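(* Let $f\colon R\hookrightarrow S$ be an annular conformal embedding of Riemann surfaces. Then there is a constant $K<1$ such that for any quadratic differential $q\in\mathcal Q(S)$, $$A_{f^*q}(R)\le K\,A_q(S).$$ Furthermore, the constant $K$ can be chosen uniformly under finite covers, in the sense that for any finite cover $\widetilde f\colon\widetilde R\to\widetilde S$ of $f$ and any quadratic differential $\widetilde q\in\mathcal Q(\widetilde S)$, $$A_{\widetilde f^*\widetilde q}(\widetilde R)\le K\,A_{\widetilde q}(\widetilde S).$$
   Context: **Surfaces.** A surface $S$ is a smooth, oriented, compact 2-manifold $\overline S$ with (possibly empty) boundary $\partial S$, not necessarily connected, together with a finite set $P$ of distinguished points, the punctures. Its interior is $S^\circ := S\setminus(P\cup\partial S)$. A Riemann surface is a surface with a complex structure on $\overline S$. A conformal embedding $R\hookrightarrow S$ is an injective holomorphic map $R^\circ\to S^\circ$ that extends to a continuous map $\overline R\to\overline S$. **Annular embeddings.** An annular extension of a Riemann surface $R$ is a Riemann surface $\widehat R$ obtained by attaching a non-empty conformal annulus to each boundary component, with the boundary of $R$ smoothly embedded in $\widehat R$. A conformal embedding $R\hookrightarrow S$ is annular if it extends to a conformal embedding $\widehat R\hookrightarrow S$ for some annular extension $\widehat R$ of $R$. **Quadratic differentials.** A quadratic differential $q$ on $S$ is a holomorphic section of the square of the holomorphic cotangent bundle of $S^\circ$, locally $q=\phi(z)\,(dz)^2$. Its area measure $A_q$ is locally $|\phi(z)|$ times Lebesgue measure. $\mathcal Q(S)$ is the vector space of quadratic differentials on $S$ of finite total area that extend analytically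 to $\partial S$ (but not necessarily to the punctures, where they have at most simple poles). **Covers.** Given a covering map $p\colon\widetilde S\to S$, the corresponding cover of $f$ is the pull-back map $\widetilde f\colon\widetilde R\hookrightarrow\widetilde S$, where $\widetilde R:=\{(r,\widetilde s)\in R\times\widetilde S : f(r)=p(\widetilde s)\}$ and $\widetilde f(r,\widetilde s):=\widetilde s$; the projection $(r,\widetilde s)\mapsto r$ is a covering map $\widetilde R\to R$, and complex structures are lifted. The cover is finite if $p$ has finite degree.
   Formalization: Every component of R is assumed to have non-empty boundary (otherwise the identity of a closed torus is a counterexample); covers are unbranched, also at punctures, and are carried on S × ℕ, to which every finite cover is isomorphic. *)

theory Defs
  imports "HOL-Complex_Analysis.Complex_Analysis"
begin

(* A bordered surface with punctures, carried by an abstract topology. The underlying space is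
   the compact surface: it contains the boundary and the punctures. The atlas is any holomorphic
   atlas of charts into the closed upper half-plane; it need not be maximal. *)

type_synonym 'a chart = "'a set \<times> ('a \<Rightarrow> complex)"

record 'a surf =
  surf_top :: "'a topology"
  surf_atlas :: "'a chart set"
  surf_punctures :: "'a set"

definition half_plane :: "complex set" where
  "half_plane = {z. 0 \<le> Im z}"

definition surf_boundary :: "'a surf \<Rightarrow> 'a set" where
  "surf_boundary S =
     {x. \<exists>(U, \<phi>) \<in> surf_atlas S. x \<in> U \<and> Im (\<phi> x) = 0}"

definition surf_interior :: "'a surf \<Rightarrow> 'a set" where
  "surf_interior S = topspace (surf_top S) - (surf_punctures S \<union> surf_boundary S)"

(* Near x, the restriction of F to D is a holomorphic function of the coordinate phi.
   If x is an interior point of D this is ordinary holomorphy at x; if phi x is real, it says that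
   F extends holomorphically across the real axis. The value at x matters only if x is in D. *)
definition holomorphic_in_chart ::
    "('a \<Rightarrow> complex) \<Rightarrow> 'a set \<Rightarrow> 'a \<Rightarrow> ('a \<Rightarrow> complex) \<Rightarrow> bool" where
  "holomorphic_in_chart \<phi> D x F \<longleftrightarrow>
     (\<exists>e>0. \<exists>g. g holomorphic_on ball (\<phi> x) e \<and>
        (\<forall>y\<in>D. \<phi> y \<in> ball (\<phi> x) e \<longrightarrow> F y = g (\<phi> y)))"

(* Smoothness and orientation are those induced by the complex structure. *)
definition riemann_surface :: "'a surf \<Rightarrow> bool" where
  "riemann_surface S \<longleftrightarrow>
     compact_space (surf_top S) \<and> Hausdorff_space (surf_top S) \<and>
     (\<forall>(U, \<phi>) \<in> surf_atlas S.
        openin (surf_top S) U \<and>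
        openin (top_of_set half_plane) (\<phi> ` U) \<and>
        homeomorphic_map (subtopology (surf_top S) U) (top_of_set (\<phi> ` U)) \<phi>) \<and>
     (\<Union>(U, \<phi>) \<in> surf_atlas S. U) = topspace (surf_top S) \<and>
     (\<forall>(U, \<phi>) \<in> surf_atlas S. \<forall>(V, \<psi>) \<in> surf_atlas S.
        \<forall>x \<in> U \<inter> V. holomorphic_in_chart \<phi> (U \<inter> V) x \<psi>) \<and>
     finite (surf_punctures S) \<and>
     surf_punctures S \<subseteq> topspace (surf_top S) - surf_boundary S"

definition holomorphic_map_at :: "'a surf \<Rightarrow> 'b surf \<Rightarrow> ('a \<Rightarrow> 'b) \<Rightarrow> 'a \<Rightarrow> bool" where
  "holomorphic_map_at R S f x \<longleftrightarrow>
     (\<forall>(U, \<phi>) \<in> surf_atlas R. \<forall>(V, \<psi>) \<in> surf_atlas S. x \<in> U \<and> f x \<in> V \<longrightarrow>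
        holomorphic_in_chart \<phi> {y \<in> U. f y \<in> V} x (\<lambda>y. \<psi> (f y)))"

(* An embedding is represented by its (unique) continuous extension to the compact surface;
   injectivity and holomorphy are required on the interior only. *)
definition conformal_embedding :: "'a surf \<Rightarrow> 'b surf \<Rightarrow> ('a \<Rightarrow> 'b) \<Rightarrow> bool" where
  "conformal_embedding R S f \<longleftrightarrow>
     continuous_map (surf_top R) (surf_top S) f \<and>
     f ` surf_interior R \<subseteq> surf_interior S \<and>
     inj_on f (surf_interior R) \<and>
     (\<forall>x \<in> surf_interior R. holomorphic_map_at R S f x)"

(* C-infinity near t, with non-zero velocity at t; D n is the n-th derivative. *)
definition smooth_immersed_at :: "(real \<Rightarrow> complex) \<Rightarrow> real \<Rightarrow> bool" where
  "smooth_immersed_at \<gamma> t \<longleftrightarrow>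
     (\<exists>e>0. \<exists>D :: nat \<Rightarrow> real \<Rightarrow> complex.
        (\<forall>s \<in> ball t e. D 0 s = \<gamma> s) \<and>
        (\<forall>n. \<forall>s \<in> ball t e. (D n has_vector_derivative D (Suc n) s) (at s)) \<and>
        D 1 t \<noteq> 0)"

definition boundary_components :: "'a surf \<Rightarrow> 'a set set" where
  "boundary_components R = connected_components_of (subtopology (surf_top R) (surf_boundary R))"

(* Every compact annulus bounded by Jordan curves in a Riemann surface is parametrised by some
   conf_annulus r, holomorphically inside and homeomorphically up to the boundary. *)
definition conf_annulus :: "real \<Rightarrow> complex set" where
  "conf_annulus r = {z. 1 \<le> cmod z \<and> cmod z \<le> r}"

(* i is the inclusion of R in Rh; a C parametrises the annulus attached along the boundary
   component C. *)
definition annular_extension :: "'a surf \<Rightarrow> 'c surf \<Rightarrow> ('a \<Rightarrow> 'c) \<Rightarrow> bool" where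
  "annular_extension R Rh i \<longleftrightarrow>
     riemann_surface Rh \<and>
     conformal_embedding R Rh i \<and>
     inj_on i (topspace (surf_top R)) \<and>
     surf_punctures Rh = i ` surf_punctures R \<and>
     (\<forall>x \<in> surf_boundary R. \<forall>(U, \<phi>) \<in> surf_atlas R. \<forall>(V, \<psi>) \<in> surf_atlas Rh.
        x \<in> U \<and> i x \<in> V \<longrightarrow>
        smooth_immersed_at (\<lambda>t. \<psi> (i (inv_into U \<phi> (complex_of_real t)))) (Re (\<phi> x))) \<and>
     (\<exists>(r :: 'a set \<Rightarrow> real) (a :: 'a set \<Rightarrow> complex \<Rightarrow> 'c).
        (\<forall>C \<in> boundary_components R.
           1 < r C \<and>
           continuous_map (top_of_set (conf_annulus (r C))) (surf_top Rh) (a C) \<and>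
           inj_on (a C) (conf_annulus (r C)) \<and>
           (\<forall>z. 1 < cmod z \<and> cmod z < r C \<longrightarrow>
              (\<forall>(V, \<psi>) \<in> surf_atlas Rh. a C z \<in> V \<longrightarrow> (\<lambda>w. \<psi> (a C w)) analytic_on {z})) \<and>
           a C ` sphere 0 1 = i ` C \<and>
           a C ` conf_annulus (r C) \<inter> i ` topspace (surf_top R) = i ` C) \<and>
        disjoint_family_on (\<lambda>C. a C ` conf_annulus (r C)) (boundary_components R) \<and>
        topspace (surf_top Rh) =
          i ` topspace (surf_top R) \<union> (\<Union>C \<in> boundary_components R. a C ` conf_annulus (r C)) \<and>
        surf_boundary Rh = (\<Union>C \<in> boundary_components R. a C ` sphere 0 (r C)))"

(* The type argument is the type carrying the annular extension. Up to isomorphism, every annular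
   extension of R lives on 'a + nat \<times> complex. To a component of R without boundary nothing is
   attached, so the identity of a closed surface is annular in this sense. *)
definition annular_embedding :: "'c itself \<Rightarrow> 'a surf \<Rightarrow> 'b surf \<Rightarrow> ('a \<Rightarrow> 'b) \<Rightarrow> bool" where
  "annular_embedding _ R S f \<longleftrightarrow>
     conformal_embedding R S f \<and>
     (\<exists>(Rh :: 'c surf) i fh.
        annular_extension R Rh i \<and> conformal_embedding Rh S fh \<and>
        (\<forall>x \<in> topspace (surf_top R). fh (i x) = f x))"

(* q c x is the coefficient, at the point x, of the differential in the chart c; it is meaningful
   for c in the atlas and x in the domain of c and in the interior of the surface. *)
type_synonym 'a qdiff = "'a chart \<Rightarrow> 'a \<Rightarrow> complex"

definition quadratic_differential :: "'a surf \<Rightarrow> 'a qdiff \<Rightarrow> bool" where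
  "quadratic_differential S q \<longleftrightarrow>
     (\<forall>(U, \<phi>) \<in> surf_atlas S. \<forall>x \<in> U \<inter> surf_interior S.
        holomorphic_in_chart \<phi> (U \<inter> surf_interior S) x (q (U, \<phi>))) \<and>
     (\<forall>(U, \<phi>) \<in> surf_atlas S. \<forall>(V, \<psi>) \<in> surf_atlas S. \<forall>x \<in> U \<inter> V \<inter> surf_interior S.
        q (U, \<phi>) x = q (V, \<psi>) x * (deriv (\<psi> \<circ> inv_into U \<phi>) (\<phi> x))\<^sup>2)"

definition extends_to_boundary :: "'a surf \<Rightarrow> 'a qdiff \<Rightarrow> bool" where
  "extends_to_boundary S q \<longleftrightarrow>
     (\<forall>(U, \<phi>) \<in> surf_atlas S. \<forall>x \<in> U \<inter> surf_boundary S.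
        holomorphic_in_chart \<phi> (U \<inter> surf_interior S) x (q (U, \<phi>)))"

definition is_area_measure :: "'a surf \<Rightarrow> 'a qdiff \<Rightarrow> 'a measure \<Rightarrow> bool" where
  "is_area_measure S q M \<longleftrightarrow>
     space M = surf_interior S \<and>
     sets M = sigma_sets (surf_interior S) {W. openin (surf_top S) W \<and> W \<subseteq> surf_interior S} \<and>
     (\<forall>(U, \<phi>) \<in> surf_atlas S. \<forall>B \<in> sets M. B \<subseteq> U \<longrightarrow>
        emeasure M B =
          (\<integral>\<^sup>+z \<in> \<phi> ` B. ennreal (cmod (q (U, \<phi>) (inv_into U \<phi> z))) \<partial>lborel))"

(* The conditions determine the measure, since finitely many charts cover the surface; it exists
   whenever q is a quadratic differential on a Riemann surface, by the transformation law. *)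
definition area_measure :: "'a surf \<Rightarrow> 'a qdiff \<Rightarrow> 'a measure" where
  "area_measure S q = (THE M. is_area_measure S q M)"

definition area :: "'a surf \<Rightarrow> 'a qdiff \<Rightarrow> ennreal" where
  "area S q = emeasure (area_measure S q) (surf_interior S)"

(* Finite area already forces at most simple poles at the punctures. *)
definition QD :: "'a surf \<Rightarrow> 'a qdiff set" where
  "QD S = {q. quadratic_differential S q \<and> extends_to_boundary S q \<and> area S q < \<infinity>}"

(* By the transformation law of q, the result does not depend on the chosen chart at f x. *)
definition pullback_qd :: "'a surf \<Rightarrow> 'b surf \<Rightarrow> ('a \<Rightarrow> 'b) \<Rightarrow> 'b qdiff \<Rightarrow> 'a qdiff" where
  "pullback_qd R S f q = (\<lambda>(U, \<phi>) x.
     let (V, \<psi>) = (SOME c. c \<in> surf_atlas S \<and> f x \<in> fst c)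
     in q (V, \<psi>) (f x) * (deriv (\<psi> \<circ> f \<circ> inv_into U \<phi>) (\<phi> x))\<^sup>2)"

(* covering_space of HOL-Analysis, for abstract topologies *)
definition covering_map_of :: "'a topology \<Rightarrow> 'b topology \<Rightarrow> ('a \<Rightarrow> 'b) \<Rightarrow> bool" where
  "covering_map_of X Y p \<longleftrightarrow>
     continuous_map X Y p \<and> p ` topspace X = topspace Y \<and>
     (\<forall>y \<in> topspace Y. \<exists>T. y \<in> T \<and> openin Y T \<and>
        (\<exists>v. \<Union>v = {x \<in> topspace X. p x \<in> T} \<and>
             (\<forall>V \<in> v. openin X V) \<and>
             pairwise disjnt v \<and>
             (\<forall>V \<in> v. homeomorphic_map (subtopology X V) (subtopology Y T) p)))"

(* The covering map is unbranched on the whole compact surface; the punctures of the cover are the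
   points above punctures. If branching over punctures were allowed, no constant could be
   uniform: under w \<mapsto> w ^ k on the unit disc punctured at 0, the subdisc of radius 1/2 lifts to
   that of radius (1/2) powr (1/k), and the area ratio for (dw)^2 tends to 1 as k grows.
   A finite cover of S :: 'b surf is isomorphic to one on 'b \<times> nat, as its fibres are finite. *)
definition finite_cover :: "'d surf \<Rightarrow> 'b surf \<Rightarrow> ('d \<Rightarrow> 'b) \<Rightarrow> bool" where
  "finite_cover St S p \<longleftrightarrow>
     riemann_surface St \<and>
     covering_map_of (surf_top St) (surf_top S) p \<and>
     (\<forall>s \<in> topspace (surf_top S). finite {x \<in> topspace (surf_top St). p x = s}) \<and>
     (\<forall>x \<in> topspace (surf_top St). holomorphic_map_at St S p x) \<and>
     surf_punctures St = {x \<in> topspace (surf_top St). p x \<in> surf_punctures S}"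

(* The fibre product of f and p. It covers R by fst, and its charts are the lifts of charts of R
   to open sets on which fst is injective. The corresponding cover of f is snd. *)
definition pullback_surf :: "'a surf \<Rightarrow> 'd surf \<Rightarrow> ('a \<Rightarrow> 'b) \<Rightarrow> ('d \<Rightarrow> 'b) \<Rightarrow> ('a \<times> 'd) surf" where
  "pullback_surf R St f p =
     (let X = subtopology (prod_topology (surf_top R) (surf_top St)) {(r, s). f r = p s}
      in \<lparr>surf_top = X,
          surf_atlas = {(W, \<phi> \<circ> fst) | W U \<phi>.
             (U, \<phi>) \<in> surf_atlas R \<and> openin X W \<and> inj_on fst W \<and> fst ` W \<subseteq> U},
          surf_punctures = {x \<in> topspace X. fst x \<in> surf_punctures R}\<rparr>)"

end

theory Submission
  imports Defs
begin

text \<open>Call a set \<open>N\<close> controlled if for every \<open>\<epsilon> > 0\<close> there is \<open>C\<close> such that, in every finite cover, the area over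
  \<open>N\<close> is at most \<open>\<epsilon>\<close> times the total area plus \<open>C\<close> times the area over the complement of \<open>f(R)\<close>. By
  Montel's theorem, the mass of an integrable holomorphic function on a punctured disc satisfies
  such a bound on a smaller concentric disc in terms of its mass on any non-empty open subset. Discs
  lift homeomorphically to every cover and the bound is linear in the masses, so it sums over the
  sheets without loss: a small disc is controlled as soon as some open part of it is. Hence the
  points with a controlled neighbourhood form a set that is open and closed in the surface minus its
  boundary. Each component of \<open>R\<close> has a boundary point, which the annular extension places in the
  closure of the complement of \<open>f(R)\<close>; by connectedness and compactness \<open>f(R)\<close> is controlled.
  With \<open>\<epsilon> = 1/2\<close>, \<open>m \<le> T/2 + C (T - m)\<close> gives \<open>K = (1/2 + C)/(1 + C)\<close>.\<close>

section \<open>Change of variables for holomorphic maps\<close>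

text \<open>The term in \<epsilon> is forced: on a fixed disc the mass of a holomorphic function is
  not bounded by a multiple of its mass on a smaller open set, as the powers of a linear function
  show. What can be had is such a bound up to an arbitrarily small part of the total. As \<epsilon>
  is quantified before \<open>C\<close>, the property survives each passage from one disc to the
  next, where the old \<epsilon> is multiplied by the new constant and has only to be chosen small
  enough beforehand. Integrable differentials may have simple poles at punctures, which is why the
  discs are punctured at their centres. Controlled areas are compared with the complement of the
  image of the interior of \<open>R\<close>, because its preimage in a cover is exactly what is left
  of the interior there, so that the two areas add up to the total. A component of \<open>R\<close>
  without boundary has to be excluded: the identity of a torus preserves all areas. Discs and
  constants are chosen on \<open>S\<close>, before any cover is given; a cover only contributes the
  number of sheets, over which a linear inequality is summed.\<close>

definition vec2_of_complex :: "complex \<Rightarrow> real^2" where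
  "vec2_of_complex z = vector [Re z, Im z]"

definition complex_of_vec2 :: "real^2 \<Rightarrow> complex" where
  "complex_of_vec2 v = Complex (v$1) (v$2)"

lemma complex_vec2_inverse [simp]:
  "complex_of_vec2 (vec2_of_complex z) = z" "vec2_of_complex (complex_of_vec2 v) = v"
  by (simp_all add: vec2_of_complex_def complex_of_vec2_def vec_eq_iff forall_2 complex_eq_iff)

lemma linear_vec2_of_complex: "linear vec2_of_complex"
  by (rule linearI) (simp_all add: vec2_of_complex_def vec_eq_iff forall_2)

lemma linear_complex_of_vec2: "linear complex_of_vec2"
  by (rule linearI) (simp_all add: complex_of_vec2_def complex_eq_iff)

lemma continuous_on_vec2: "continuous_on A vec2_of_complex" "continuous_on B complex_of_vec2"
  using linear_vec2_of_complex linear_complex_of_vec2 linear_continuous_on linear_linear by blast+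

lemma measurable_vec2 [measurable]:
  "vec2_of_complex \<in> borel_measurable borel" "complex_of_vec2 \<in> borel_measurable borel"
  using continuous_on_vec2 borel_measurable_continuous_onI by blast+

lemma box_vec2: "complex_of_vec2 -` box a b = box (vec2_of_complex a) (vec2_of_complex b)"
  by (auto simp: in_box_complex_iff mem_box_cart forall_2 complex_of_vec2_def vec2_of_complex_def)

text \<open>Boxes correspond to boxes of the same volume, and this determines Lebesgue measure. The
  plane is carried to \<open>real^2\<close> because the change of variables theorem is expressed by
  determinants of matrices.\<close>

lemma distr_complex_of_vec2: "distr lborel borel complex_of_vec2 = lborel"
proof (rule lborel_eqI[symmetric])
  fix l u :: complex
  assume lu: "\<And>b. b \<in> Basis \<Longrightarrow> l \<bullet> b \<le> u \<bullet> b"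
  have B: "(Basis :: (real^2) set) = {axis 1 1, axis 2 1}"
    unfolding Basis_vec_def UNIV_2 by (simp add: insert_commute)
  have le: "Re l \<le> Re u" "Im l \<le> Im u" using lu[of 1] lu[of "\<i>"] by (auto simp: Basis_complex_def)
  have "emeasure (distr lborel borel complex_of_vec2) (box l u)
      = emeasure lborel (box (vec2_of_complex l) (vec2_of_complex u))"
    by (subst emeasure_distr) (auto simp: box_vec2)
  also have "\<dots> = ennreal (\<Prod>b\<in>Basis. (vec2_of_complex u - vec2_of_complex l) \<bullet> b)"
  proof (rule emeasure_lborel_box)
    fix b :: "real^2" assume "b \<in> Basis"
    then show "vec2_of_complex l \<bullet> b \<le> vec2_of_complex u \<bullet> b"
      using le unfolding B by (elim insertE emptyE) (simp_all add: inner_axis vec2_of_complex_def)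
  qed
  also have "(\<Prod>b\<in>Basis. (vec2_of_complex u - vec2_of_complex l) \<bullet> b) = (\<Prod>b\<in>Basis. (u - l) \<bullet> b)"
  proof -
    have "axis 1 (1::real) \<noteq> (axis 2 1 :: real^2)"
      by (simp add: axis_eq_axis)
    then show ?thesis
      by (simp add: B Basis_complex_def inner_axis vec2_of_complex_def)
  qed
  finally show "emeasure (distr lborel borel complex_of_vec2) (box l u) = ennreal (\<Prod>b\<in>Basis. (u - l) \<bullet> b)" .
qed simp

lemma nn_integral_complex_vec2:
  assumes [measurable]: "f \<in> borel_measurable borel"
  shows "(\<integral>\<^sup>+z. f z \<partial>lborel) = (\<integral>\<^sup>+v. f (complex_of_vec2 v) \<partial>lborel)"
  by (subst distr_complex_of_vec2[symmetric], subst nn_integral_distr) auto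

text \<open>The real Jacobian of a holomorphic map is the squared modulus of its derivative. This is
  the factor that makes the area of a quadratic differential independent of the coordinate.\<close>

lemma det_complex_mult:
  "det (matrix (\<lambda>v. vec2_of_complex (d * complex_of_vec2 v))) = (cmod d)\<^sup>2"
  by (simp add: det_2 matrix_def axis_def vec2_of_complex_def complex_of_vec2_def cmod_power2)
     (simp add: power2_eq_square)

text \<open>The change of variables theorem speaks of absolute integrability, areas are integrals
  with values in \<open>ennreal\<close>. Since \<infinity> stands exactly for the failure of
  integrability, an equality of two such expressions includes the infinite case.\<close>

lemma set_nn_integral_eq_absolutely_integrable:
  fixes F :: "real^'n \<Rightarrow> real"
  assumes [measurable]: "(\<lambda>x. indicator A x * F x) \<in> borel_measurable borel" and nn: "\<And>x. 0 \<le> F x"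
  shows "(\<integral>\<^sup>+x\<in>A. ennreal (F x) \<partial>lborel) =
           (if F absolutely_integrable_on A then ennreal (integral A F) else \<infinity>)"
proof -
  let ?G = "\<lambda>x. indicator A x * F x"
  have m: "?G \<in> borel_measurable lebesgue" using assms(1) by (simp add: borel_measurable_if_D measurable_completion)
  have e: "(\<integral>\<^sup>+x\<in>A. ennreal (F x) \<partial>lborel) = (\<integral>\<^sup>+x. ennreal (?G x) \<partial>lebesgue)"
    by (subst nn_integral_completion) (auto intro!: nn_integral_cong simp: indicator_def)
  show ?thesis
  proof (cases "F absolutely_integrable_on A")
    case True
    then have i: "integrable lebesgue ?G" by (simp add: set_integrable_def)
    have "(\<integral>\<^sup>+x. ennreal (?G x) \<partial>lebesgue) = ennreal (integral\<^sup>L lebesgue ?G)"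
      by (rule nn_integral_eq_integral[OF i]) (simp add: nn)
    also have "integral\<^sup>L lebesgue ?G = integral A F"
      using set_lebesgue_integral_eq_integral(2)[OF True] by (simp add: set_lebesgue_integral_def)
    finally show ?thesis using True e by simp
  next
    case False
    then have "\<not> integrable lebesgue ?G" by (simp add: set_integrable_def)
    then have "\<not> (\<integral>\<^sup>+x. ennreal (?G x) \<partial>lebesgue) < \<infinity>"
      using integrableI_nonneg[OF m] nn by auto
    then have "(\<integral>\<^sup>+x. ennreal (?G x) \<partial>lebesgue) = \<infinity>"
      by (simp add: less_top[symmetric])
    then show ?thesis using False e by simp
  qed
qed

lemma set_nn_integral_change_of_variables_vec2:
  fixes k :: "real^2 \<Rightarrow> real^2" and F :: "real^2 \<Rightarrow> real"
  assumes S: "S \<in> sets borel"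
    and der: "\<And>x. x \<in> S \<Longrightarrow> (k has_derivative k' x) (at x)"
    and inj: "inj_on k S" and nn: "\<And>x. 0 \<le> F x"
    and m1: "(\<lambda>x. indicator (k ` S) x * F x) \<in> borel_measurable borel"
    and m2: "(\<lambda>x. indicator S x * (\<bar>det (matrix (k' x))\<bar> * F (k x))) \<in> borel_measurable borel"
  shows "(\<integral>\<^sup>+x\<in>k ` S. ennreal (F x) \<partial>lborel) = (\<integral>\<^sup>+x\<in>S. ennreal (\<bar>det (matrix (k' x))\<bar> * F (k x)) \<partial>lborel)"
proof -
  let ?G = "\<lambda>x. \<bar>det (matrix (k' x))\<bar> * F (k x)"
  have S': "S \<in> sets lebesgue" using S by (simp add: sets_completionI_sets)
  \<comment> \<open>The theorem is about vector-valued integrands, so scalars enter as vectors of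
    \<open>real^1\<close>. Being an equivalence for an arbitrary value \<open>b\<close>, it
    transfers integrability as well as the value.\<close>
  have *: "(?G absolutely_integrable_on S \<and> integral S ?G = b) \<longleftrightarrow>
         (F absolutely_integrable_on k ` S \<and> integral (k ` S) F = b)" for b
  proof -
    have "((\<lambda>x. \<bar>det (matrix (k' x))\<bar> *\<^sub>R (vec (F (k x)) :: real^1)) absolutely_integrable_on S \<and>
          integral S (\<lambda>x. \<bar>det (matrix (k' x))\<bar> *\<^sub>R (vec (F (k x)) :: real^1)) = vec b) \<longleftrightarrow>
         ((\<lambda>x. vec (F x) :: real^1) absolutely_integrable_on k ` S \<and> integral (k ` S) (\<lambda>x. vec (F x) :: real^1) = vec b)"
      by (rule has_absolute_integral_change_of_variables[OF S' _ inj])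
         (use der has_derivative_at_withinI in blast)
    then show ?thesis
      by (simp add: absolutely_integrable_on_1_iff integral_on_1_eq vec_eq_iff absolutely_integrable_on_def integrable_on_1_iff)
  qed
  have **: "?G absolutely_integrable_on S \<longleftrightarrow> F absolutely_integrable_on k ` S"
    "?G absolutely_integrable_on S \<Longrightarrow> integral S ?G = integral (k ` S) F"
    using * by blast+
  show ?thesis
    unfolding set_nn_integral_eq_absolutely_integrable[OF m1 nn]
    by (subst set_nn_integral_eq_absolutely_integrable[OF m2])
       (use nn ** in \<open>simp_all del: real_scaleR_def cong: if_cong\<close>)
qed

text \<open>The image is a preimage under the holomorphic inverse, which is continuous on an open
  set and is extended by 0 to a Borel function on the plane.\<close>

lemma inj_holomorphic_image_borel:
  assumes "open \<Omega>" "k holomorphic_on \<Omega>" "inj_on k \<Omega>" "E \<in> sets borel" "E \<subseteq> \<Omega>"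
  shows "k ` E \<in> sets borel"
proof -
  obtain h where h: "h holomorphic_on k ` \<Omega>" "\<And>z. z \<in> \<Omega> \<Longrightarrow> h (k z) = z"
    using holomorphic_has_inverse[OF assms(2,1,3)] by metis
  have op: "open (k ` \<Omega>)"
    using assms(1-3) holomorphic_on_imp_continuous_on invariance_of_domain by blast
  have "(\<lambda>w. if w \<in> k ` \<Omega> then h w else 0) \<in> borel_measurable borel"
    by (rule borel_measurable_continuous_on_if) (use op h holomorphic_on_imp_continuous_on in auto)
  then have "(\<lambda>w. if w \<in> k ` \<Omega> then h w else 0) -` E \<inter> k ` \<Omega> \<in> sets borel"
    using assms(4) op by (intro sets.Int measurable_sets_borel) auto
  moreover have "(\<lambda>w. if w \<in> k ` \<Omega> then h w else 0) -` E \<inter> k ` \<Omega> = k ` E"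
  proof (intro set_eqI iffI)
    fix w assume "w \<in> (\<lambda>w. if w \<in> k ` \<Omega> then h w else 0) -` E \<inter> k ` \<Omega>"
    then obtain z where "z \<in> \<Omega>" "w = k z" "h w \<in> E" by auto
    then show "w \<in> k ` E" using h(2) by simp
  next
    fix w assume "w \<in> k ` E"
    then obtain z where "z \<in> E" "w = k z" by auto
    then show "w \<in> (\<lambda>w. if w \<in> k ` \<Omega> then h w else 0) -` E \<inter> k ` \<Omega>"
      using h(2) assms(5) by (simp add: subset_iff image_eqI)
  qed
  ultimately show ?thesis by simp
qed

lemma set_nn_integral_holomorphic_image:
  fixes g :: "complex \<Rightarrow> real"
  assumes \<Omega>: "open \<Omega>" and k: "k holomorphic_on \<Omega>" "inj_on k \<Omega>"
    and E: "E \<in> sets borel" "E \<subseteq> \<Omega>" and nn: "\<And>w. 0 \<le> g w"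
    and g: "(\<lambda>w. indicator (k ` \<Omega>) w * g w) \<in> borel_measurable borel"
  shows "(\<integral>\<^sup>+w\<in>k ` E. ennreal (g w) \<partial>lborel) = (\<integral>\<^sup>+z\<in>E. ennreal (g (k z) * (cmod (deriv k z))\<^sup>2) \<partial>lborel)"
proof -
  let ?T = vec2_of_complex and ?T' = complex_of_vec2
  have kE: "k ` E \<in> sets borel" by (rule inj_holomorphic_image_borel[OF \<Omega> k E])
  \<comment> \<open>\<open>K\<close>, \<open>D\<close> and \<open>G\<close> are cut off by 0 so as
    to be Borel on the whole plane; on \<open>E\<close> and its image nothing changes.\<close>
  define K where "K = (\<lambda>z. if z \<in> \<Omega> then k z else 0)"
  define D where "D = (\<lambda>z. if z \<in> \<Omega> then deriv k z else 0)"
  define G where "G = (\<lambda>w. indicator (k ` \<Omega>) w * g w)"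
  have [measurable]: "G \<in> borel_measurable borel" using g by (simp add: G_def)
  have [measurable]: "K \<in> borel_measurable borel" unfolding K_def
    by (rule borel_measurable_continuous_on_if) (use \<Omega> k holomorphic_on_imp_continuous_on in auto)
  have [measurable]: "D \<in> borel_measurable borel" unfolding D_def
    by (rule borel_measurable_continuous_on_if)
       (use \<Omega> k holomorphic_deriv holomorphic_on_imp_continuous_on in auto)
  have [measurable]: "E \<in> sets borel" "k ` E \<in> sets borel" by fact+
  have e1: "indicator (k ` E) w * g w = indicator (k ` E) w * G w" for w
    using E(2) by (auto simp: G_def indicator_def)
  have e2: "indicator E z * ((cmod (deriv k z))\<^sup>2 * g (k z)) = indicator E z * ((cmod (D z))\<^sup>2 * G (K z))" for z
    using E(2) by (auto simp: G_def K_def D_def indicator_def)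
  let ?k = "\<lambda>v. ?T (k (?T' v))"
  let ?k' = "\<lambda>v u. ?T (deriv k (?T' v) * ?T' u)"
  have inT: "x \<in> ?T ` A \<longleftrightarrow> ?T' x \<in> A" for x A
    by (metis complex_vec2_inverse imageE image_eqI)
  have im: "?k ` ?T ` E = ?T ` k ` E" by (simp add: image_image)
  have TE: "?T ` E \<in> sets borel"
  proof -
    have "?T ` E = ?T' -` E" using inT by auto
    then show ?thesis by (metis E(1) measurable_vec2(2) measurable_sets_borel)
  qed
  have ind: "indicator (?T ` A) x = (indicator A (?T' x) :: real)"
      "indicator (?T ` A) x = (indicator A (?T' x) :: ennreal)" for x A
    by (simp_all add: indicator_def inT)
  have "(\<integral>\<^sup>+w\<in>k ` E. ennreal (g w) \<partial>lborel) = (\<integral>\<^sup>+w. ennreal (indicator (k ` E) w * G w) \<partial>lborel)"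
    by (rule nn_integral_cong) (use e1 in \<open>auto simp: indicator_def\<close>)
  also have "\<dots> = (\<integral>\<^sup>+v. ennreal (indicator (k ` E) (?T' v) * G (?T' v)) \<partial>lborel)"
    by (subst nn_integral_complex_vec2) auto
  also have "\<dots> = (\<integral>\<^sup>+v\<in>?k ` ?T ` E. ennreal (g (?T' v)) \<partial>lborel)"
    unfolding im ind by (rule nn_integral_cong) (use e1 in \<open>auto simp: indicator_def\<close>)
  also have "\<dots> = (\<integral>\<^sup>+v\<in>?T ` E. ennreal (\<bar>det (matrix (?k' v))\<bar> * g (?T' (?k v))) \<partial>lborel)"
  proof (rule set_nn_integral_change_of_variables_vec2[OF TE])
    fix x assume "x \<in> ?T ` E"
    then have "?T' x \<in> \<Omega>" using E(2) inT by blast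
    then have "(k has_derivative (\<lambda>u. deriv k (?T' x) * u)) (at (?T' x))"
      using k(1) \<Omega> holomorphic_derivI has_field_derivative_def by blast
    moreover have "(?T' has_derivative ?T') (at x)"
      using linear_complex_of_vec2 linear_imp_has_derivative by blast
    ultimately have "((\<lambda>v. k (?T' v)) has_derivative (\<lambda>u. deriv k (?T' x) * ?T' u)) (at x)"
      using has_derivative_compose by blast
    moreover have "(?T has_derivative ?T) (at (k (?T' x)))"
      using linear_vec2_of_complex linear_imp_has_derivative by blast
    ultimately show "(?k has_derivative ?k' x) (at x)"
      using has_derivative_compose by blast
  next
    show "inj_on ?k (?T ` E)"
    proof (rule inj_onI)
      fix x y assume xy: "x \<in> ?T ` E" "y \<in> ?T ` E" "?k x = ?k y"
      then have "k (?T' x) = k (?T' y)" by (metis complex_vec2_inverse(1))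
      then have "?T' x = ?T' y" using xy inT E(2) k(2) by (meson inj_onD subsetD)
      then show "x = y" by (metis complex_vec2_inverse(2))
    qed
    show "0 \<le> g (?T' x)" for x by (rule nn)
    show "(\<lambda>x. indicator (?k ` ?T ` E) x * g (?T' x)) \<in> borel_measurable borel"
      unfolding im ind e1 by measurable
    show "(\<lambda>x. indicator (?T ` E) x * (\<bar>det (matrix (?k' x))\<bar> * g (?T' (?k x)))) \<in> borel_measurable borel"
      unfolding ind det_complex_mult complex_vec2_inverse abs_power2 e2 by measurable
  qed
  also have "\<dots> = (\<integral>\<^sup>+v. ennreal (indicator E (?T' v) * ((cmod (D (?T' v)))\<^sup>2 * G (K (?T' v)))) \<partial>lborel)"
    unfolding ind det_complex_mult complex_vec2_inverse abs_power2 e2[symmetric]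
    by (rule nn_integral_cong) (simp add: indicator_def)
  also have "\<dots> = (\<integral>\<^sup>+z. ennreal (indicator E z * ((cmod (D z))\<^sup>2 * G (K z))) \<partial>lborel)"
    by (rule nn_integral_complex_vec2[symmetric]) measurable
  also have "\<dots> = (\<integral>\<^sup>+z\<in>E. ennreal (g (k z) * (cmod (deriv k z))\<^sup>2) \<partial>lborel)"
    unfolding e2[symmetric] by (rule nn_integral_cong) (auto simp: indicator_def mult.commute)
  finally show ?thesis .
qed

section \<open>Area estimates on discs\<close>

abbreviation mass :: "(complex \<Rightarrow> complex) \<Rightarrow> complex set \<Rightarrow> ennreal" where
  "mass h A \<equiv> \<integral>\<^sup>+z\<in>A. ennreal (cmod (h z)) \<partial>lborel"

section \<open>Mean value inequalities over circles and discs\<close>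

lemma emeasure_ball_complex: "0 \<le> r \<Longrightarrow> emeasure lborel (ball (c::complex) r) = ennreal (pi * r\<^sup>2)"
  by (simp add: emeasure_ball unit_ball_vol_2 mult.commute)

text \<open>Cauchy's formula on the unit circle for the function taking \<open>u\<close> to
  \<open>g (c + u * z)\<close>. The circle is given by a complex \<open>z\<close> and not by a
  radius, so that the inequality can be averaged over all \<open>z\<close> in a disc.\<close>

lemma cmod_le_circle_mean:
  assumes hol: "g holomorphic_on ball c r" and z: "z \<in> ball 0 r"
  shows "ennreal (cmod (g c)) \<le>
    (\<integral>\<^sup>+t\<in>{0..1}. ennreal (cmod (g (c + exp (2 * of_real pi * \<i> * of_real t) * z))) \<partial>lborel)"
proof -
  define f where "f = (\<lambda>u. g (c + u * z))"
  let ?e = "\<lambda>t::real. exp (2 * of_real pi * \<i> * of_real t)"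
  have sub: "(\<lambda>u. c + u * z) ` cball 0 1 \<subseteq> ball c r"
    using z mult_left_le_one_le[of "cmod z"] by (auto simp: norm_mult dist_norm) (meson le_less_trans norm_ge_zero)
  have f: "f holomorphic_on cball 0 1" unfolding f_def
    by (rule holomorphic_on_compose_gen[OF _ hol sub, unfolded o_def]) (intro holomorphic_intros)
  then have "((\<lambda>u. f u / (u - 0)) has_contour_integral (2 * of_real pi * \<i> * f 0)) (circlepath 0 1)"
    by (rule Cauchy_integral_circlepath_simple) simp
  then have "((\<lambda>t. f (circlepath 0 1 t) / circlepath 0 1 t * vector_derivative (circlepath 0 1) (at t within {0..1}))
     has_integral (2 * of_real pi * \<i> * f 0)) {0..1}"
    by (simp add: has_contour_integral_def)
  then have "((\<lambda>t. 2 * of_real pi * \<i> * f (?e t)) has_integral (2 * of_real pi * \<i> * f 0)) {0..1}"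
    by (rule has_integral_eq[rotated]) (simp add: vector_derivative_circlepath01, simp add: circlepath)
  then have "((\<lambda>t. (1 / (2 * of_real pi * \<i>)) * (2 * of_real pi * \<i> * f (?e t))) has_integral
     (1 / (2 * of_real pi * \<i>)) * (2 * of_real pi * \<i> * f 0)) {0..1}"
    by (rule has_integral_mult_right)
  then have hi: "((\<lambda>t. f (?e t)) has_integral f 0) {0..1}" by simp
  have "continuous_on {0..1} (\<lambda>t. f (?e t))"
    by (rule continuous_on_compose2[OF holomorphic_on_imp_continuous_on[OF f]]) (auto intro!: continuous_intros)
  then have si: "set_integrable lborel {0..1} (\<lambda>t. f (?e t))" by (rule borel_integrable_atLeastAtMost')
  then have "f 0 = (LINT t:{0..1}|lborel. f (?e t))"
    using set_borel_integral_eq_integral(2) hi integral_unique by metis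
  then have "ennreal (cmod (f 0)) \<le> (\<integral>\<^sup>+t. norm (indicator {0..1} t *\<^sub>R f (?e t)) \<partial>lborel)"
    using si integral_norm_bound_ennreal unfolding set_integrable_def set_lebesgue_integral_def by metis
  also have "\<dots> = (\<integral>\<^sup>+t\<in>{0..1}. ennreal (cmod (f (?e t))) \<partial>lborel)"
    by (rule nn_integral_cong) (simp add: indicator_def)
  finally show ?thesis by (simp add: f_def)
qed

text \<open>No polar coordinates are involved. The circle means are integrated over all
  \<open>z\<close> of the disc and the integrals exchanged; for a fixed angle \<open>t\<close> the
  inner integral is then taken over the disc turned by that angle about \<open>c\<close>, which
  gives the same mass \<open>?I\<close> for every \<open>t\<close>.\<close>

lemma cmod_le_area_mean:
  assumes hol: "g holomorphic_on ball c r" and r: "0 < r"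
  shows "ennreal (pi * r\<^sup>2 * cmod (g c)) \<le> mass g (ball c r)"
proof -
  let ?e = "\<lambda>t::real. exp (2 * of_real pi * \<i> * of_real t)"
  let ?I = "\<integral>\<^sup>+z\<in>ball c r. ennreal (cmod (g z)) \<partial>lborel"
  define G where "G = (\<lambda>z. if z \<in> ball c r then g z else 0)"
  have [measurable]: "G \<in> borel_measurable borel" unfolding G_def
    by (rule borel_measurable_continuous_on_if) (use hol holomorphic_on_imp_continuous_on in auto)
  have [measurable]: "?e \<in> borel_measurable borel"
    by (intro borel_measurable_continuous_onI continuous_intros)
  have [measurable]: "ball (0::complex) r \<in> sets borel" by simp
  have ne: "cmod (?e t) = 1" for t by (simp add: norm_exp_eq_Re)
  have inb: "c + ?e t * z \<in> ball c r \<longleftrightarrow> z \<in> ball 0 r" for t z by (simp add: dist_norm norm_mult ne)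
  have I: "(\<integral>\<^sup>+z\<in>ball 0 r. ennreal (cmod (G (c + ?e t * z))) \<partial>lborel) = ?I" for t
  proof -
    have "(\<lambda>z. c + ?e t * z) ` ball 0 r = ball c r"
    proof (intro equalityI subsetI)
      fix w assume "w \<in> ball c r"
      then have "w = c + ?e t * ((w - c) / ?e t)" "(w - c) / ?e t \<in> ball 0 r"
        by (simp_all add: dist_norm norm_divide ne norm_minus_commute)
      then show "w \<in> (\<lambda>z. c + ?e t * z) ` ball 0 r" by blast
    qed (use inb in auto)
    moreover have "mass G ((\<lambda>z. c + ?e t * z) ` ball 0 r)
       = (\<integral>\<^sup>+z\<in>ball 0 r. ennreal (cmod (G (c + ?e t * z)) * (cmod (deriv (\<lambda>z. c + ?e t * z) z))\<^sup>2) \<partial>lborel)"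
    proof (rule set_nn_integral_holomorphic_image[of UNIV])
      have "range (\<lambda>z. c + ?e t * z) \<in> sets borel"
        by (rule inj_holomorphic_image_borel[of UNIV]) (auto intro!: holomorphic_intros injI)
      then show "(\<lambda>w. indicator (range (\<lambda>z. c + ?e t * z)) w * cmod (G w)) \<in> borel_measurable borel" by measurable
    qed (auto intro!: holomorphic_intros injI)
    moreover have "deriv (\<lambda>z. c + ?e t * z) z = ?e t" for z
      by (rule DERIV_imp_deriv) (auto intro!: derivative_eq_intros)
    ultimately have "(\<integral>\<^sup>+z\<in>ball 0 r. ennreal (cmod (G (c + ?e t * z))) \<partial>lborel) = mass G (ball c r)"
      by (simp add: ne)
    also have "\<dots> = ?I" by (rule nn_integral_cong) (auto simp: G_def indicator_def)
    finally show ?thesis .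
  qed
  have "ennreal (pi * r\<^sup>2 * cmod (g c)) = (\<integral>\<^sup>+z\<in>ball (0::complex) r. ennreal (cmod (g c)) \<partial>lborel)"
    using r by (simp add: nn_integral_cmult_indicator emeasure_ball_complex ennreal_mult'' mult.commute)
  also have "\<dots> \<le> (\<integral>\<^sup>+z\<in>ball 0 r. (\<integral>\<^sup>+t\<in>{0..1}. ennreal (cmod (G (c + ?e t * z))) \<partial>lborel) \<partial>lborel)"
  proof (rule nn_integral_mono)
    fix z :: complex
    have "ennreal (cmod (g c)) \<le> (\<integral>\<^sup>+t\<in>{0..1}. ennreal (cmod (G (c + ?e t * z))) \<partial>lborel)" if z: "z \<in> ball 0 r"
    proof -
      have "(\<integral>\<^sup>+t\<in>{0..1}. ennreal (cmod (g (c + ?e t * z))) \<partial>lborel) = (\<integral>\<^sup>+t\<in>{0..1}. ennreal (cmod (G (c + ?e t * z))) \<partial>lborel)"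
        by (rule nn_integral_cong) (use inb z in \<open>simp add: G_def\<close>)
      then show ?thesis using cmod_le_circle_mean[OF hol z] by simp
    qed
    then show "ennreal (cmod (g c)) * indicator (ball 0 r) z \<le>
       (\<integral>\<^sup>+t\<in>{0..1}. ennreal (cmod (G (c + ?e t * z))) \<partial>lborel) * indicator (ball 0 r) z"
      by (simp add: indicator_def)
  qed
  also have "\<dots> = (\<integral>\<^sup>+z. (\<integral>\<^sup>+t. ennreal (cmod (G (c + ?e t * z))) * indicator {0..1} t * indicator (ball 0 r) z \<partial>lborel) \<partial>lborel)"
    by (subst nn_integral_multc) auto
  also have "\<dots> = (\<integral>\<^sup>+t. (\<integral>\<^sup>+z. ennreal (cmod (G (c + ?e t * z))) * indicator {0..1} t * indicator (ball 0 r) z \<partial>lborel) \<partial>lborel)"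
    by (rule lborel_pair.Fubini') measurable
  also have "\<dots> = (\<integral>\<^sup>+t. ?I * indicator {0..1::real} t \<partial>lborel)"
  proof (rule nn_integral_cong)
    fix t :: real
    have "(\<integral>\<^sup>+z. ennreal (cmod (G (c + ?e t * z))) * indicator {0..1} t * indicator (ball 0 r) z \<partial>lborel)
      = (\<integral>\<^sup>+z. (ennreal (cmod (G (c + ?e t * z))) * indicator (ball 0 r) z) * indicator {0..1} t \<partial>lborel)"
      by (simp add: mult_ac)
    also have "\<dots> = ?I * indicator {0..1} t"
      by (subst nn_integral_multc) (auto simp: I)
    finally show "(\<integral>\<^sup>+z. ennreal (cmod (G (c + ?e t * z))) * indicator {0..1} t * indicator (ball 0 r) z \<partial>lborel)
      = ?I * indicator {0..1} t" .
  qed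
  also have "\<dots> = ?I" by (simp add: nn_integral_cmult_indicator)
  finally show ?thesis .
qed

text \<open>On the dyadic ring where \<open>cmod (z - c)\<close> lies between
  \<open>r / 2 ^ Suc k\<close> and \<open>r / 2 ^ k\<close> the integrand is at most
  \<open>2 ^ Suc k / r\<close>. With the rings enlarged to discs, the masses still form a geometric
  series.\<close>

lemma set_nn_integral_inverse_cmod_finite:
  assumes r: "0 < r"
  shows "(\<integral>\<^sup>+z\<in>ball (c::complex) r. ennreal (1 / cmod (z - c)) \<partial>lborel) < \<infinity>"
proof -
  let ?f = "\<lambda>k z. ennreal (2 ^ Suc k / r) * indicator (ball c (r / 2 ^ k)) z"
  have [measurable]: "ball c (r / 2 ^ k) \<in> sets borel" for k :: nat by simp
  have pw: "ennreal (1 / cmod (z - c)) * indicator (ball c r) z \<le> (\<Sum>k. ?f k z)" for z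
  proof (cases "z \<in> ball c r \<and> z \<noteq> c")
    case True
    let ?P = "\<lambda>n. r / 2 ^ Suc n \<le> cmod (z - c)"
    have "(\<lambda>n. r / 2 ^ Suc n) \<longlonglongrightarrow> 0" by real_asymp
    moreover have "0 < cmod (z - c)" using True by simp
    ultimately have "eventually (\<lambda>n. r / 2 ^ Suc n < cmod (z - c)) sequentially"
      by (rule order_tendstoD)
    then have ex: "\<exists>n. ?P n" unfolding eventually_sequentially by (meson less_imp_le order_refl)
    \<comment> \<open>The least such index names the ring containing \<open>z\<close>: minimality
      gives the outer bound, except for index 0, where it is membership in the disc.\<close>
    define k where "k = (LEAST n. ?P n)"
    have Pk: "?P k" unfolding k_def using ex by (rule LeastI_ex)
    have lt: "cmod (z - c) < r / 2 ^ k"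
    proof (cases k)
      case 0 then show ?thesis using True by (simp add: dist_norm norm_minus_commute)
    next
      case (Suc m)
      then have "\<not> ?P m" using not_less_Least[of m ?P] k_def by auto
      then show ?thesis using Suc by simp
    qed
    have "1 / cmod (z - c) \<le> 2 ^ Suc k / r"
      using Pk r True by (simp add: field_simps)
    then have "ennreal (1 / cmod (z - c)) * indicator (ball c r) z \<le> ?f k z"
      using True lt by (simp add: dist_norm norm_minus_commute ennreal_leI)
    also have "\<dots> \<le> (\<Sum>k. ?f k z)"
    proof -
      define F where "F = (\<lambda>k. ?f k z)"
      have "sum F {k} \<le> suminf F" by (rule sum_le_suminf) auto
      then have "F k \<le> suminf F" by simp
      then show ?thesis unfolding F_def .
    qed
    finally show ?thesis .
  \<comment> \<open>At \<open>z = c\<close> the left side is 0, because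
    \<open>1 / 0 = 0\<close>.\<close>
  qed (auto simp: indicator_def)
  have "(\<integral>\<^sup>+z\<in>ball c r. ennreal (1 / cmod (z - c)) \<partial>lborel) \<le> (\<integral>\<^sup>+z. (\<Sum>k. ?f k z) \<partial>lborel)"
    by (rule nn_integral_mono) (rule pw)
  also have "\<dots> = (\<Sum>k. \<integral>\<^sup>+z. ?f k z \<partial>lborel)" by (rule nn_integral_suminf) measurable
  also have "\<dots> = (\<Sum>k. ennreal (2 * pi * r * (1/2) ^ k))"
  proof (rule suminf_cong)
    fix k
    have "(\<integral>\<^sup>+z. ?f k z \<partial>lborel) = ennreal (2 ^ Suc k / r) * ennreal (pi * (r / 2 ^ k)\<^sup>2)"
      using r by (simp add: nn_integral_cmult_indicator emeasure_ball_complex)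
    also have "\<dots> = ennreal (2 ^ Suc k / r * (pi * (r / 2 ^ k)\<^sup>2))"
      by (rule ennreal_mult[symmetric]) (use r in auto)
    also have "2 ^ Suc k / r * (pi * (r / 2 ^ k)\<^sup>2) = 2 * pi * r * (1/2) ^ k"
      using r by (simp add: field_simps power2_eq_square)
    finally show "(\<integral>\<^sup>+z. ?f k z \<partial>lborel) = ennreal (2 * pi * r * (1/2) ^ k)" .
  qed
  also have "\<dots> = ennreal (\<Sum>k. 2 * pi * r * (1/2) ^ k)"
    using r by (intro suminf_ennreal2 summable_mult summable_geometric) auto
  also have "\<dots> < \<infinity>" by simp
  finally show ?thesis .
qed

text \<open>The disc about \<open>z\<close> of radius \<open>dist z c\<close> just misses
  \<open>c\<close>. The area mean inequality on it bounds
  \<open>(dist z c)\<^sup>2 * cmod (h z)\<close> by the mass of \<open>h\<close> close to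
  \<open>c\<close>, and that mass tends to 0.\<close>

lemma simple_pole_of_integrable:
  assumes rho: "0 < \<rho>" and h: "h holomorphic_on ball c \<rho> - {c}"
    and fin: "mass h (ball c \<rho> - {c}) < \<infinity>"
  obtains g where "g holomorphic_on ball c \<rho>" "\<And>z. z \<in> ball c \<rho> - {c} \<Longrightarrow> g z = (z - c) * h z"
proof -
  define H where "H = (\<lambda>z. if z \<in> ball c \<rho> - {c} then h z else 0)"
  have [measurable]: "H \<in> borel_measurable borel" unfolding H_def
    by (rule borel_measurable_continuous_on_if) (use h holomorphic_on_imp_continuous_on in auto)
  define M where "M = density lborel (\<lambda>z. ennreal (cmod (H z)))"
  have M: "emeasure M A = mass H A" if "A \<in> sets borel" for A
    unfolding M_def by (rule emeasure_density) (use that in auto)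
  have Mfin: "emeasure M A < \<infinity>" if "A \<in> sets borel" for A
  proof -
    have "emeasure M A \<le> mass h (ball c \<rho> - {c})"
      unfolding M[OF that] by (rule nn_integral_mono) (auto simp: H_def indicator_def)
    then show ?thesis using fin by (simp add: le_less_trans)
  qed
  define B where "B = (\<lambda>n. ball c (1 / real (Suc n)))"
  \<comment> \<open>Continuity from above: the balls shrink to \<open>{c}\<close>, which carries no
    mass.\<close>
  have "(\<lambda>n. emeasure M (B n)) \<longlonglongrightarrow> emeasure M (\<Inter>n. B n)"
  proof (rule Lim_emeasure_decseq)
    show "range B \<subseteq> sets M" by (auto simp: B_def M_def)
    show "decseq B" unfolding B_def decseq_def
      by (intro allI impI subset_ball) (simp add: frac_le)
    show "emeasure M (B i) \<noteq> \<infinity>" for i using Mfin[of "B i"] by (auto simp: B_def)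
  qed
  moreover have "(\<Inter>n. B n) = {c}"
  proof (intro equalityI subsetI)
    fix z assume z: "z \<in> (\<Inter>n. B n)"
    show "z \<in> {c}"
    proof (rule ccontr)
      assume "z \<notin> {c}"
      then obtain n where "1 / real (Suc n) < dist c z"
        using reals_Archimedean[of "dist c z"] by (auto simp: inverse_eq_divide)
      then show False using z unfolding B_def by (metis INT_D UNIV_I less_asym mem_ball)
    qed
  qed (auto simp: B_def)
  moreover have "emeasure M {c} = 0"
  proof -
    have "emeasure M {c} = (\<integral>\<^sup>+z. 0 \<partial>(lborel :: complex measure))" unfolding M[OF borel_singleton[OF sets.empty_sets, of c]]
      by (rule nn_integral_cong) (auto simp: H_def indicator_def)
    then show ?thesis by simp
  qed
  ultimately have lim: "(\<lambda>n. emeasure M (B n)) \<longlonglongrightarrow> 0" by simp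
  \<comment> \<open>Riemann's criterion is applied to the function \<open>(z - c) * h z\<close>, and
    it brings in one more factor \<open>z - c\<close>.\<close>
  have "((\<lambda>z. (z - c) * ((z - c) * h z)) \<longlongrightarrow> 0) (at c)"
  proof (rule tendstoI)
    fix e :: real assume e: "0 < e"
    then have "eventually (\<lambda>n. emeasure M (B n) < ennreal (pi * e)) sequentially"
      by (intro order_tendstoD(2)[OF lim]) simp
    then obtain n where n: "emeasure M (B n) < ennreal (pi * e)" by (auto simp: eventually_sequentially)
    define N where "N = 1 / real (Suc n)"
    \<comment> \<open>The disc about \<open>z\<close> of radius \<open>dist z c\<close> reaches no
      further than twice that distance from \<open>c\<close>, hence the halves.\<close>
    define d where "d = min (\<rho> / 2) (N / 2)"
    have "dist ((z - c) * ((z - c) * h z)) 0 < e" if z: "0 < dist z c" "dist z c < d" for z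
    proof -
      let ?s = "dist z c"
      have sub: "ball z ?s \<subseteq> ball c \<rho> - {c}" "ball z ?s \<subseteq> B n"
      proof -
        have *: "dist c w < 2 * ?s" if "w \<in> ball z ?s" for w
          using that dist_triangle[of c w z] by (simp add: dist_commute)
        have "2 * ?s < \<rho>" "2 * ?s < N" using z(2) unfolding d_def min_less_iff_conj by linarith+
        then have "ball z ?s \<subseteq> ball c \<rho>" "ball z ?s \<subseteq> B n"
          using * unfolding B_def N_def by (metis less_trans mem_ball subsetI)+
        then show "ball z ?s \<subseteq> ball c \<rho> - {c}" "ball z ?s \<subseteq> B n" by auto
      qed
      have "ennreal (pi * ?s\<^sup>2 * cmod (h z)) \<le> mass h (ball z ?s)"
        using z(1) sub(1) h by (intro cmod_le_area_mean) (auto intro: holomorphic_on_subset)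
      also have "\<dots> \<le> mass H (B n)"
        using sub by (intro nn_integral_mono) (auto simp: H_def indicator_def)
      also have "\<dots> = emeasure M (B n)" by (rule M[symmetric]) (simp add: B_def)
      finally have "ennreal (pi * ?s\<^sup>2 * cmod (h z)) < ennreal (pi * e)" using n by (rule le_less_trans)
      then have "pi * ?s\<^sup>2 * cmod (h z) < pi * e" using e by (simp add: ennreal_less_iff)
      then have "?s\<^sup>2 * cmod (h z) < e" by (simp add: mult.assoc)
      then show ?thesis by (simp add: norm_mult dist_norm power2_eq_square mult.assoc)
    qed
    moreover have "d > 0" using rho by (simp add: d_def N_def)
    ultimately show "\<forall>\<^sub>F z in at c. dist ((z - c) * ((z - c) * h z)) 0 < e"
      unfolding eventually_at by (intro exI[of _ d]) auto
  qed
  moreover have "(\<lambda>z. (z - c) * h z) holomorphic_on ball c \<rho> - {c}"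
    using h by (intro holomorphic_intros)
  moreover have "c \<in> interior (ball c \<rho>)" using rho by simp
  ultimately show ?thesis using holomorphic_on_extend_lim that by blast
qed

text \<open>Compactness gives the constant without exhibiting it. Counterexamples for the constants
  \<open>Suc n\<close>, normalised by their total masses, have a locally uniform limit; it vanishes
  on \<open>B\<close>, hence on the disc. So the normalised functions become uniformly small on the
  closed disc of radius \<open>r\<close>, too small to carry the fraction \<epsilon> of the
  mass.\<close>

lemma disc_area_estimate:
  assumes r: "r < \<rho>" and B: "open B" "B \<noteq> {}" "B \<subseteq> ball c \<rho>" and \<epsilon>: "0 < \<epsilon>"
  shows "\<exists>C\<ge>0. \<forall>h. h holomorphic_on ball c \<rho> - {c} \<longrightarrow>
    mass h (ball c \<rho> - {c}) < \<infinity> \<longrightarrow>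
    mass h (ball c r - {c}) \<le>
      ennreal \<epsilon> * mass h (ball c \<rho> - {c}) +
      ennreal C * mass h (B - {c})"
proof (rule ccontr)
  define I where "I = (\<lambda>(h :: complex \<Rightarrow> complex) A. \<integral>\<^sup>+z\<in>A. ennreal (cmod (h z)) \<partial>lborel)"
  assume "\<not> ?thesis"
  then have "\<forall>C\<ge>0. \<exists>h. h holomorphic_on ball c \<rho> - {c} \<and> I h (ball c \<rho> - {c}) < \<infinity> \<and>
      \<not> I h (ball c r - {c}) \<le> ennreal \<epsilon> * I h (ball c \<rho> - {c}) + ennreal C * I h (B - {c})"
    unfolding I_def by blast
  then have "\<forall>n. \<exists>h. h holomorphic_on ball c \<rho> - {c} \<and> I h (ball c \<rho> - {c}) < \<infinity> \<and>
      \<not> I h (ball c r - {c}) \<le> ennreal \<epsilon> * I h (ball c \<rho> - {c}) + ennreal (real (Suc n)) * I h (B - {c})"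
    by (meson of_nat_0_le_iff)
  then obtain h where h: "\<And>n. h n holomorphic_on ball c \<rho> - {c}" "\<And>n. I (h n) (ball c \<rho> - {c}) < \<infinity>"
    and big: "\<And>n. ennreal \<epsilon> * I (h n) (ball c \<rho> - {c}) + ennreal (real (Suc n)) * I (h n) (B - {c}) < I (h n) (ball c r - {c})"
    by (metis not_le)
  have rho: "0 < \<rho>" using B(2,3) by (metis ball_eq_empty not_le subset_empty)
  have mono: "I h A \<le> I h A'" if "A \<subseteq> A'" for h A A'
    unfolding I_def using that by (intro nn_integral_mono) (auto simp: indicator_def)
  define T where "T = (\<lambda>n. enn2real (I (h n) (ball c \<rho> - {c})))"
  have T: "I (h n) (ball c \<rho> - {c}) = ennreal (T n)" for n using h(2)[of n] by (simp add: T_def)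
  have rT: "I (h n) (ball c r - {c}) \<le> ennreal (T n)" for n
    unfolding T[symmetric] using r by (intro mono) auto
  have Tpos: "0 < T n" for n
  proof (rule ccontr)
    assume "\<not> 0 < T n"
    then have "ennreal (T n) = 0" by (simp add: ennreal_neg)
    then show False using big[of n] rT[of n] by simp
  qed
  have "\<exists>g. g holomorphic_on ball c \<rho> \<and> (\<forall>z\<in>ball c \<rho> - {c}. g z = (z - c) * h n z)" for n
    using simple_pole_of_integrable[OF rho h(1)[of n]] h(2)[of n] unfolding I_def by metis
  then obtain g0 where g0: "\<And>n. g0 n holomorphic_on ball c \<rho>"
      "\<And>n z. z \<in> ball c \<rho> - {c} \<Longrightarrow> g0 n z = (z - c) * h n z" by metis
  \<comment> \<open>The factor \<open>z - c\<close> in \<open>g0\<close> cancels the possible simple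
    pole, and division by \<open>T n\<close> makes the family bounded on compact sets.\<close>
  define g where "g = (\<lambda>n z. g0 n z / of_real (T n))"
  have g: "g n holomorphic_on ball c \<rho>" for n
    unfolding g_def using g0(1)[of n] Tpos[of n] by (intro holomorphic_intros) auto
  have gh: "cmod (g n z) = cmod (z - c) * cmod (h n z) / T n" if "z \<in> ball c \<rho> - {c}" for n z
    using g0(2)[OF that] Tpos[of n] by (simp add: g_def norm_divide norm_mult)
  \<comment> \<open>The factor \<open>z - c\<close> costs at most \<rho> on the disc, and the null
    point \<open>c\<close> can be left out of the integral, where nothing is known about
    \<open>h n\<close>.\<close>
  have Ig: "I (g n) A \<le> ennreal (\<rho> / T n) * I (h n) (A - {c})"
    if A: "A \<subseteq> ball c \<rho>" "A \<in> sets borel" for n A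
  proof -
    have "I (g n) A = mass (g n) (A - {c})"
      unfolding I_def
      by (rule nn_integral_cong_AE) (use AE_lborel_singleton[of c] in eventually_elim, auto simp: indicator_def)
    also have "\<dots> \<le> (\<integral>\<^sup>+z. ennreal (\<rho> / T n) * (ennreal (cmod (h n z)) * indicator (A - {c}) z) \<partial>lborel)"
    proof (rule nn_integral_mono)
      fix z
      show "ennreal (cmod (g n z)) * indicator (A - {c}) z \<le> ennreal (\<rho> / T n) * (ennreal (cmod (h n z)) * indicator (A - {c}) z)"
      proof (cases "z \<in> A - {c}")
        case True
        then have z: "z \<in> ball c \<rho> - {c}" using A by auto
        then have "cmod (z - c) * cmod (h n z) / T n \<le> \<rho> * cmod (h n z) / T n"
          using Tpos[of n] by (intro divide_right_mono mult_right_mono) (auto simp: dist_norm norm_minus_commute)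
        then have "ennreal (cmod (g n z)) \<le> ennreal (\<rho> / T n * cmod (h n z))"
          unfolding gh[OF z] by (intro ennreal_leI) simp
        then show ?thesis using True rho Tpos[of n] by (simp add: ennreal_mult[symmetric])
      qed simp
    qed
    also have "\<dots> = ennreal (\<rho> / T n) * I (h n) (A - {c})"
      unfolding I_def
    proof (rule nn_integral_cmult)
      have "(\<lambda>z. if z \<in> ball c \<rho> - {c} then h n z else 0) \<in> borel_measurable borel"
        by (rule borel_measurable_continuous_on_if) (use h holomorphic_on_imp_continuous_on in auto)
      then have "(\<lambda>z. ennreal (cmod (if z \<in> ball c \<rho> - {c} then h n z else 0)) * indicator (A - {c}) z) \<in> borel_measurable borel"
        using A(2) by measurable
      also have "(\<lambda>z. ennreal (cmod (if z \<in> ball c \<rho> - {c} then h n z else 0)) * indicator (A - {c}) z)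
          = (\<lambda>z. ennreal (cmod (h n z)) * indicator (A - {c}) z)"
        using A(1) by (auto simp: fun_eq_iff indicator_def)
      finally show "(\<lambda>z. ennreal (cmod (h n z)) * indicator (A - {c}) z) \<in> borel_measurable lborel" by simp
    qed
    finally show ?thesis .
  qed
  have pt: "ennreal (pi * s\<^sup>2 * cmod (g n w)) \<le> ennreal (\<rho> / T n) * I (h n) (A - {c})"
    if "ball w s \<subseteq> A" "A \<subseteq> ball c \<rho>" "A \<in> sets borel" "0 < s" for n w s A
  proof -
    have "ennreal (pi * s\<^sup>2 * cmod (g n w)) \<le> I (g n) (ball w s)"
      unfolding I_def by (rule cmod_le_area_mean) (use that g[of n] in \<open>auto intro: holomorphic_on_subset\<close>)
    also have "\<dots> \<le> I (g n) A" by (rule mono) (rule that)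
    also have "\<dots> \<le> ennreal (\<rho> / T n) * I (h n) (A - {c})" by (rule Ig) (use that in auto)
    finally show ?thesis .
  qed
  have bound: "\<exists>M. \<forall>f\<in>range g. \<forall>z\<in>K. cmod (f z) \<le> M" if K: "compact K" "K \<subseteq> ball c \<rho>" for K
  proof -
    obtain s where s: "0 < s" "(\<Union>x\<in>K. ball x s) \<subseteq> ball c \<rho>"
      using compact_subset_open_imp_ball_epsilon_subset[OF K(1) open_ball K(2)] by blast
    have "cmod (g n z) \<le> \<rho> / (pi * s\<^sup>2)" if z: "z \<in> K" for n z
    proof -
      have "ennreal (pi * s\<^sup>2 * cmod (g n z)) \<le> ennreal (\<rho> / T n) * I (h n) (ball c \<rho> - {c})"
        by (rule pt[OF _ order_refl]) (use s z in auto)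
      also have "\<dots> = ennreal \<rho>" unfolding T using rho Tpos[of n] by (simp add: ennreal_mult[symmetric])
      finally have "pi * s\<^sup>2 * cmod (g n z) \<le> \<rho>" using rho by (simp add: ennreal_le_iff)
      then show ?thesis using s by (simp add: pos_le_divide_eq mult.commute)
    qed
    then show ?thesis by blast
  qed
  obtain f k where f: "f holomorphic_on ball c \<rho>" "strict_mono (k :: nat \<Rightarrow> nat)"
      "\<And>x. x \<in> ball c \<rho> \<Longrightarrow> (\<lambda>n. g (k n) x) \<longlonglongrightarrow> f x"
      "\<And>K. compact K \<Longrightarrow> K \<subseteq> ball c \<rho> \<Longrightarrow> uniform_limit K (g \<circ> k) f sequentially"
    by (rule Montel[of "ball c \<rho>" "range g" g]) (use g bound in auto)
  \<comment> \<open>By \<open>big\<close>, the mass of \<open>h n\<close> on \<open>B\<close> is at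
    most \<open>T n / real (Suc n)\<close>. The mean inequality on a disc inside \<open>B\<close>
    turns this into a bound of order \<open>1/n\<close> for \<open>g n w\<close>.\<close>
  have fB: "f w = 0" if w: "w \<in> B" for w
  proof -
    obtain s where s: "0 < s" "ball w s \<subseteq> B" using B(1) w open_contains_ball by blast
    have le: "cmod (g n w) \<le> \<rho> / (pi * s\<^sup>2) / real (Suc n)" for n
    proof -
      have "ennreal (real (Suc n)) * I (h n) (B - {c}) \<le>
          ennreal \<epsilon> * I (h n) (ball c \<rho> - {c}) + ennreal (real (Suc n)) * I (h n) (B - {c})"
        by (rule add_increasing) auto
      also have "\<dots> \<le> ennreal (T n)" using big[of n] rT[of n] by simp
      finally have "ennreal (real (Suc n)) * I (h n) (B - {c}) \<le> ennreal (T n)" .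
      note this(1)[THEN mult_left_mono, of "ennreal (\<rho> / T n)"]
      moreover have "ennreal (real (Suc n)) * ennreal (pi * s\<^sup>2 * cmod (g n w))
          \<le> ennreal (real (Suc n)) * (ennreal (\<rho> / T n) * I (h n) (B - {c}))"
        by (rule mult_left_mono[OF pt[OF s(2) B(3) _ s(1)]]) (use B in auto)
      ultimately have "ennreal (real (Suc n)) * ennreal (pi * s\<^sup>2 * cmod (g n w)) \<le> ennreal (\<rho> / T n) * ennreal (T n)"
        by (simp add: mult.left_commute)
      then have "ennreal (real (Suc n) * (pi * s\<^sup>2 * cmod (g n w))) \<le> ennreal (\<rho> / T n * T n)"
        using rho Tpos[of n] by (subst (1 2) ennreal_mult) auto
      then have "real (Suc n) * (pi * s\<^sup>2 * cmod (g n w)) \<le> \<rho>"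
        using rho Tpos[of n] by (simp add: ennreal_le_iff)
      then show ?thesis using s by (simp add: pos_le_divide_eq mult_ac)
    qed
    have "(\<lambda>n. g n w) \<longlonglongrightarrow> 0"
    proof (rule Lim_null_comparison)
      show "\<forall>\<^sub>F n in sequentially. cmod (g n w) \<le> \<rho> / (pi * s\<^sup>2) / real (Suc n)" using le by simp
      show "(\<lambda>n. \<rho> / (pi * s\<^sup>2) / real (Suc n)) \<longlonglongrightarrow> 0" by real_asymp
    qed
    then have "(\<lambda>n. g (k n) w) \<longlonglongrightarrow> 0"
      using LIMSEQ_subseq_LIMSEQ[OF _ f(2)] by (simp add: o_def)
    then show ?thesis using f(3)[of w] w B(3) LIMSEQ_unique by blast
  qed
  have f0: "f z = 0" if "z \<in> ball c \<rho>" for z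
    by (rule analytic_continuation_open[OF B(1) open_ball B(2) _ B(3) f(1), of "\<lambda>_. 0"]) (use fB that in auto)
  have rpos: "0 < r"
  proof (rule ccontr)
    assume "\<not> 0 < r"
    then have e: "ball c r = {}" by simp
    show False using big[of 0] by (simp add: I_def e)
  qed
  define J where "J = enn2real (\<integral>\<^sup>+z\<in>ball c r. ennreal (1 / cmod (z - c)) \<partial>lborel)"
  have J: "(\<integral>\<^sup>+z\<in>ball c r. ennreal (1 / cmod (z - c)) \<partial>lborel) = ennreal J" "0 \<le> J"
    using set_nn_integral_inverse_cmod_finite[OF rpos, of c] by (simp_all add: J_def)
  \<comment> \<open>A uniform bound \<delta> on the normalised function bounds \<open>h\<close> by
    \<open>\<delta> * T / cmod (z - c)\<close>, whose integral over the small disc is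
    \<open>\<delta> * J * T\<close>. The summand 1 keeps the quotient meaningful when
    \<open>J\<close> is 0.\<close>
  define \<delta> where "\<delta> = \<epsilon> / (J + 1)"
  have \<delta>: "0 < \<delta>" "\<delta> * J \<le> \<epsilon>" using \<epsilon> J(2) by (simp_all add: \<delta>_def field_simps)
  have "uniform_limit (cball c r) (g \<circ> k) f sequentially"
    by (rule f(4)) (use r in auto)
  then have "\<forall>\<^sub>F n in sequentially. \<forall>z\<in>cball c r. dist ((g \<circ> k) n z) (f z) < \<delta>"
    using \<delta>(1) by (rule uniform_limitD)
  then obtain n where n: "\<And>z. z \<in> cball c r \<Longrightarrow> dist (g (k n) z) (f z) < \<delta>"
    using eventually_happens[of _ sequentially] by fastforce
  define m where "m = k n"
  have gm: "cmod (g m z) \<le> \<delta>" if "z \<in> ball c r" for z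
    using n[of z] f0[of z] that r by (simp add: m_def)
  have "I (h m) (ball c r - {c}) \<le> (\<integral>\<^sup>+z. ennreal (\<delta> * T m) * (ennreal (1 / cmod (z - c)) * indicator (ball c r) z) \<partial>lborel)"
    unfolding I_def
  proof (rule nn_integral_mono)
    fix z
    show "ennreal (cmod (h m z)) * indicator (ball c r - {c}) z \<le> ennreal (\<delta> * T m) * (ennreal (1 / cmod (z - c)) * indicator (ball c r) z)"
    proof (cases "z \<in> ball c r - {c}")
      case True
      then have "cmod (z - c) * cmod (h m z) / T m \<le> \<delta>"
        using gm[of z] gh[of z m] r by auto
      then have "cmod (h m z) \<le> \<delta> * T m * (1 / cmod (z - c))"
        using True Tpos[of m] by (simp add: field_simps)
      then show ?thesis using True \<delta>(1) Tpos[of m] by (simp add: ennreal_mult[symmetric] ennreal_leI)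
    qed simp
  qed
  also have "\<dots> = ennreal (\<delta> * T m) * ennreal J"
  proof -
    have [measurable]: "ball c r \<in> sets borel" by simp
    show ?thesis by (subst nn_integral_cmult) (measurable, use J in auto)
  qed
  also have "\<dots> = ennreal (\<delta> * J * T m)" using \<delta>(1) Tpos[of m] J(2) by (simp add: ennreal_mult[symmetric] mult_ac)
  also have "\<dots> \<le> ennreal (\<epsilon> * T m)" using \<delta>(2) Tpos[of m] by (intro ennreal_leI mult_right_mono) auto
  also have "\<dots> = ennreal \<epsilon> * ennreal (T m)" using \<epsilon> Tpos[of m] by (simp add: ennreal_mult)
  also have "\<dots> < I (h m) (ball c r - {c})"
    using big[of m] unfolding T by (meson add_increasing2 le_less_trans order_refl zero_le)
  finally show False by simp
qed

section \<open>Charts and invariance of domain\<close>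

text \<open>The common ground of Riemann surfaces and the fibre product of an embedding with a
  cover. It collects what invariance of domain and the uniqueness of area measures rely on;
  transition maps do not occur in it. Openness of chart images is asked for in the half-plane, so
  boundary charts are included.\<close>

definition charted_surface :: "'a surf \<Rightarrow> bool" where
  "charted_surface X \<longleftrightarrow>
     compact_space (surf_top X) \<and> closedin (surf_top X) (surf_punctures X) \<and>
     (\<Union>(U, \<phi>) \<in> surf_atlas X. U) = topspace (surf_top X) \<and>
     (\<forall>(U, \<phi>) \<in> surf_atlas X.
        openin (surf_top X) U \<and> inj_on \<phi> U \<and> \<phi> ` U \<subseteq> half_plane \<and>
        continuous_map (subtopology (surf_top X) U) euclidean \<phi> \<and>
        (\<forall>W. openin (surf_top X) W \<longrightarrow> W \<subseteq> U \<longrightarrow> openin (top_of_set half_plane) (\<phi> ` W)))"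

lemma
  assumes "charted_surface X"
  shows charted_surface_compact: "compact_space (surf_top X)"
    and charted_surface_closedin_punctures: "closedin (surf_top X) (surf_punctures X)"
    and charted_surface_covered: "x \<in> topspace (surf_top X) \<Longrightarrow> \<exists>U \<phi>. (U, \<phi>) \<in> surf_atlas X \<and> x \<in> U"
    and openin_chart: "(U, \<phi>) \<in> surf_atlas X \<Longrightarrow> openin (surf_top X) U"
    and inj_on_chart: "(U, \<phi>) \<in> surf_atlas X \<Longrightarrow> inj_on \<phi> U"
    and chart_half_plane: "(U, \<phi>) \<in> surf_atlas X \<Longrightarrow> \<phi> ` U \<subseteq> half_plane"
    and continuous_map_chart: "(U, \<phi>) \<in> surf_atlas X \<Longrightarrow> continuous_map (subtopology (surf_top X) U) euclidean \<phi>"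
    and openin_chart_image: "(U, \<phi>) \<in> surf_atlas X \<Longrightarrow> openin (surf_top X) W \<Longrightarrow> W \<subseteq> U \<Longrightarrow>
       openin (top_of_set half_plane) (\<phi> ` W)"
proof -
  show "compact_space (surf_top X)" "closedin (surf_top X) (surf_punctures X)"
    using assms by (simp_all add: charted_surface_def)
  have "(\<Union>(U, \<phi>) \<in> surf_atlas X. U) = topspace (surf_top X)" using assms by (simp add: charted_surface_def)
  then show "x \<in> topspace (surf_top X) \<Longrightarrow> \<exists>U \<phi>. (U, \<phi>) \<in> surf_atlas X \<and> x \<in> U" by fast
  assume "(U, \<phi>) \<in> surf_atlas X"
  then have *: "openin (surf_top X) U \<and> inj_on \<phi> U \<and> \<phi> ` U \<subseteq> half_plane \<and>
        continuous_map (subtopology (surf_top X) U) euclidean \<phi> \<and>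
        (\<forall>W. openin (surf_top X) W \<longrightarrow> W \<subseteq> U \<longrightarrow> openin (top_of_set half_plane) (\<phi> ` W))"
    using assms unfolding charted_surface_def by fast
  show "openin (surf_top X) U" "inj_on \<phi> U" "\<phi> ` U \<subseteq> half_plane"
    "continuous_map (subtopology (surf_top X) U) euclidean \<phi>"
    "openin (surf_top X) W \<Longrightarrow> W \<subseteq> U \<Longrightarrow> openin (top_of_set half_plane) (\<phi> ` W)"
    using * by simp_all
qed

lemma riemann_surface_imp_charted:
  assumes "riemann_surface S" shows "charted_surface S"
proof -
  let ?T = "surf_top S"
  have ch: "openin ?T U" "openin (top_of_set half_plane) (\<phi> ` U)"
      "homeomorphic_map (subtopology ?T U) (top_of_set (\<phi> ` U)) \<phi>"
    if "(U, \<phi>) \<in> surf_atlas S" for U \<phi>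
    using assms that unfolding riemann_surface_def by blast+
  have ts: "topspace (subtopology ?T U) = U" if "(U, \<phi>) \<in> surf_atlas S" for U \<phi>
    using openin_subset[OF ch(1)[OF that]] by (simp add: Int_absorb1)
  show ?thesis unfolding charted_surface_def
  proof (intro conjI ballI, goal_cases)
    case 1 show ?case using assms by (simp add: riemann_surface_def)
  next
    case 2 show ?case using assms by (auto simp: riemann_surface_def intro: closedin_Hausdorff_finite)
  next
    case 3 show ?case using assms by (simp add: riemann_surface_def)
  next
    case (4 c)
    obtain U \<phi> where c: "c = (U, \<phi>)" by force
    then have a: "(U, \<phi>) \<in> surf_atlas S" using 4 by simp
    note h = ch(3)[OF a]
    have "inj_on \<phi> U" using homeomorphic_imp_injective_map[OF h] ts[OF a] by simp
    moreover have "\<phi> ` U \<subseteq> half_plane" using openin_imp_subset[OF ch(2)[OF a]] .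
    moreover have "continuous_map (subtopology ?T U) euclidean \<phi>"
      using homeomorphic_imp_continuous_map[OF h] continuous_map_into_fulltopology by blast
    moreover have "openin (top_of_set half_plane) (\<phi> ` W)" if W: "openin ?T W" "W \<subseteq> U" for W
    proof -
      have "openin (subtopology ?T U) W" using W ch(1)[OF a] by (simp add: openin_open_subtopology)
      then have "openin (top_of_set (\<phi> ` U)) (\<phi> ` W)"
        using homeomorphic_imp_open_map[OF h] by (simp add: open_map_def)
      then show ?thesis using ch(2)[OF a] openin_trans by blast
    qed
    ultimately show ?case using ch(1)[OF a] c by simp
  qed
qed

lemma openin_chart_preimage:
  assumes X: "charted_surface X" and a: "(U, \<phi>) \<in> surf_atlas X" and A: "open A"
  shows "openin (surf_top X) {y \<in> U. \<phi> y \<in> A}"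
proof -
  have U: "openin (surf_top X) U" using X a by (rule openin_chart)
  have "openin (subtopology (surf_top X) U) {y \<in> topspace (subtopology (surf_top X) U). \<phi> y \<in> A}"
    using continuous_map_chart[OF X a] A by (rule openin_continuous_map_preimage[OF _ open_openin[THEN iffD1]])
  moreover have "topspace (subtopology (surf_top X) U) = U" using openin_subset[OF U] by (simp add: Int_absorb1)
  ultimately have "openin (subtopology (surf_top X) U) {y \<in> U. \<phi> y \<in> A}" by (simp only:)
  then show ?thesis using U by (simp add: openin_open_subtopology)
qed

section \<open>Invariance of domain carried to surfaces\<close>

lemma open_Collect_preimage:
  fixes \<Omega> :: "'a::topological_space set"
  assumes "open \<Omega>" "continuous_map (top_of_set \<Omega>) T G" "openin T W"
  shows "open {z \<in> \<Omega>. G z \<in> W}"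
  using openin_continuous_map_preimage[OF assms(2,3)] assms(1)
  by (simp add: openin_open_eq)

lemma open_chart_comp_image:
  fixes \<Omega> :: "complex set"
  assumes X: "charted_surface X" and a: "(V, \<psi>) \<in> surf_atlas X"
    and \<Omega>: "open \<Omega>" and G: "continuous_map (top_of_set \<Omega>) (surf_top X) G" "inj_on G \<Omega>"
    and W: "open W" "W \<subseteq> \<Omega>" "G ` W \<subseteq> V"
  shows "open ((\<lambda>z. \<psi> (G z)) ` W)"
proof (rule invariance_of_domain)
  show "open W" by fact
  have "continuous_map (top_of_set W) (subtopology (surf_top X) V) G"
    using W(3) continuous_map_from_subtopology_mono[OF G(1) W(2)] by (auto simp: continuous_map_in_subtopology)
  then have "continuous_map (top_of_set W) euclidean (\<psi> \<circ> G)"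
    by (rule continuous_map_compose[OF _ continuous_map_chart[OF X a]])
  then show "continuous_on W (\<lambda>z. \<psi> (G z))" by (simp add: o_def continuous_map_iff_continuous)
  show "inj_on (\<lambda>z. \<psi> (G z)) W"
    using G(2) W inj_on_chart[OF X a] by (auto simp: inj_on_def) (metis image_subset_iff subsetD)
qed

text \<open>Charts take values in the closed half-plane. If an injective image of an open plane set
  contained a point with real coordinate, invariance of domain would put a full disc around that
  coordinate into the half-plane.\<close>

lemma continuous_inj_image_disjoint_boundary:
  fixes \<Omega> :: "complex set"
  assumes X: "charted_surface X" and \<Omega>: "open \<Omega>"
    and G: "continuous_map (top_of_set \<Omega>) (surf_top X) G" "inj_on G \<Omega>"
  shows "G ` \<Omega> \<inter> surf_boundary X = {}"
proof (rule ccontr)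
  assume "\<not> ?thesis"
  then obtain z V \<psi> where z: "z \<in> \<Omega>" and a: "(V, \<psi>) \<in> surf_atlas X" and V: "G z \<in> V" "Im (\<psi> (G z)) = 0"
    unfolding surf_boundary_def by blast
  define W where "W = {z \<in> \<Omega>. G z \<in> V}"
  have "open W" unfolding W_def using \<Omega> G(1) openin_chart[OF X a] by (rule open_Collect_preimage)
  then have "open ((\<lambda>z. \<psi> (G z)) ` W)"
    by (intro open_chart_comp_image[OF X a \<Omega> G]) (auto simp: W_def)
  moreover have "\<psi> (G z) \<in> (\<lambda>z. \<psi> (G z)) ` W" using z V by (auto simp: W_def)
  ultimately obtain e where e: "0 < e" "ball (\<psi> (G z)) e \<subseteq> (\<lambda>z. \<psi> (G z)) ` W"
    using open_contains_ball by blast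
  \<comment> \<open>A point of the disc strictly below the real axis.\<close>
  have "\<psi> (G z) - \<i> * of_real (e / 2) \<in> ball (\<psi> (G z)) e"
    using e(1) by (simp add: dist_norm norm_mult)
  then obtain w where "w \<in> W" "\<psi> (G z) - \<i> * of_real (e / 2) = \<psi> (G w)" using e(2) by blast
  then have "\<psi> (G z) - \<i> * of_real (e / 2) \<in> \<psi> ` V" by (simp add: W_def)
  then have "\<psi> (G z) - \<i> * of_real (e / 2) \<in> half_plane" using chart_half_plane[OF X a] by blast
  then show False using e(1) V(2) by (simp add: half_plane_def)
qed

lemma openin_continuous_inj_image:
  fixes \<Omega> :: "complex set"
  assumes X: "charted_surface X" and \<Omega>: "open \<Omega>"
    and G: "continuous_map (top_of_set \<Omega>) (surf_top X) G" "inj_on G \<Omega>"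
    and W: "open W" "W \<subseteq> \<Omega>"
  shows "openin (surf_top X) (G ` W)"
proof (subst openin_subopen, intro ballI)
  fix y assume "y \<in> G ` W"
  then obtain z where z: "z \<in> W" "y = G z" by blast
  have "y \<in> topspace (surf_top X)" using z W(2) G(1) by (auto simp: continuous_map_def)
  then obtain V \<psi> where a: "(V, \<psi>) \<in> surf_atlas X" and yV: "y \<in> V" using charted_surface_covered[OF X] by blast
  define W' where "W' = {z \<in> W. G z \<in> V}"
  have "W' = W \<inter> {z \<in> \<Omega>. G z \<in> V}" using W(2) by (auto simp: W'_def)
  then have W': "open W'" using W(1) open_Collect_preimage[OF \<Omega> G(1) openin_chart[OF X a]] by auto
  then have "open ((\<lambda>z. \<psi> (G z)) ` W')"
    using W(2) by (intro open_chart_comp_image[OF X a \<Omega> G]) (auto simp: W'_def)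
  then have "openin (surf_top X) {y \<in> V. \<psi> y \<in> (\<lambda>z. \<psi> (G z)) ` W'}"
    by (rule openin_chart_preimage[OF X a])
  moreover have "{y \<in> V. \<psi> y \<in> (\<lambda>z. \<psi> (G z)) ` W'} = G ` W'"
    using inj_on_chart[OF X a] by (auto simp: W'_def inj_on_def)
  ultimately show "\<exists>T. openin (surf_top X) T \<and> y \<in> T \<and> T \<subseteq> G ` W"
    using z yV by (intro exI[of _ "G ` W'"]) (auto simp: W'_def)
qed

text \<open>The condition is put on the imaginary part in this one chart and not on
  \<open>surf_boundary\<close>, since the agreement of the two, \<open>chart_boundary_iff\<close>,
  is itself derived from this.\<close>

lemma open_chart_image_upper:
  assumes X: "charted_surface X" and a: "(U, \<phi>) \<in> surf_atlas X"
    and W: "openin (surf_top X) W" "W \<subseteq> U" and pos: "\<And>y. y \<in> W \<Longrightarrow> 0 < Im (\<phi> y)"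
  shows "open (\<phi> ` W)"
proof -
  obtain A where A: "open A" "\<phi> ` W = half_plane \<inter> A"
    using openin_chart_image[OF X a W] by (auto simp: openin_open)
  have "\<phi> ` W \<subseteq> {z. 0 < Im z}" using pos by auto
  moreover have "A \<inter> {z. 0 < Im z} \<subseteq> \<phi> ` W" unfolding A(2) by (auto simp: half_plane_def)
  ultimately have "\<phi> ` W = A \<inter> {z. 0 < Im z}" using A(2) by blast
  then show ?thesis using A(1) by (simp add: open_Int open_halfspace_Im_gt)
qed

lemma continuous_map_inv_chart_upper:
  assumes X: "charted_surface X" and a: "(U, \<phi>) \<in> surf_atlas X"
    and W: "openin (surf_top X) W" "W \<subseteq> U" and pos: "\<And>y. y \<in> W \<Longrightarrow> 0 < Im (\<phi> y)"
  shows "continuous_map (top_of_set (\<phi> ` W)) (surf_top X) (inv_into U \<phi>)"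
proof -
  have inv: "inv_into U \<phi> (\<phi> y) = y" if "y \<in> U" for y
    using inj_on_chart[OF X a] that by (rule inv_into_f_f)
  have "openin (top_of_set (\<phi> ` W)) {z \<in> \<phi> ` W. inv_into U \<phi> z \<in> A}" if A: "openin (surf_top X) A" for A
  proof -
    have "{z \<in> \<phi> ` W. inv_into U \<phi> z \<in> A} = \<phi> ` (W \<inter> A)"
      using inv W(2) by (auto simp: subset_iff)
    moreover have "open (\<phi> ` (W \<inter> A))"
      using W A pos by (intro open_chart_image_upper[OF X a]) auto
    moreover have "\<phi> ` (W \<inter> A) \<subseteq> \<phi> ` W" by blast
    ultimately show ?thesis using open_subset[of "\<phi> ` (W \<inter> A)" "\<phi> ` W"] by simp
  qed
  then show ?thesis
    using inv W openin_subset[OF W(1)] by (auto simp: continuous_map subset_iff)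
qed

text \<open>\<open>surf_boundary\<close> asks for some chart with a real coordinate; that every
  other chart at the point then agrees is topological invariance of the boundary. If the coordinate
  in another chart had positive imaginary part, the inverse of that chart would be an injective
  continuous map of an open plane set hitting the boundary.\<close>

lemma chart_boundary_iff:
  assumes X: "charted_surface X" and a: "(U, \<phi>) \<in> surf_atlas X" and y: "y \<in> U"
  shows "y \<in> surf_boundary X \<longleftrightarrow> Im (\<phi> y) = 0"
proof
  show "Im (\<phi> y) = 0 \<Longrightarrow> y \<in> surf_boundary X" using a y by (auto simp: surf_boundary_def)
next
  assume b: "y \<in> surf_boundary X"
  show "Im (\<phi> y) = 0"
  proof (rule ccontr)
    assume "Im (\<phi> y) \<noteq> 0"
    then have y0: "0 < Im (\<phi> y)" using chart_half_plane[OF X a] y by (auto simp: half_plane_def image_subset_iff less_le)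
    define W where "W = {y \<in> U. \<phi> y \<in> {z. 0 < Im z}}"
    have W: "openin (surf_top X) W" "W \<subseteq> U" "\<And>y. y \<in> W \<Longrightarrow> 0 < Im (\<phi> y)"
      unfolding W_def by (rule openin_chart_preimage[OF X a open_halfspace_Im_gt]) auto
    have "inv_into U \<phi> ` \<phi> ` W \<inter> surf_boundary X = {}"
      using W by (intro continuous_inj_image_disjoint_boundary[OF X] open_chart_image_upper[OF X a]
          continuous_map_inv_chart_upper[OF X a] inj_on_subset[OF inj_on_inv_into[OF order_refl]] image_mono)
    moreover have "inv_into U \<phi> (\<phi> y) = y" using inj_on_chart[OF X a] y by (rule inv_into_f_f)
    ultimately show False using b y y0 by (force simp: W_def)
  qed
qed

lemma openin_nonboundary:
  assumes X: "charted_surface X"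
  shows "openin (surf_top X) (topspace (surf_top X) - surf_boundary X)"
proof (subst openin_subopen, intro ballI)
  fix y assume y: "y \<in> topspace (surf_top X) - surf_boundary X"
  then obtain U \<phi> where a: "(U, \<phi>) \<in> surf_atlas X" and yU: "y \<in> U" using charted_surface_covered[OF X] by blast
  have pos: "Im (\<phi> y) \<noteq> 0 \<longleftrightarrow> 0 < Im (\<phi> y)" if "y \<in> U" for y
    using chart_half_plane[OF X a] that by (auto simp: half_plane_def image_subset_iff less_le)
  have "openin (surf_top X) {y \<in> U. \<phi> y \<in> {z. 0 < Im z}}"
    by (rule openin_chart_preimage[OF X a open_halfspace_Im_gt])
  moreover have "{y \<in> U. \<phi> y \<in> {z. 0 < Im z}} = U - surf_boundary X"
    using pos chart_boundary_iff[OF X a] by auto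
  ultimately show "\<exists>T. openin (surf_top X) T \<and> y \<in> T \<and> T \<subseteq> topspace (surf_top X) - surf_boundary X"
    using y yU openin_subset[OF openin_chart[OF X a]] by (intro exI[of _ "U - surf_boundary X"]) auto
qed

lemma openin_surf_interior:
  assumes X: "charted_surface X"
  shows "openin (surf_top X) (surf_interior X)"
proof -
  have "surf_interior X = (topspace (surf_top X) - surf_boundary X) - surf_punctures X"
    by (auto simp: surf_interior_def)
  then show ?thesis
    using openin_nonboundary[OF X] charted_surface_closedin_punctures[OF X] by (simp add: openin_diff)
qed

lemma chart_Im_pos:
  assumes X: "charted_surface X" and a: "(U, \<phi>) \<in> surf_atlas X" and y: "y \<in> U" "y \<notin> surf_boundary X"
  shows "0 < Im (\<phi> y)"
proof -
  have "0 \<le> Im (\<phi> y)" using chart_half_plane[OF X a] y(1) by (auto simp: half_plane_def image_subset_iff)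
  then show ?thesis using chart_boundary_iff[OF X a y(1)] y(2) by simp
qed

lemma open_chart_image:
  assumes X: "charted_surface X" and a: "(U, \<phi>) \<in> surf_atlas X"
    and W: "openin (surf_top X) W" "W \<subseteq> U" "W \<inter> surf_boundary X = {}"
  shows "open (\<phi> ` W)"
  by (rule open_chart_image_upper[OF X a W(1,2)]) (use chart_Im_pos[OF X a] W in blast)

lemma continuous_map_inv_chart:
  assumes X: "charted_surface X" and a: "(U, \<phi>) \<in> surf_atlas X"
    and W: "openin (surf_top X) W" "W \<subseteq> U" "W \<inter> surf_boundary X = {}"
  shows "continuous_map (top_of_set (\<phi> ` W)) (surf_top X) (inv_into U \<phi>)"
  by (rule continuous_map_inv_chart_upper[OF X a W(1,2)]) (use chart_Im_pos[OF X a] W in blast)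

section \<open>Area in a chart\<close>

text \<open>An injective map respects complements and countable unions, so measurability of images
  has only to be checked on generators. The intersection with \<open>X\<close> is there because
  generators may reach beyond the set on which \<open>g\<close> is injective.\<close>

lemma sigma_sets_image_Int:
  assumes E: "E \<in> sigma_sets \<Omega> A" and X: "X \<subseteq> \<Omega>" "inj_on g X" and N: "sigma_algebra S N"
    and A: "\<And>a. a \<in> A \<Longrightarrow> g ` (a \<inter> X) \<in> N" and gX: "g ` X \<in> N"
  shows "g ` (E \<inter> X) \<in> N"
  using E
proof induction
  interpret sigma_algebra S N by fact
  {
    case (Basic a) then show ?case by (rule A)
  next
    case Empty show ?case by simp
  next
    case (Compl a)
    have "g ` ((\<Omega> - a) \<inter> X) = g ` X - g ` (a \<inter> X)" using X by (auto simp: inj_on_def)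
    then show ?case using gX Compl by auto
  next
    case (Union a)
    have "g ` (\<Union> (range a) \<inter> X) = (\<Union>i. g ` (a i \<inter> X))" by auto
    then show ?case using Union by auto
  }
qed

text \<open>Splitting off one member of the cover at a time reduces equality of two set functions to
  subsets of single members. It serves to compare measures chart by chart.\<close>

lemma additive_eq_of_finite_cover:
  fixes m n :: "'a set \<Rightarrow> ennreal"
  assumes N: "sigma_algebra S N" and I: "finite I" "I \<subseteq> N"
    and empty: "m {} = 0" "n {} = 0"
    and m: "\<And>A B. A \<in> N \<Longrightarrow> B \<in> N \<Longrightarrow> A \<inter> B = {} \<Longrightarrow> m (A \<union> B) = m A + m B"
    and n: "\<And>A B. A \<in> N \<Longrightarrow> B \<in> N \<Longrightarrow> A \<inter> B = {} \<Longrightarrow> n (A \<union> B) = n A + n B"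
    and eq: "\<And>U B. U \<in> I \<Longrightarrow> B \<in> N \<Longrightarrow> B \<subseteq> U \<Longrightarrow> m B = n B"
    and B: "B \<in> N" "B \<subseteq> \<Union>I"
  shows "m B = n B"
  using I eq B
proof (induction I arbitrary: B)
  case empty
  then show ?case using assms(4,5) by simp
next
  case (insert U I)
  interpret sigma_algebra S N by fact
  have U: "B \<inter> U \<in> N" "B - U \<in> N" using insert.prems by auto
  have e: "(B \<inter> U) \<union> (B - U) = B" "(B \<inter> U) \<inter> (B - U) = {}" by auto
  have "m (B \<inter> U) = n (B \<inter> U)" using U insert.prems by blast
  moreover have "m (B - U) = n (B - U)"
    by (rule insert.IH) (use U insert.prems in auto)
  ultimately show ?case using m[OF U e(2)] n[OF U e(2)] unfolding e(1) by simp
qed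

definition surf_sets :: "'a surf \<Rightarrow> 'a set set" where
  "surf_sets X = sigma_sets (surf_interior X) {W. openin (surf_top X) W \<and> W \<subseteq> surf_interior X}"

lemma sigma_algebra_surf_sets: "sigma_algebra (surf_interior X) (surf_sets X)"
  unfolding surf_sets_def by (rule sigma_algebra_sigma_sets) auto

lemma surf_setsI: "openin (surf_top X) W \<Longrightarrow> W \<subseteq> surf_interior X \<Longrightarrow> W \<in> surf_sets X"
  unfolding surf_sets_def by (rule sigma_sets.Basic) simp

lemma surf_sets_subset: "B \<in> surf_sets X \<Longrightarrow> B \<subseteq> surf_interior X"
  unfolding surf_sets_def by (rule sigma_sets_into_sp) auto

lemma interior_Int_boundary: "W \<subseteq> surf_interior X \<Longrightarrow> W \<inter> surf_boundary X = {}"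
  by (auto simp: surf_interior_def)

lemma open_chart_interior_image:
  assumes X: "charted_surface X" and a: "(U, \<phi>) \<in> surf_atlas X"
  shows "open (\<phi> ` (U \<inter> surf_interior X))"
  by (rule open_chart_image[OF X a])
     (use interior_Int_boundary[of "U \<inter> surf_interior X"] openin_chart[OF X a] openin_surf_interior[OF X] in \<open>auto simp: openin_Int\<close>)

lemma chart_image_borel:
  assumes X: "charted_surface X" and a: "(U, \<phi>) \<in> surf_atlas X" and B: "B \<in> surf_sets X" "B \<subseteq> U"
  shows "\<phi> ` B \<in> sets borel"
proof -
  let ?D = "U \<inter> surf_interior X"
  have op: "open (\<phi> ` (W \<inter> U))" if "openin (surf_top X) W" "W \<subseteq> surf_interior X" for W
    by (rule open_chart_image[OF X a]) (use that openin_chart[OF X a] interior_Int_boundary in \<open>auto simp: openin_Int\<close>)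
  have "\<phi> ` (B \<inter> ?D) \<in> sets borel"
  proof (rule sigma_sets_image_Int)
    show "B \<in> sigma_sets (surf_interior X) {W. openin (surf_top X) W \<and> W \<subseteq> surf_interior X}"
      using B by (simp add: surf_sets_def)
    show "inj_on \<phi> ?D" using inj_on_chart[OF X a] by (rule inj_on_subset) auto
    show "sigma_algebra UNIV (sets (borel :: complex measure))"
      using sets.sigma_algebra_axioms[of "borel :: complex measure"] by simp
    show "\<phi> ` ?D \<in> sets borel"
      using op[OF openin_surf_interior[OF X]] by (simp add: Int_commute)
    fix W assume "W \<in> {W. openin (surf_top X) W \<and> W \<subseteq> surf_interior X}"
    then show "\<phi> ` (W \<inter> ?D) \<in> sets borel" using op[of W] by (simp add: Int_absorb2 Int_left_commute Int_assoc Int_commute inf.absorb_iff1)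
  qed auto
  moreover have "B \<inter> ?D = B" using B(2) surf_sets_subset[OF B(1)] by auto
  ultimately show ?thesis by simp
qed

lemma borel_image_surf_sets:
  fixes \<Omega> :: "complex set"
  assumes X: "charted_surface X" and \<Omega>: "open \<Omega>"
    and G: "continuous_map (top_of_set \<Omega>) (surf_top X) G" "inj_on G \<Omega>" "G ` \<Omega> \<subseteq> surf_interior X"
    and E: "E \<in> sets borel" "E \<subseteq> \<Omega>"
  shows "G ` E \<in> surf_sets X"
proof -
  have "G ` (E \<inter> \<Omega>) \<in> surf_sets X"
  proof (rule sigma_sets_image_Int[OF _ _ G(2) sigma_algebra_surf_sets])
    show "E \<in> sigma_sets UNIV {S. open S}" using E(1) by (simp add: sets_borel)
    show "G ` \<Omega> \<in> surf_sets X"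
      using openin_continuous_inj_image[OF X \<Omega> G(1,2) \<Omega>] G(3) by (simp add: surf_setsI)
    fix A :: "complex set" assume "A \<in> {S. open S}"
    then show "G ` (A \<inter> \<Omega>) \<in> surf_sets X"
      using openin_continuous_inj_image[OF X \<Omega> G(1,2), of "A \<inter> \<Omega>"] G(3) \<Omega> by (intro surf_setsI) auto
  qed auto
  then show ?thesis using E(2) by (simp add: Int_absorb2)
qed

section \<open>Holomorphy in charts and coefficients of quadratic differentials\<close>

lemma holomorphic_on_locally:
  assumes "open S" "\<And>z. z \<in> S \<Longrightarrow> \<exists>e>0. \<exists>g. g holomorphic_on ball z e \<and> (\<forall>w\<in>S \<inter> ball z e. f w = g w)"
  shows "f holomorphic_on S"
  unfolding holomorphic_on_open[OF assms(1)]
proof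
  fix z assume z: "z \<in> S"
  then obtain e g where eg: "0 < e" "g holomorphic_on ball z e" "\<forall>w\<in>S \<inter> ball z e. f w = g w"
    using assms(2) by blast
  have "(g has_field_derivative deriv g z) (at z)"
    using eg by (intro holomorphic_derivI[of _ "ball z e"]) auto
  then have "(f has_field_derivative deriv g z) (at z)"
    by (rule has_field_derivative_transform_within_open[of _ _ _ "S \<inter> ball z e"]) (use eg z assms(1) in auto)
  then show "\<exists>f'. (f has_field_derivative f') (at z)" ..
qed

lemma holomorphic_in_chart_subset:
  "holomorphic_in_chart \<phi> D x F \<Longrightarrow> D' \<subseteq> D \<Longrightarrow> holomorphic_in_chart \<phi> D' x F"
  unfolding holomorphic_in_chart_def by blast

lemma holomorphic_on_inv_chart:
  assumes inj: "inj_on \<phi> U" and D: "D \<subseteq> U" "open (\<phi> ` D)"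
    and hol: "\<And>x. x \<in> D \<Longrightarrow> holomorphic_in_chart \<phi> D x F"
  shows "(\<lambda>z. F (inv_into U \<phi> z)) holomorphic_on \<phi> ` D"
proof (rule holomorphic_on_locally[OF D(2)])
  fix z assume "z \<in> \<phi> ` D"
  then obtain x where x: "x \<in> D" "z = \<phi> x" by blast
  then obtain e g where "0 < e" "g holomorphic_on ball (\<phi> x) e" "\<forall>y\<in>D. \<phi> y \<in> ball (\<phi> x) e \<longrightarrow> F y = g (\<phi> y)"
    using hol unfolding holomorphic_in_chart_def by blast
  moreover have "inv_into U \<phi> (\<phi> y) = y" if "y \<in> D" for y using inj D(1) that by (intro inv_into_f_f) auto
  ultimately show "\<exists>e>0. \<exists>g. g holomorphic_on ball z e \<and> (\<forall>w\<in>\<phi> ` D \<inter> ball z e. F (inv_into U \<phi> w) = g w)"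
    using x by (intro exI[of _ e] conjI exI[of _ g]) auto
qed

lemma transition_holomorphic:
  assumes Y: "riemann_surface Y" and a: "(U, \<phi>) \<in> surf_atlas Y" "(V, \<psi>) \<in> surf_atlas Y"
    and W: "openin (surf_top Y) W" "W \<subseteq> U" "W \<subseteq> V" "W \<inter> surf_boundary Y = {}"
  shows "(\<lambda>z. \<psi> (inv_into U \<phi> z)) holomorphic_on \<phi> ` W"
proof -
  note Y' = riemann_surface_imp_charted[OF Y]
  show ?thesis
  proof (rule holomorphic_on_inv_chart[OF inj_on_chart[OF Y' a(1)] W(2) open_chart_image[OF Y' a(1) W(1,2,4)]])
    fix x assume "x \<in> W"
    then have "holomorphic_in_chart \<phi> (U \<inter> V) x \<psi>"
      using Y a W(2,3) unfolding riemann_surface_def by fast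
    then show "holomorphic_in_chart \<phi> W x \<psi>" by (rule holomorphic_in_chart_subset) (use W in auto)
  qed
qed

lemma qd_coeff_holomorphic:
  assumes Y: "charted_surface Y" and q: "quadratic_differential Y q" and a: "(U, \<phi>) \<in> surf_atlas Y"
  shows "(\<lambda>z. q (U, \<phi>) (inv_into U \<phi> z)) holomorphic_on \<phi> ` (U \<inter> surf_interior Y)"
proof (rule holomorphic_on_inv_chart[OF inj_on_chart[OF Y a]])
  show "open (\<phi> ` (U \<inter> surf_interior Y))"
    by (rule open_chart_interior_image[OF Y a])
qed (use q a in \<open>auto simp: quadratic_differential_def\<close>)

lemma qd_coeff_borel:
  assumes Y: "charted_surface Y" and q: "quadratic_differential Y q" and a: "(U, \<phi>) \<in> surf_atlas Y"
    and A: "A \<in> sets borel" "A \<subseteq> \<phi> ` (U \<inter> surf_interior Y)"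
  shows "(\<lambda>z. indicator A z * cmod (q (U, \<phi>) (inv_into U \<phi> z))) \<in> borel_measurable borel"
proof -
  let ?D = "\<phi> ` (U \<inter> surf_interior Y)"
  have op: "open ?D" by (rule open_chart_interior_image[OF Y a])
  define F where "F = (\<lambda>z. if z \<in> ?D then q (U, \<phi>) (inv_into U \<phi> z) else 0)"
  have [measurable]: "F \<in> borel_measurable borel" unfolding F_def
    by (rule borel_measurable_continuous_on_if)
       (use op qd_coeff_holomorphic[OF Y q a] holomorphic_on_imp_continuous_on in auto)
  have [measurable]: "A \<in> sets borel" by fact
  have "(\<lambda>z. indicator A z * cmod (F z)) \<in> borel_measurable borel" by measurable
  moreover have "indicator A z * cmod (F z) = indicator A z * cmod (q (U, \<phi>) (inv_into U \<phi> z))" for z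
    using A(2) by (auto simp: F_def indicator_def)
  ultimately show ?thesis by simp
qed

definition chart_area :: "'a qdiff \<Rightarrow> 'a chart \<Rightarrow> 'a set \<Rightarrow> ennreal" where
  "chart_area q = (\<lambda>(U, \<phi>) B. \<integral>\<^sup>+z\<in>\<phi> ` B. ennreal (cmod (q (U, \<phi>) (inv_into U \<phi> z))) \<partial>lborel)"

text \<open>The chart carries this set function to a measure on the plane with density the modulus
  of the coefficient, cut off outside the chart image so as to be Borel everywhere. Injectivity of
  the chart keeps disjoint sets disjoint.\<close>

lemma chart_area_countably_additive:
  assumes Y: "charted_surface Y" and q: "quadratic_differential Y q" and a: "(U, \<phi>) \<in> surf_atlas Y"
    and A: "range A \<subseteq> surf_sets Y" "disjoint_family A" "\<And>i. A i \<subseteq> U"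
  shows "(\<Sum>i. chart_area q (U, \<phi>) (A i)) = chart_area q (U, \<phi>) (\<Union>i. A i)"
proof -
  let ?D = "\<phi> ` (U \<inter> surf_interior Y)"
  interpret sigma_algebra "surf_interior Y" "surf_sets Y" by (rule sigma_algebra_surf_sets)
  define M where "M = density lborel (\<lambda>z. ennreal (indicator ?D z * cmod (q (U, \<phi>) (inv_into U \<phi> z))))"
  have op: "open ?D" by (rule open_chart_interior_image[OF Y a])
  have M: "emeasure M (\<phi> ` B) = chart_area q (U, \<phi>) B" if B: "B \<in> surf_sets Y" "B \<subseteq> U" for B
  proof -
    have "emeasure M (\<phi> ` B) = (\<integral>\<^sup>+z\<in>\<phi> ` B. ennreal (indicator ?D z * cmod (q (U, \<phi>) (inv_into U \<phi> z))) \<partial>lborel)"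
      unfolding M_def using chart_image_borel[OF Y a B] qd_coeff_borel[OF Y q a, of ?D] op
      by (intro emeasure_density) auto
    also have "\<dots> = chart_area q (U, \<phi>) B" unfolding chart_area_def split_conv
      by (rule nn_integral_cong) (use B(2) surf_sets_subset[OF B(1)] in \<open>auto simp: indicator_def\<close>)
    finally show ?thesis .
  qed
  have "(\<Sum>i. chart_area q (U, \<phi>) (A i)) = (\<Sum>i. emeasure M (\<phi> ` A i))"
    using A by (intro suminf_cong M[symmetric]) auto
  also have "\<dots> = emeasure M (\<Union>i. \<phi> ` A i)"
  proof (rule suminf_emeasure)
    show "range (\<lambda>i. \<phi> ` A i) \<subseteq> sets M" using chart_image_borel[OF Y a] A by (auto simp: M_def)
    show "disjoint_family (\<lambda>i. \<phi> ` A i)"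
      using A(2,3) inj_on_chart[OF Y a] unfolding disjoint_family_on_def
      by (metis UNIV_I image_empty inj_on_image_Int)
  qed
  also have "(\<Union>i. \<phi> ` A i) = \<phi> ` (\<Union>i. A i)" by auto
  also have "emeasure M \<dots> = chart_area q (U, \<phi>) (\<Union>i. A i)"
    using A by (intro M) auto
  finally show ?thesis .
qed

lemma chart_area_empty [simp]: "chart_area q c {} = 0"
  by (cases c) (simp add: chart_area_def)

lemma chart_area_add:
  assumes Y: "charted_surface Y" and q: "quadratic_differential Y q" and a: "(U, \<phi>) \<in> surf_atlas Y"
    and A: "A \<in> surf_sets Y" "B \<in> surf_sets Y" "A \<inter> B = {}" "A \<subseteq> U" "B \<subseteq> U"
  shows "chart_area q (U, \<phi>) (A \<union> B) = chart_area q (U, \<phi>) A + chart_area q (U, \<phi>) B"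
proof -
  interpret sigma_algebra "surf_interior Y" "surf_sets Y" by (rule sigma_algebra_surf_sets)
  have "(\<Sum>i. chart_area q (U, \<phi>) (binaryset A B i)) = chart_area q (U, \<phi>) (\<Union>i. binaryset A B i)"
    using A by (intro chart_area_countably_additive[OF Y q a])
      (auto simp: range_binaryset_eq disjoint_family_on_def binaryset_def)
  then show ?thesis
    by (simp add: UN_binaryset_eq suminf_binaryset_eq[of "chart_area q (U, \<phi>)"])
qed

section \<open>Existence and uniqueness of the area measure\<close>

text \<open>Inverse charts, embeddings read in a chart and the lifts of both to a cover all have
  this form, so one area formula serves them all. Holomorphy is tested in every chart of the target,
  which avoids choosing one.\<close>

definition conformal_param :: "'a surf \<Rightarrow> complex set \<Rightarrow> (complex \<Rightarrow> 'a) \<Rightarrow> bool" where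
  "conformal_param Y \<Omega> G \<longleftrightarrow>
     open \<Omega> \<and> continuous_map (top_of_set \<Omega>) (surf_top Y) G \<and> inj_on G \<Omega> \<and> G ` \<Omega> \<subseteq> surf_interior Y \<and>
     (\<forall>(V, \<psi>) \<in> surf_atlas Y. (\<lambda>z. \<psi> (G z)) holomorphic_on {z \<in> \<Omega>. G z \<in> V})"

lemma conformal_paramD:
  assumes "conformal_param Y \<Omega> G"
  shows "open \<Omega>" "continuous_map (top_of_set \<Omega>) (surf_top Y) G" "inj_on G \<Omega>" "G ` \<Omega> \<subseteq> surf_interior Y"
    and "(V, \<psi>) \<in> surf_atlas Y \<Longrightarrow> (\<lambda>z. \<psi> (G z)) holomorphic_on {z \<in> \<Omega>. G z \<in> V}"
  using assms unfolding conformal_param_def by auto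

lemma conformal_param_inv_chart:
  assumes Y: "riemann_surface Y" and a: "(U, \<phi>) \<in> surf_atlas Y"
  shows "conformal_param Y (\<phi> ` (U \<inter> surf_interior Y)) (inv_into U \<phi>)"
proof -
  note Y' = riemann_surface_imp_charted[OF Y]
  note inj = inj_on_chart[OF Y' a]
  let ?W = "U \<inter> surf_interior Y"
  have W: "openin (surf_top Y) ?W" "?W \<inter> surf_boundary Y = {}"
    using openin_chart[OF Y' a] openin_surf_interior[OF Y'] interior_Int_boundary[of ?W] by (auto simp: openin_Int)
  have inv: "inv_into U \<phi> (\<phi> y) = y" if "y \<in> U" for y using inj that by (rule inv_into_f_f)
  have "(\<lambda>z. \<psi> (inv_into U \<phi> z)) holomorphic_on {z \<in> \<phi> ` ?W. inv_into U \<phi> z \<in> V}"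
    if b: "(V, \<psi>) \<in> surf_atlas Y" for V \<psi>
  proof -
    have "{z \<in> \<phi> ` ?W. inv_into U \<phi> z \<in> V} = \<phi> ` (?W \<inter> V)" using inv by auto
    moreover have "(\<lambda>z. \<psi> (inv_into U \<phi> z)) holomorphic_on \<phi> ` (?W \<inter> V)"
      by (rule transition_holomorphic[OF Y a b]) (use W openin_chart[OF Y' b] in \<open>auto simp: openin_Int\<close>)
    ultimately show ?thesis by simp
  qed
  moreover have "inj_on (inv_into U \<phi>) (\<phi> ` ?W)" by (rule inj_on_inv_into) auto
  moreover have "inv_into U \<phi> ` \<phi> ` ?W \<subseteq> surf_interior Y" using inv by auto
  ultimately show ?thesis unfolding conformal_param_def
    using open_chart_interior_image[OF Y' a] continuous_map_inv_chart[OF Y' a W(1) _ W(2)] by auto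
qed

lemma open_param_preimage:
  assumes "conformal_param Y \<Omega> G" "openin (surf_top Y) W"
  shows "open {z \<in> \<Omega>. G z \<in> W}"
  by (rule open_Collect_preimage[OF conformal_paramD(1,2)[OF assms(1)] assms(2)])

lemma chart_area_param:
  assumes Y: "charted_surface Y" and q: "quadratic_differential Y q" and G: "conformal_param Y \<Omega> G"
    and a: "(V, \<psi>) \<in> surf_atlas Y" and E: "E \<in> sets borel" "E \<subseteq> \<Omega>" "G ` E \<subseteq> V"
  shows "chart_area q (V, \<psi>) (G ` E) =
    (\<integral>\<^sup>+z\<in>E. ennreal (cmod (q (V, \<psi>) (G z) * (deriv (\<psi> \<circ> G) z)\<^sup>2)) \<partial>lborel)"
proof -
  note G' = conformal_paramD[OF G]
  let ?\<Omega> = "{z \<in> \<Omega>. G z \<in> V}"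
  let ?k = "\<lambda>z. \<psi> (G z)"
  let ?g = "\<lambda>w. cmod (q (V, \<psi>) (inv_into V \<psi> w))"
  have inv: "inv_into V \<psi> (\<psi> y) = y" if "y \<in> V" for y using inj_on_chart[OF Y a] that by (rule inv_into_f_f)
  have op: "open ?\<Omega>" by (rule open_param_preimage[OF G openin_chart[OF Y a]])
  have k: "?k holomorphic_on ?\<Omega>" by (rule G'(5)[OF a])
  have inj: "inj_on ?k ?\<Omega>"
    using G'(3) inj_on_chart[OF Y a] by (auto simp: inj_on_def)
  have "(\<integral>\<^sup>+w\<in>?k ` E. ennreal (?g w) \<partial>lborel) = (\<integral>\<^sup>+z\<in>E. ennreal (?g (?k z) * (cmod (deriv ?k z))\<^sup>2) \<partial>lborel)"
  proof (rule set_nn_integral_holomorphic_image[OF op k inj E(1)])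
    show "E \<subseteq> ?\<Omega>" using E by auto
    have "open (?k ` ?\<Omega>)" using op inj k holomorphic_on_imp_continuous_on invariance_of_domain by blast
    then show "(\<lambda>w. indicator (?k ` ?\<Omega>) w * ?g w) \<in> borel_measurable borel"
      by (intro qd_coeff_borel[OF Y q a]) (use G'(4) in auto)
  qed simp
  also have "\<dots> = (\<integral>\<^sup>+z\<in>E. ennreal (cmod (q (V, \<psi>) (G z) * (deriv (\<psi> \<circ> G) z)\<^sup>2)) \<partial>lborel)"
    using E(3) inv by (intro nn_integral_cong) (auto simp: indicator_def norm_mult norm_power o_def image_subset_iff)
  finally show ?thesis by (simp add: chart_area_def image_image)
qed

text \<open>The coefficient of the pull-back of \<open>q\<close> by \<open>G\<close> in the plane
  coordinate. The chart is picked exactly as in \<open>pullback_qd\<close>, so that the two agree by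
  unfolding when \<open>G\<close> is a map read in a chart.\<close>

definition qd_along :: "'a surf \<Rightarrow> 'a qdiff \<Rightarrow> (complex \<Rightarrow> 'a) \<Rightarrow> complex \<Rightarrow> complex" where
  "qd_along Y q G z =
     (let (V, \<psi>) = (SOME c. c \<in> surf_atlas Y \<and> G z \<in> fst c) in q (V, \<psi>) (G z) * (deriv (\<psi> \<circ> G) z)\<^sup>2)"

text \<open>With \<open>k\<close> the transition from the chosen chart to the given one, the
  transformation law contributes the square of the derivative of \<open>k\<close>, and the chain
  rule absorbs it into the derivative of \<open>\<psi> \<circ> G\<close>.\<close>

lemma qd_along_chart:
  assumes Y: "riemann_surface Y" and q: "quadratic_differential Y q" and G: "conformal_param Y \<Omega> G"
    and a: "(V, \<psi>) \<in> surf_atlas Y" and z: "z \<in> \<Omega>" "G z \<in> V"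
  shows "qd_along Y q G z = q (V, \<psi>) (G z) * (deriv (\<psi> \<circ> G) z)\<^sup>2"
proof -
  note Y' = riemann_surface_imp_charted[OF Y]
  note G' = conformal_paramD[OF G]
  obtain V' \<psi>' where c: "(SOME c. c \<in> surf_atlas Y \<and> G z \<in> fst c) = (V', \<psi>')" by fastforce
  have "(V', \<psi>') \<in> surf_atlas Y \<and> G z \<in> fst (V', \<psi>')"
    unfolding c[symmetric] by (rule someI[of _ "(V, \<psi>)"]) (use a z in auto)
  then have a': "(V', \<psi>') \<in> surf_atlas Y" and zV': "G z \<in> V'" by auto
  have zi: "G z \<in> surf_interior Y" using G'(4) z(1) by blast
  define W where "W = V \<inter> V' \<inter> surf_interior Y"
  have W: "openin (surf_top Y) W" "W \<subseteq> V'" "W \<subseteq> V" "W \<inter> surf_boundary Y = {}"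
    using openin_chart[OF Y' a] openin_chart[OF Y' a'] openin_surf_interior[OF Y'] interior_Int_boundary[of W]
    by (auto simp: W_def openin_Int)
  define k where "k = \<psi> \<circ> inv_into V' \<psi>'"
  have k: "k holomorphic_on \<psi>' ` W" using transition_holomorphic[OF Y a' a W] by (simp add: k_def o_def)
  have "open (\<psi>' ` W)" by (rule open_chart_image[OF Y' a' W(1,2,4)])
  moreover have zW: "G z \<in> W" using z(2) zV' zi by (simp add: W_def)
  ultimately have dk: "(k has_field_derivative deriv k (\<psi>' (G z))) (at (\<psi>' (G z)))"
    by (intro holomorphic_derivI[OF k]) auto
  have "((\<lambda>w. \<psi>' (G w)) has_field_derivative deriv (\<lambda>w. \<psi>' (G w)) z) (at z)"
    by (rule holomorphic_derivI[OF G'(5)[OF a'] open_param_preimage[OF G openin_chart[OF Y' a']]])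
       (use z zV' in auto)
  then have "((\<lambda>w. k (\<psi>' (G w))) has_field_derivative deriv k (\<psi>' (G z)) * deriv (\<lambda>w. \<psi>' (G w)) z) (at z)"
    using DERIV_chain2[of k _ "\<lambda>w. \<psi>' (G w)" z] dk by blast
  moreover have "k (\<psi>' (G w)) = \<psi> (G w)" if "w \<in> {w \<in> \<Omega>. G w \<in> W}" for w
    using that inj_on_chart[OF Y' a'] W(2) by (auto simp: k_def)
  ultimately have "((\<lambda>w. \<psi> (G w)) has_field_derivative deriv k (\<psi>' (G z)) * deriv (\<lambda>w. \<psi>' (G w)) z) (at z)"
    using has_field_derivative_transform_within_open[OF _ open_param_preimage[OF G W(1)]] z(1) zW by auto
  then have "deriv (\<psi> \<circ> G) z = deriv k (\<psi>' (G z)) * deriv (\<psi>' \<circ> G) z"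
    by (simp add: DERIV_imp_deriv o_def)
  moreover have "q (V', \<psi>') (G z) = q (V, \<psi>) (G z) * (deriv k (\<psi>' (G z)))\<^sup>2"
    using q a a' z(2) zV' zi unfolding quadratic_differential_def k_def by blast
  ultimately show ?thesis
    unfolding qd_along_def c by (simp add: power_mult_distrib mult_ac)
qed

lemma qd_along_holomorphic:
  assumes Y: "riemann_surface Y" and q: "quadratic_differential Y q" and G: "conformal_param Y \<Omega> G"
  shows "qd_along Y q G holomorphic_on \<Omega>"
proof (rule holomorphic_on_locally)
  note Y' = riemann_surface_imp_charted[OF Y]
  note G' = conformal_paramD[OF G]
  show "open \<Omega>" by (rule G'(1))
  fix z assume z: "z \<in> \<Omega>"
  then have "G z \<in> topspace (surf_top Y)" using G'(4) by (auto simp: surf_interior_def)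
  then obtain V \<psi> where a: "(V, \<psi>) \<in> surf_atlas Y" and zV: "G z \<in> V" using charted_surface_covered[OF Y'] by blast
  let ?\<Omega> = "{w \<in> \<Omega>. G w \<in> V}"
  have op: "open ?\<Omega>" by (rule open_param_preimage[OF G openin_chart[OF Y' a]])
  have inv: "inv_into V \<psi> (\<psi> y) = y" if "y \<in> V" for y using inj_on_chart[OF Y' a] that by (rule inv_into_f_f)
  let ?g = "\<lambda>w. q (V, \<psi>) (inv_into V \<psi> (\<psi> (G w))) * (deriv (\<lambda>w. \<psi> (G w)) w)\<^sup>2"
  have "(\<lambda>w. q (V, \<psi>) (inv_into V \<psi> (\<psi> (G w)))) holomorphic_on ?\<Omega>"
    by (rule holomorphic_on_compose_gen[OF G'(5)[OF a] qd_coeff_holomorphic[OF Y' q a], unfolded o_def])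
       (use G'(4) in auto)
  then have g: "?g holomorphic_on ?\<Omega>"
    using holomorphic_deriv[OF G'(5)[OF a] op] by (rule holomorphic_on_mult[OF _ holomorphic_on_power])
  obtain e where e: "0 < e" "ball z e \<subseteq> ?\<Omega>" using op z zV open_contains_ball[of ?\<Omega>] by auto
  show "\<exists>e>0. \<exists>g. g holomorphic_on ball z e \<and> (\<forall>w\<in>\<Omega> \<inter> ball z e. qd_along Y q G w = g w)"
  proof (intro exI conjI ballI)
    show "?g holomorphic_on ball z e" using g e(2) by (rule holomorphic_on_subset)
    fix w assume "w \<in> \<Omega> \<inter> ball z e"
    then have "w \<in> \<Omega>" "G w \<in> V" using e by auto
    then show "qd_along Y q G w = ?g w"
      using qd_along_chart[OF Y q G a] inv by (simp add: o_def)
  qed (rule e)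
qed

section \<open>Area measures: uniqueness by finite chart covers, existence by gluing\<close>

lemma is_area_measureD:
  assumes "is_area_measure X q M"
  shows "space M = surf_interior X" "sets M = surf_sets X"
    and "(U, \<phi>) \<in> surf_atlas X \<Longrightarrow> B \<in> surf_sets X \<Longrightarrow> B \<subseteq> U \<Longrightarrow> emeasure M B = chart_area q (U, \<phi>) B"
proof -
  show "space M = surf_interior X" and s: "sets M = surf_sets X"
    using assms by (simp_all add: is_area_measure_def surf_sets_def)
  show "emeasure M B = chart_area q (U, \<phi>) B"
    if "(U, \<phi>) \<in> surf_atlas X" "B \<in> surf_sets X" "B \<subseteq> U"
    using assms that s unfolding is_area_measure_def chart_area_def by fastforce
qed

lemma is_area_measureI:
  assumes "space M = surf_interior X" "sets M = surf_sets X"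
    and "\<And>U \<phi> B. (U, \<phi>) \<in> surf_atlas X \<Longrightarrow> B \<in> surf_sets X \<Longrightarrow> B \<subseteq> U \<Longrightarrow> emeasure M B = chart_area q (U, \<phi>) B"
  shows "is_area_measure X q M"
  using assms by (auto simp: is_area_measure_def surf_sets_def chart_area_def)

lemma finite_chart_cover:
  assumes X: "charted_surface X"
  obtains c :: "nat \<Rightarrow> 'a chart" and n where "\<And>i. i < n \<Longrightarrow> c i \<in> surf_atlas X" "topspace (surf_top X) \<subseteq> (\<Union>i<n. fst (c i))"
proof -
  have "\<exists>\<F>. finite \<F> \<and> \<F> \<subseteq> fst ` surf_atlas X \<and> topspace (surf_top X) \<subseteq> \<Union>\<F>"
    using charted_surface_compact[OF X] unfolding compact_space_alt
    by (elim allE[of _ "fst ` surf_atlas X"] impE) (use openin_chart[OF X] charted_surface_covered[OF X] in force)+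
  then obtain C where C: "finite C" "C \<subseteq> surf_atlas X" "topspace (surf_top X) \<subseteq> \<Union>(fst ` C)"
    by (metis finite_subset_image)
  then obtain c :: "nat \<Rightarrow> 'a chart" and n where "C = c ` {i. i < n}"
    using finite_imp_nat_seg_image_inj_on by metis
  with C have "\<And>i. i < n \<Longrightarrow> c i \<in> surf_atlas X" "topspace (surf_top X) \<subseteq> (\<Union>i<n. fst (c i))"
    by (auto simp: lessThan_def)
  then show ?thesis by (rule that)
qed

lemma area_measure_unique:
  assumes X: "charted_surface X" and M: "is_area_measure X q M" "is_area_measure X q M'"
  shows "M = M'"
proof (rule measure_eqI)
  note D = is_area_measureD[OF M(1)] and D' = is_area_measureD[OF M(2)]
  show "sets M = sets M'" using D(2) D'(2) by simp
  fix A assume A: "A \<in> sets M"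
  obtain c :: "nat \<Rightarrow> 'a chart" and n where c: "\<And>i. i < n \<Longrightarrow> c i \<in> surf_atlas X"
      "topspace (surf_top X) \<subseteq> (\<Union>i<n. fst (c i))"
    by (rule finite_chart_cover[OF X]) blast
  let ?I = "(\<lambda>i. fst (c i) \<inter> surf_interior X) ` {..<n}"
  have cc: "(fst (c i), snd (c i)) \<in> surf_atlas X" if "i < n" for i using c(1) that by simp
  show "emeasure M A = emeasure M' A"
  proof (rule additive_eq_of_finite_cover[OF sigma_algebra_surf_sets[of X], where I = ?I])
    show "?I \<subseteq> surf_sets X"
      using openin_chart[OF X cc] openin_surf_interior[OF X] by (auto intro!: surf_setsI)
    show "emeasure M B = emeasure M' B" if "U \<in> ?I" "B \<in> surf_sets X" "B \<subseteq> U" for U B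
      using that D(3)[OF cc] D'(3)[OF cc] by fastforce
    show "A \<subseteq> \<Union>?I"
      using c(2) surf_sets_subset[of A X] A D(2) by (fastforce simp: surf_interior_def)
  qed (use A D(2) D'(2) plus_emeasure[of _ M] plus_emeasure[of _ M'] in auto)
qed

lemma area_measure_eqI:
  assumes "charted_surface X" "is_area_measure X q M"
  shows "area_measure X q = M"
  unfolding area_measure_def using assms area_measure_unique by blast

lemma chart_area_transition:
  assumes Y: "riemann_surface Y" and q: "quadratic_differential Y q"
    and a: "(U, \<phi>) \<in> surf_atlas Y" and b: "(V, \<psi>) \<in> surf_atlas Y"
    and B: "B \<in> surf_sets Y" "B \<subseteq> U" "B \<subseteq> V"
  shows "chart_area q (V, \<psi>) B = chart_area q (U, \<phi>) B"
proof -
  note Y' = riemann_surface_imp_charted[OF Y]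
  have inv: "inv_into U \<phi> (\<phi> y) = y" if "y \<in> U" for y using inj_on_chart[OF Y' a] that by (rule inv_into_f_f)
  have G: "inv_into U \<phi> ` \<phi> ` B = B" using inv B(2) by force
  have "chart_area q (c, \<theta>) B = mass (qd_along Y q (inv_into U \<phi>)) (\<phi> ` B)"
    if c: "(c, \<theta>) \<in> surf_atlas Y" "B \<subseteq> c" for c \<theta>
  proof -
    have sub: "\<phi> ` B \<subseteq> \<phi> ` (U \<inter> surf_interior Y)" using B(2) surf_sets_subset[OF B(1)] by blast
    have "chart_area q (c, \<theta>) (inv_into U \<phi> ` \<phi> ` B) =
      (\<integral>\<^sup>+z\<in>\<phi> ` B. ennreal (cmod (q (c, \<theta>) (inv_into U \<phi> z) * (deriv (\<theta> \<circ> inv_into U \<phi>) z)\<^sup>2)) \<partial>lborel)"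
      by (rule chart_area_param[OF Y' q conformal_param_inv_chart[OF Y a] c(1) chart_image_borel[OF Y' a B(1,2)] sub])
         (simp add: G c)
    also have "\<dots> = mass (qd_along Y q (inv_into U \<phi>)) (\<phi> ` B)"
    proof (rule nn_integral_cong)
      fix z
      have "q (c, \<theta>) (inv_into U \<phi> z) * (deriv (\<theta> \<circ> inv_into U \<phi>) z)\<^sup>2 = qd_along Y q (inv_into U \<phi>) z" if "z \<in> \<phi> ` B"
        by (rule qd_along_chart[OF Y q conformal_param_inv_chart[OF Y a] c(1), symmetric]) (use that sub G c in auto)
      then show "ennreal (cmod (q (c, \<theta>) (inv_into U \<phi> z) * (deriv (\<theta> \<circ> inv_into U \<phi>) z)\<^sup>2)) * indicator (\<phi> ` B) z =
          ennreal (cmod (qd_along Y q (inv_into U \<phi>) z)) * indicator (\<phi> ` B) z"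
        by (simp add: indicator_def)
    qed
    finally show ?thesis by (simp only: G)
  qed
  then show ?thesis using a b B by metis
qed

text \<open>Finitely many charts are cut down to disjoint pieces \<open>D i\<close>, and the areas
  of the parts in the pieces, each taken in its own chart, are added. By the transition lemma the
  sum agrees with the area in any chart of the atlas.\<close>

lemma area_measure_exists:
  assumes Y: "riemann_surface Y" and q: "quadratic_differential Y q"
  shows "\<exists>M. is_area_measure Y q M"
proof -
  note Y' = riemann_surface_imp_charted[OF Y]
  interpret sigma_algebra "surf_interior Y" "surf_sets Y" by (rule sigma_algebra_surf_sets)
  obtain c :: "nat \<Rightarrow> 'a chart" and n where c: "\<And>i. i < n \<Longrightarrow> c i \<in> surf_atlas Y"
      "topspace (surf_top Y) \<subseteq> (\<Union>i<n. fst (c i))"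
    by (rule finite_chart_cover[OF Y']) blast
  have cc: "(fst (c i), snd (c i)) \<in> surf_atlas Y" if "i < n" for i using c(1) that by simp
  define D where "D = (\<lambda>i. fst (c i) \<inter> surf_interior Y - (\<Union>j<i. fst (c j) \<inter> surf_interior Y))"
  have U: "fst (c i) \<inter> surf_interior Y \<in> surf_sets Y" if "i < n" for i
    using openin_chart[OF Y' cc[OF that]] openin_surf_interior[OF Y'] by (intro surf_setsI) (auto simp: openin_Int)
  have D: "D i \<in> surf_sets Y" if "i < n" for i
    unfolding D_def using U that by (intro Diff finite_UN) auto
  have Dsub: "D i \<subseteq> fst (c i)" for i by (auto simp: D_def)
  define \<mu> where "\<mu> = (\<lambda>B. \<Sum>i<n. chart_area q (c i) (B \<inter> D i))"
  have ca: "countably_additive (surf_sets Y) \<mu>"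
    unfolding countably_additive_def
  proof (intro allI impI)
    fix A :: "nat \<Rightarrow> 'a set" assume A: "range A \<subseteq> surf_sets Y" "disjoint_family A"
    have "(\<Sum>k. \<mu> (A k)) = (\<Sum>i<n. \<Sum>k. chart_area q (c i) (A k \<inter> D i))"
      unfolding \<mu>_def by (rule suminf_sum) simp
    also have "\<dots> = \<mu> (\<Union>k. A k)" unfolding \<mu>_def
    proof (rule sum.cong[OF refl])
      fix i assume i: "i \<in> {..<n}"
      then have "(\<Sum>k. chart_area q (fst (c i), snd (c i)) (A k \<inter> D i)) = chart_area q (fst (c i), snd (c i)) (\<Union>k. A k \<inter> D i)"
      proof (intro chart_area_countably_additive[OF Y' q cc])
        show "range (\<lambda>k. A k \<inter> D i) \<subseteq> surf_sets Y"
          using A(1) D[of i] i by (intro image_subsetI Int) auto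
        show "disjoint_family (\<lambda>k. A k \<inter> D i)"
          using A(2) unfolding disjoint_family_on_def by blast
        show "A k \<inter> D i \<subseteq> fst (c i)" for k using Dsub by blast
      qed simp
      then show "(\<Sum>k. chart_area q (c i) (A k \<inter> D i)) = chart_area q (c i) ((\<Union>k. A k) \<inter> D i)"
        by simp
    qed
    finally show "(\<Sum>k. \<mu> (A k)) = \<mu> (\<Union>k. A k)" .
  qed
  define M where "M = measure_of (surf_interior Y) (surf_sets Y) \<mu>"
  have em: "emeasure M B = \<mu> B" if "B \<in> surf_sets Y" for B
    unfolding M_def by (rule emeasure_measure_of_sigma[OF sigma_algebra_surf_sets _ ca that]) (simp add: positive_def \<mu>_def)
  have "is_area_measure Y q M"
  proof (rule is_area_measureI)
    show "space M = surf_interior Y" "sets M = surf_sets Y"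
      unfolding M_def using space_closed sigma_sets_eq by (simp_all add: space_measure_of sets_measure_of)
    fix U \<phi> B assume a: "(U, \<phi>) \<in> surf_atlas Y" and B: "B \<in> surf_sets Y" "B \<subseteq> U"
    have "(\<Sum>i<m. chart_area q (U, \<phi>) (B \<inter> D i)) = chart_area q (U, \<phi>) (B \<inter> (\<Union>i<m. fst (c i) \<inter> surf_interior Y))"
      if "m \<le> n" for m using that
    proof (induction m)
      case (Suc m)
      let ?A = "\<Union>i<m. fst (c i) \<inter> surf_interior Y"
      have "?A \<in> surf_sets Y" using U Suc.prems by (intro finite_UN) auto
      moreover have "B \<inter> (\<Union>i<Suc m. fst (c i) \<inter> surf_interior Y) = (B \<inter> ?A) \<union> (B \<inter> D m)"
        by (auto simp: D_def less_Suc_eq)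
      moreover have "(B \<inter> ?A) \<inter> (B \<inter> D m) = {}" by (auto simp: D_def)
      ultimately have "chart_area q (U, \<phi>) (B \<inter> (\<Union>i<Suc m. fst (c i) \<inter> surf_interior Y)) =
         chart_area q (U, \<phi>) (B \<inter> ?A) + chart_area q (U, \<phi>) (B \<inter> D m)"
        using B D[of m] Suc.prems by (simp only:) (intro chart_area_add[OF Y' q a], auto)
      then show ?case using Suc by simp
    qed simp
    moreover have "B \<inter> (\<Union>i<n. fst (c i) \<inter> surf_interior Y) = B"
      using c(2) surf_sets_subset[OF B(1)] by (fastforce simp: surf_interior_def)
    moreover have "\<mu> B = (\<Sum>i<n. chart_area q (U, \<phi>) (B \<inter> D i))"
      unfolding \<mu>_def
    proof (rule sum.cong[OF refl])
      fix i assume i: "i \<in> {..<n}"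
      have "chart_area q (fst (c i), snd (c i)) (B \<inter> D i) = chart_area q (U, \<phi>) (B \<inter> D i)"
        by (rule chart_area_transition[OF Y q a cc]) (use i B D Dsub in auto)
      then show "chart_area q (c i) (B \<inter> D i) = chart_area q (U, \<phi>) (B \<inter> D i)" by simp
    qed
    ultimately show "emeasure M B = chart_area q (U, \<phi>) B" using em[OF B(1)] by simp
  qed
  then show ?thesis ..
qed

lemma is_area_measure_area_measure:
  assumes "riemann_surface Y" "quadratic_differential Y q"
  shows "is_area_measure Y q (area_measure Y q)"
  using area_measure_exists[OF assms] area_measure_eqI[OF riemann_surface_imp_charted[OF assms(1)]] by metis

section \<open>Area of a pulled-back differential\<close>

lemma borel_image_param:
  assumes "charted_surface Y" "conformal_param Y \<Omega> G" "E \<in> sets borel" "E \<subseteq> \<Omega>"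
  shows "G ` E \<in> surf_sets Y"
  by (rule borel_image_surf_sets[OF assms(1) conformal_paramD(1-4)[OF assms(2)] assms(3,4)])

text \<open>The image need not fit into one chart. Both sides are finitely additive in
  \<open>E\<close>, and on the preimages of finitely many covering charts the equality is a change
  of variables.\<close>

lemma emeasure_param:
  assumes Y: "riemann_surface Y" and q: "quadratic_differential Y q" and G: "conformal_param Y \<Omega> G"
    and E: "E \<in> sets borel" "E \<subseteq> \<Omega>"
  shows "emeasure (area_measure Y q) (G ` E) = mass (qd_along Y q G) E"
proof -
  note Y' = riemann_surface_imp_charted[OF Y]
  note G' = conformal_paramD[OF G]
  note M = is_area_measureD[OF is_area_measure_area_measure[OF Y q]]
  obtain c :: "nat \<Rightarrow> 'a chart" and n where c: "\<And>i. i < n \<Longrightarrow> c i \<in> surf_atlas Y"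
      "topspace (surf_top Y) \<subseteq> (\<Union>i<n. fst (c i))"
    by (rule finite_chart_cover[OF Y']) blast
  have cc: "(fst (c i), snd (c i)) \<in> surf_atlas Y" if "i < n" for i using c(1) that by simp
  define H where "H = (\<lambda>z. if z \<in> \<Omega> then qd_along Y q G z else 0)"
  have [measurable]: "H \<in> borel_measurable borel" unfolding H_def
    by (rule borel_measurable_continuous_on_if)
       (use G'(1) qd_along_holomorphic[OF Y q G] holomorphic_on_imp_continuous_on in auto)
  define N where "N = density lborel (\<lambda>z. ennreal (cmod (H z)))"
  have N: "emeasure N A = mass (qd_along Y q G) A"
    if A: "A \<in> sets borel" "A \<subseteq> \<Omega>" for A
  proof -
    have "emeasure N A = mass H A"
      unfolding N_def by (rule emeasure_density) (use A in auto)
    also have "\<dots> = mass (qd_along Y q G) A"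
      by (rule nn_integral_cong) (use A(2) in \<open>auto simp: H_def indicator_def\<close>)
    finally show ?thesis .
  qed
  let ?S = "sets (restrict_space borel \<Omega>)"
  have S: "A \<in> ?S \<longleftrightarrow> A \<in> sets borel \<and> A \<subseteq> \<Omega>" for A
    using G'(1) by (subst sets_restrict_space_iff) auto
  have sa: "sigma_algebra \<Omega> ?S"
    using sets.sigma_algebra_axioms[of "restrict_space borel \<Omega>"] by (simp add: space_restrict_space)
  let ?I = "(\<lambda>i. {z \<in> \<Omega>. G z \<in> fst (c i)}) ` {..<n}"
  have "emeasure (area_measure Y q) (G ` E) = emeasure N E"
  proof (rule additive_eq_of_finite_cover[OF sa, where I = ?I and m = "\<lambda>E. emeasure (area_measure Y q) (G ` E)"])
    show "?I \<subseteq> ?S"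
      using open_param_preimage[OF G openin_chart[OF Y' cc]] by (auto simp: S)
    show "emeasure (area_measure Y q) (G ` B) = emeasure N B" if U: "U \<in> ?I" "B \<in> ?S" "B \<subseteq> U" for U B
    proof -
      obtain i where i: "i < n" and Bi: "G ` B \<subseteq> fst (c i)" using U by auto
      have B: "B \<in> sets borel" "B \<subseteq> \<Omega>" using U by (auto simp: S)
      have "emeasure (area_measure Y q) (G ` B) = chart_area q (fst (c i), snd (c i)) (G ` B)"
        by (rule M(3)[OF cc[OF i] borel_image_param[OF Y' G B] Bi])
      also have "\<dots> = (\<integral>\<^sup>+z\<in>B. ennreal (cmod (q (fst (c i), snd (c i)) (G z) * (deriv (snd (c i) \<circ> G) z)\<^sup>2)) \<partial>lborel)"
        by (rule chart_area_param[OF Y' q G cc[OF i] B Bi])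
      also have "\<dots> = mass (qd_along Y q G) B"
      proof (rule nn_integral_cong)
        fix z
        have "qd_along Y q G z = q (fst (c i), snd (c i)) (G z) * (deriv (snd (c i) \<circ> G) z)\<^sup>2" if "z \<in> B"
          by (rule qd_along_chart[OF Y q G cc[OF i]]) (use that B Bi in auto)
        then show "ennreal (cmod (q (fst (c i), snd (c i)) (G z) * (deriv (snd (c i) \<circ> G) z)\<^sup>2)) * indicator B z
          = ennreal (cmod (qd_along Y q G z)) * indicator B z" by (simp add: indicator_def)
      qed
      also have "\<dots> = emeasure N B" by (rule N[OF B, symmetric])
      finally show ?thesis .
    qed
    show "emeasure (area_measure Y q) (G ` (A \<union> B)) = emeasure (area_measure Y q) (G ` A) + emeasure (area_measure Y q) (G ` B)"
      if AB: "A \<in> ?S" "B \<in> ?S" "A \<inter> B = {}" for A B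
    proof -
      have "G ` A \<inter> G ` B = {}" using AB inj_on_image_Int[OF G'(3), of A B] by (simp add: S)
      moreover have "G ` A \<in> sets (area_measure Y q)" "G ` B \<in> sets (area_measure Y q)"
        using borel_image_param[OF Y' G] AB by (auto simp: S M(2))
      ultimately show ?thesis by (simp add: image_Un plus_emeasure)
    qed
    show "emeasure N (A \<union> B) = emeasure N A + emeasure N B" if "A \<in> ?S" "B \<in> ?S" "A \<inter> B = {}" for A B
      using that by (intro plus_emeasure[symmetric]) (auto simp: S N_def)
    show "E \<in> ?S" using E by (simp add: S)
    show "E \<subseteq> \<Union>?I"
      using E(2) G'(4) c(2) by (fastforce simp: surf_interior_def)
  qed auto
  then show ?thesis using N[OF E] by simp
qed

section \<open>Injective holomorphic maps between surfaces and the areas of their images\<close>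

lemma conformal_param_comp_chart:
  assumes X: "charted_surface X" and Y: "riemann_surface Y"
    and F: "continuous_map (surf_top X) (surf_top Y) F" "F ` surf_interior X \<subseteq> surf_interior Y"
      "inj_on F (surf_interior X)" "\<And>x. x \<in> surf_interior X \<Longrightarrow> holomorphic_map_at X Y F x"
    and a: "(U, \<phi>) \<in> surf_atlas X"
  shows "conformal_param Y (\<phi> ` (U \<inter> surf_interior X)) (F \<circ> inv_into U \<phi>)"
proof -
  note Y' = riemann_surface_imp_charted[OF Y]
  note inj = inj_on_chart[OF X a]
  let ?W = "U \<inter> surf_interior X"
  have W: "openin (surf_top X) ?W" "?W \<inter> surf_boundary X = {}"
    using openin_chart[OF X a] openin_surf_interior[OF X] interior_Int_boundary[of ?W] by (auto simp: openin_Int)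
  have inv: "inv_into U \<phi> (\<phi> y) = y" if "y \<in> U" for y using inj that by (rule inv_into_f_f)
  have "(\<lambda>z. \<psi> ((F \<circ> inv_into U \<phi>) z)) holomorphic_on {z \<in> \<phi> ` ?W. (F \<circ> inv_into U \<phi>) z \<in> V}"
    if b: "(V, \<psi>) \<in> surf_atlas Y" for V \<psi>
  proof -
    let ?D = "{x \<in> ?W. F x \<in> V}"
    have eq: "{z \<in> \<phi> ` ?W. (F \<circ> inv_into U \<phi>) z \<in> V} = \<phi> ` ?D" using inv by auto
    have "?D = ?W \<inter> {x \<in> topspace (surf_top X). F x \<in> V}" using openin_subset[OF W(1)] by auto
    then have "openin (surf_top X) ?D"
      using W(1) openin_continuous_map_preimage[OF F(1) openin_chart[OF Y' b]] by (simp add: openin_Int)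
    then have op: "open (\<phi> ` ?D)" by (rule open_chart_image[OF X a]) (use W(2) in auto)
    have "(\<lambda>z. (\<psi> \<circ> F) (inv_into U \<phi> z)) holomorphic_on \<phi> ` ?D"
    proof (rule holomorphic_on_inv_chart[OF inj _ op])
      fix x assume x: "x \<in> ?D"
      then have "holomorphic_in_chart \<phi> {y \<in> U. F y \<in> V} x (\<lambda>y. \<psi> (F y))"
        using F(4)[of x] a b unfolding holomorphic_map_at_def by fast
      then show "holomorphic_in_chart \<phi> ?D x (\<psi> \<circ> F)"
        unfolding o_def by (rule holomorphic_in_chart_subset) auto
    qed auto
    then show ?thesis unfolding eq by (simp add: o_def)
  qed
  moreover have "inj_on (F \<circ> inv_into U \<phi>) (\<phi> ` ?W)"
    using F(3) inv by (auto simp: inj_on_def)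
  moreover have "(F \<circ> inv_into U \<phi>) ` \<phi> ` ?W \<subseteq> surf_interior Y" using inv F(2) by auto
  moreover have "continuous_map (top_of_set (\<phi> ` ?W)) (surf_top Y) (F \<circ> inv_into U \<phi>)"
    by (rule continuous_map_compose[OF continuous_map_inv_chart[OF X a W(1) _ W(2)] F(1)]) auto
  ultimately show ?thesis unfolding conformal_param_def
    using open_chart_interior_image[OF X a] by auto
qed

lemma openin_conformal_image:
  assumes X: "charted_surface X" and Y: "riemann_surface Y"
    and F: "continuous_map (surf_top X) (surf_top Y) F" "F ` surf_interior X \<subseteq> surf_interior Y"
      "inj_on F (surf_interior X)" "\<And>x. x \<in> surf_interior X \<Longrightarrow> holomorphic_map_at X Y F x"
    and W: "openin (surf_top X) W" "W \<subseteq> surf_interior X"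
  shows "openin (surf_top Y) (F ` W)"
proof (subst openin_subopen, intro ballI)
  note Y' = riemann_surface_imp_charted[OF Y]
  fix y assume "y \<in> F ` W"
  then obtain x where x: "x \<in> W" "y = F x" by blast
  then obtain U \<phi> where a: "(U, \<phi>) \<in> surf_atlas X" and xU: "x \<in> U"
    using charted_surface_covered[OF X] openin_subset[OF W(1)] by blast
  note G = conformal_param_comp_chart[OF X Y F a]
  have inv: "inv_into U \<phi> (\<phi> y) = y" if "y \<in> U" for y using inj_on_chart[OF X a] that by (rule inv_into_f_f)
  have "openin (surf_top Y) ((F \<circ> inv_into U \<phi>) ` \<phi> ` (U \<inter> W))"
  proof (rule openin_continuous_inj_image[OF Y' conformal_paramD(1-3)[OF G]])
    show "open (\<phi> ` (U \<inter> W))"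
      by (rule open_chart_image[OF X a])
         (use W openin_chart[OF X a] interior_Int_boundary[OF W(2)] in \<open>auto simp: openin_Int\<close>)
  qed (use W in auto)
  moreover have "(F \<circ> inv_into U \<phi>) ` \<phi> ` (U \<inter> W) = F ` (U \<inter> W)"
    using inv by (force simp: image_image)
  ultimately show "\<exists>T. openin (surf_top Y) T \<and> y \<in> T \<and> T \<subseteq> F ` W"
    using x xU by (intro exI[of _ "F ` (U \<inter> W)"]) auto
qed

lemma area_pullback:
  assumes X: "charted_surface X" and Y: "riemann_surface Y" and q: "quadratic_differential Y q"
    and F: "continuous_map (surf_top X) (surf_top Y) F" "F ` surf_interior X \<subseteq> surf_interior Y"
      "inj_on F (surf_interior X)" "\<And>x. x \<in> surf_interior X \<Longrightarrow> holomorphic_map_at X Y F x"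
  shows "area X (pullback_qd X Y F q) = emeasure (area_measure Y q) (F ` surf_interior X)"
proof -
  note Y' = riemann_surface_imp_charted[OF Y]
  interpret sigma_algebra "surf_interior X" "surf_sets X" by (rule sigma_algebra_surf_sets)
  let ?A = "area_measure Y q"
  note A = is_area_measureD[OF is_area_measure_area_measure[OF Y q]]
  have img: "F ` B \<in> surf_sets Y" if B: "B \<in> surf_sets X" for B
  proof -
    have "F ` (B \<inter> surf_interior X) \<in> surf_sets Y"
    proof (rule sigma_sets_image_Int[OF _ order_refl F(3) sigma_algebra_surf_sets])
      show "B \<in> sigma_sets (surf_interior X) {W. openin (surf_top X) W \<and> W \<subseteq> surf_interior X}"
        using B by (simp add: surf_sets_def)
      have op: "F ` W \<in> surf_sets Y" if "openin (surf_top X) W" "W \<subseteq> surf_interior X" for W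
        using openin_conformal_image[OF X Y F that] F(2) that(2) by (intro surf_setsI) auto
      then show "F ` surf_interior X \<in> surf_sets Y" using openin_surf_interior[OF X] by auto
      fix W assume "W \<in> {W. openin (surf_top X) W \<and> W \<subseteq> surf_interior X}"
      then show "F ` (W \<inter> surf_interior X) \<in> surf_sets Y" using op by (simp add: Int_absorb2)
    qed
    then show ?thesis using surf_sets_subset[OF B] by (simp add: Int_absorb2)
  qed
  define \<mu> where "\<mu> = (\<lambda>B. emeasure ?A (F ` B))"
  have ca: "countably_additive (surf_sets X) \<mu>"
    unfolding countably_additive_def \<mu>_def
  proof (intro allI impI)
    fix B :: "nat \<Rightarrow> 'a set" assume B: "range B \<subseteq> surf_sets X" "disjoint_family B"
    have "(\<Sum>i. emeasure ?A (F ` B i)) = emeasure ?A (\<Union>i. F ` B i)"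
    proof (rule suminf_emeasure)
      show "range (\<lambda>i. F ` B i) \<subseteq> sets ?A" using img B by (auto simp: A(2))
      show "disjoint_family (\<lambda>i. F ` B i)"
        unfolding disjoint_family_on_def
      proof (intro ballI impI)
        fix i j :: nat assume "i \<noteq> j"
        then have "B i \<inter> B j = {}" using B(2) by (auto simp: disjoint_family_on_def)
        moreover have "B i \<subseteq> surf_interior X" "B j \<subseteq> surf_interior X" using B(1) surf_sets_subset by blast+
        ultimately show "F ` B i \<inter> F ` B j = {}" using inj_on_image_Int[OF F(3)] by (metis image_empty)
      qed
    qed
    also have "(\<Union>i. F ` B i) = F ` (\<Union>i. B i)" by auto
    finally show "(\<Sum>i. emeasure ?A (F ` B i)) = emeasure ?A (F ` (\<Union>i. B i))" .
  qed
  define M where "M = measure_of (surf_interior X) (surf_sets X) \<mu>"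
  have em: "emeasure M B = \<mu> B" if "B \<in> surf_sets X" for B
    unfolding M_def by (rule emeasure_measure_of_sigma[OF sigma_algebra_surf_sets _ ca that]) (simp add: positive_def \<mu>_def)
  have "is_area_measure X (pullback_qd X Y F q) M"
  proof (rule is_area_measureI)
    show "space M = surf_interior X" "sets M = surf_sets X"
      unfolding M_def using space_closed sigma_sets_eq by (simp_all add: space_measure_of sets_measure_of)
    fix U \<phi> B assume a: "(U, \<phi>) \<in> surf_atlas X" and B: "B \<in> surf_sets X" "B \<subseteq> U"
    have inv: "inv_into U \<phi> (\<phi> y) = y" if "y \<in> U" for y using inj_on_chart[OF X a] that by (rule inv_into_f_f)
    let ?G = "F \<circ> inv_into U \<phi>"
    have "F ` B = ?G ` \<phi> ` B" using inv B(2) by (force simp: image_image)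
    then have "emeasure M B = emeasure ?A (?G ` \<phi> ` B)" using em[OF B(1)] by (simp add: \<mu>_def)
    also have "\<dots> = mass (qd_along Y q ?G) (\<phi> ` B)"
    proof (rule emeasure_param[OF Y q _ chart_image_borel[OF X a B]])
      show "conformal_param Y (\<phi> ` (U \<inter> surf_interior X)) ?G"
        by (rule conformal_param_comp_chart[OF X Y F a])
      show "\<phi> ` B \<subseteq> \<phi> ` (U \<inter> surf_interior X)" using B(2) surf_sets_subset[OF B(1)] by blast
    qed
    also have "\<dots> = chart_area (pullback_qd X Y F q) (U, \<phi>) B"
      unfolding chart_area_def split_conv
    proof (rule nn_integral_cong)
      fix z
      have "qd_along Y q ?G z = pullback_qd X Y F q (U, \<phi>) (inv_into U \<phi> z)" if "z \<in> \<phi> ` B"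
        using that B(2) inv by (auto simp: qd_along_def pullback_qd_def o_assoc)
      then show "ennreal (cmod (qd_along Y q ?G z)) * indicator (\<phi> ` B) z =
          ennreal (cmod (pullback_qd X Y F q (U, \<phi>) (inv_into U \<phi> z))) * indicator (\<phi> ` B) z"
        by (simp add: indicator_def)
    qed
    finally show "emeasure M B = chart_area (pullback_qd X Y F q) (U, \<phi>) B" .
  qed
  then have "area_measure X (pullback_qd X Y F q) = M" by (rule area_measure_eqI[OF X])
  then show ?thesis using em[OF top] by (simp add: area_def \<mu>_def)
qed

section \<open>Lifting rectangles through a covering\<close>

text \<open>The evenly covered neighbourhoods supplied by a covering map depend on the cover, whereas the area
  estimate needs a disc fixed before the cover is chosen; hence the lifting over whole rectangles.\<close>

definition lifts_over :: "'d topology \<Rightarrow> ('d \<Rightarrow> 'b) \<Rightarrow> (complex \<Rightarrow> 'b) \<Rightarrow> complex set \<Rightarrow> bool" where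
  "lifts_over X p k A \<longleftrightarrow>
     (\<forall>s \<in> topspace X. \<forall>a \<in> A. p s = k a \<longrightarrow>
        (\<exists>g. continuous_map (top_of_set A) X g \<and> g a = s \<and> (\<forall>z \<in> A. p (g z) = k z)))"

lemma covering_map_of_sheet:
  assumes p: "covering_map_of X Y p" and y: "y \<in> topspace Y"
  obtains T where "y \<in> T" "openin Y T"
    "\<And>s. s \<in> topspace X \<Longrightarrow> p s \<in> T \<Longrightarrow>
       \<exists>V g. s \<in> V \<and> openin X V \<and> homeomorphic_maps (subtopology X V) (subtopology Y T) p g"
proof -
  obtain T v where T: "y \<in> T" "openin Y T" and v: "\<Union>v = {x \<in> topspace X. p x \<in> T}" "\<forall>V \<in> v. openin X V"
      "\<forall>V \<in> v. homeomorphic_map (subtopology X V) (subtopology Y T) p"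
    using p y unfolding covering_map_of_def by blast
  have "\<exists>V g. s \<in> V \<and> openin X V \<and> homeomorphic_maps (subtopology X V) (subtopology Y T) p g"
    if "s \<in> topspace X" "p s \<in> T" for s
  proof -
    have "s \<in> \<Union>v" unfolding v(1) using that by simp
    then obtain V where "V \<in> v" "s \<in> V" by blast
    moreover obtain g where "homeomorphic_maps (subtopology X V) (subtopology Y T) p g"
      using v(3) \<open>V \<in> v\<close> unfolding homeomorphic_map_maps by auto
    ultimately show ?thesis using v(2) by auto
  qed
  then show ?thesis by (rule that[OF T])
qed

text \<open>The set where the lifts agree is closed because \<open>X\<close> is Hausdorff, and open
  because \<open>p\<close> is injective on a sheet.\<close>

lemma lift_unique:
  assumes p: "covering_map_of X Y p" and X: "Hausdorff_space X" and A: "connected A"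
    and g: "continuous_map (top_of_set A) X g" and h: "continuous_map (top_of_set A) X h"
    and pgh: "\<And>z. z \<in> A \<Longrightarrow> p (g z) = p (h z)" and a: "a \<in> A" "g a = h a" and z: "z \<in> A"
  shows "g z = h z"
proof -
  let ?E = "{z \<in> A. g z = h z}"
  have top: "g z \<in> topspace X" "h z \<in> topspace X" if "z \<in> A" for z
    using g h that by (auto simp: continuous_map_def)
  have "closedin (top_of_set A) ?E"
    using closedin_continuous_maps_eq[OF X g h] by simp
  moreover have "openin (top_of_set A) ?E"
  proof (subst openin_subopen, intro ballI)
    fix w assume w: "w \<in> ?E"
    have gX: "g w \<in> topspace X" using top(1) w by blast
    then have "p (g w) \<in> topspace Y" using p by (auto simp: covering_map_of_def)
    then obtain V k T where V: "g w \<in> V" "openin X V" and k: "homeomorphic_maps (subtopology X V) (subtopology Y T) p k"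
      by (rule covering_map_of_sheet[OF p]) (use gX in blast)
    have inj: "x = y" if "x \<in> V" "y \<in> V" "x \<in> topspace X" "y \<in> topspace X" "p x = p y" for x y
      using k that unfolding homeomorphic_maps_def by (metis IntI topspace_subtopology)
    let ?N = "{z \<in> A. g z \<in> V} \<inter> {z \<in> A. h z \<in> V}"
    have "openin (top_of_set A) ?N"
      using openin_continuous_map_preimage[OF g V(2)] openin_continuous_map_preimage[OF h V(2)] by (intro openin_Int) auto
    moreover have "w \<in> ?N" using w V by auto
    moreover have "?N \<subseteq> ?E"
    proof
      fix z assume z: "z \<in> ?N"
      then show "z \<in> ?E" using inj[of "g z" "h z"] top[of z] pgh by auto
    qed
    ultimately show "\<exists>T. openin (top_of_set A) T \<and> w \<in> T \<and> T \<subseteq> ?E" by blast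
  qed
  ultimately have "?E = {} \<or> ?E = A" using A unfolding connected_clopen by blast
  then show ?thesis using a z by blast
qed

lemma lifts_over_subset:
  assumes "lifts_over X p k A" "B \<subseteq> A"
  shows "lifts_over X p k B"
  unfolding lifts_over_def
proof (intro ballI impI)
  fix s a assume "s \<in> topspace X" "a \<in> B" "p s = k a"
  then obtain g where "continuous_map (top_of_set A) X g" "g a = s" "\<forall>z\<in>A. p (g z) = k z"
    using assms unfolding lifts_over_def by blast
  then show "\<exists>g. continuous_map (top_of_set B) X g \<and> g a = s \<and> (\<forall>z\<in>B. p (g z) = k z)"
    using assms(2) continuous_map_from_subtopology_mono by blast
qed

text \<open>The lift over the second set is started from the value of the first lift at a common
  point. Connectedness of the overlap makes the two agree on all of it, and closedness of both sets
  makes the glued map continuous.\<close>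

lemma lifts_over_Un:
  assumes p: "covering_map_of X Y p" and X: "Hausdorff_space X"
    and A: "closed A" "lifts_over X p k A" and B: "closed B" "lifts_over X p k B"
    and AB: "connected (A \<inter> B)" "A \<inter> B \<noteq> {}"
  shows "lifts_over X p k (A \<union> B)"
proof -
  have glue: "\<exists>g. continuous_map (top_of_set (A \<union> B)) X g \<and> g a = s \<and> (\<forall>z\<in>A \<union> B. p (g z) = k z)"
    if A: "closed A" "lifts_over X p k A" and B: "closed B" "lifts_over X p k B"
      and AB: "connected (A \<inter> B)" "A \<inter> B \<noteq> {}" and s: "s \<in> topspace X" "a \<in> A" "p s = k a" for A B s a
  proof -
    obtain g where g: "continuous_map (top_of_set A) X g" "g a = s" "\<forall>z\<in>A. p (g z) = k z"
      using A(2) s unfolding lifts_over_def by blast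
    obtain b where b: "b \<in> A" "b \<in> B" using AB(2) by blast
    have "g b \<in> topspace X" using g(1) b by (auto simp: continuous_map_def)
    then obtain h where h: "continuous_map (top_of_set B) X h" "h b = g b" "\<forall>z\<in>B. p (h z) = k z"
      using B(2) b g(3) unfolding lifts_over_def by metis
    have eq: "g z = h z" if "z \<in> A \<inter> B" for z
      by (rule lift_unique[OF p X AB(1) continuous_map_from_subtopology_mono[OF g(1)] continuous_map_from_subtopology_mono[OF h(1)], of b])
         (use g h b that in auto)
    define f where "f = (\<lambda>z. if z \<in> A then g z else h z)"
    have fB: "f z = h z" if "z \<in> B" for z using eq that by (simp add: f_def)
    have "continuous_map (top_of_set (A \<union> B)) X f"
      unfolding continuous_map_closedin
    proof (intro conjI allI impI)
      show "f \<in> topspace (top_of_set (A \<union> B)) \<rightarrow> topspace X"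
        using g(1) h(1) by (auto simp: f_def continuous_map_def)
      fix C assume C: "closedin X C"
      have "closedin (top_of_set A) {z \<in> A. g z \<in> C}" "closedin (top_of_set B) {z \<in> B. h z \<in> C}"
        using closedin_continuous_map_preimage[OF g(1) C] closedin_continuous_map_preimage[OF h(1) C] by simp_all
      then have "closed {z \<in> A. g z \<in> C}" "closed {z \<in> B. h z \<in> C}"
        using A(1) B(1) closedin_closed_trans by blast+
      moreover have "{z \<in> A \<union> B. f z \<in> C} = {z \<in> A. g z \<in> C} \<union> {z \<in> B. h z \<in> C}"
        using eq by (auto simp: f_def)
      ultimately have "closed {z \<in> A \<union> B. f z \<in> C}" by (simp only: closed_Un)
      then have "closedin (top_of_set (A \<union> B)) {z \<in> A \<union> B. f z \<in> C}"
        by (rule closed_subset[rotated]) auto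
      then show "closedin (top_of_set (A \<union> B)) {x \<in> topspace (top_of_set (A \<union> B)). f x \<in> C}"
        by simp
    qed
    moreover have "f a = s" using g(2) s by (simp add: f_def)
    moreover have "\<forall>z\<in>A \<union> B. p (f z) = k z" using g(3) h(3) by (auto simp: f_def)
    ultimately show ?thesis by blast
  qed
  show ?thesis unfolding lifts_over_def
  proof (intro ballI impI)
    fix s a assume s: "s \<in> topspace X" "a \<in> A \<union> B" "p s = k a"
    show "\<exists>g. continuous_map (top_of_set (A \<union> B)) X g \<and> g a = s \<and> (\<forall>z\<in>A \<union> B. p (g z) = k z)"
    proof (cases "a \<in> A")
      case True then show ?thesis using glue[OF A B AB] s by blast
    next
      case False
      then have "a \<in> B" using s by blast
      then have "\<exists>g. continuous_map (top_of_set (B \<union> A)) X g \<and> g a = s \<and> (\<forall>z\<in>B \<union> A. p (g z) = k z)"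
        using glue[OF B A] AB s by (simp add: Int_commute)
      then show ?thesis by (simp add: Un_commute)
    qed
  qed
qed

lemma lifts_over_local:
  assumes p: "covering_map_of X Y p" and k: "continuous_map (top_of_set R) Y k" and z: "z \<in> R"
  shows "\<exists>e>0. lifts_over X p k (R \<inter> ball z e)"
proof -
  have "k z \<in> topspace Y" using k z by (auto simp: continuous_map_def)
  then obtain T where T: "k z \<in> T" "openin Y T"
    "\<And>s. s \<in> topspace X \<Longrightarrow> p s \<in> T \<Longrightarrow>
       \<exists>V g. s \<in> V \<and> openin X V \<and> homeomorphic_maps (subtopology X V) (subtopology Y T) p g"
    by (rule covering_map_of_sheet[OF p]) blast
  have "openin (top_of_set R) {w \<in> R. k w \<in> T}" using openin_continuous_map_preimage[OF k T(2)] by simp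
  then obtain e where e: "0 < e" "ball z e \<inter> R \<subseteq> {w \<in> R. k w \<in> T}"
    using z T(1) unfolding openin_contains_ball by blast
  have "lifts_over X p k (R \<inter> ball z e)" unfolding lifts_over_def
  proof (intro ballI impI)
    fix s a assume s: "s \<in> topspace X" "a \<in> R \<inter> ball z e" "p s = k a"
    then have "k a \<in> T" using e(2) by blast
    then obtain V g where V: "s \<in> V" "openin X V" and g: "homeomorphic_maps (subtopology X V) (subtopology Y T) p g"
      using T(3)[OF s(1)] s(3) by auto
    have "continuous_map (top_of_set (R \<inter> ball z e)) (subtopology Y T) k"
      using continuous_map_from_subtopology_mono[OF k, of "R \<inter> ball z e"] e(2) by (auto simp: continuous_map_in_subtopology)
    then have "continuous_map (top_of_set (R \<inter> ball z e)) (subtopology X V) (g \<circ> k)"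
      using g continuous_map_compose unfolding homeomorphic_maps_def by blast
    then have "continuous_map (top_of_set (R \<inter> ball z e)) X (g \<circ> k)"
      using continuous_map_into_fulltopology by blast
    moreover have "(g \<circ> k) a = s"
      using g s V unfolding homeomorphic_maps_def by (auto simp flip: s(3))
    moreover have "p ((g \<circ> k) w) = k w" if "w \<in> R \<inter> ball z e" for w
    proof -
      have "k w \<in> T" "k w \<in> topspace Y" using that e(2) k by (auto simp: continuous_map_def)
      then show ?thesis using g unfolding homeomorphic_maps_def by auto
    qed
    ultimately show "\<exists>g. continuous_map (top_of_set (R \<inter> ball z e)) X g \<and> g a = s \<and> (\<forall>z\<in>R \<inter> ball z e. p (g z) = k z)" by blast
  qed
  then show ?thesis using e(1) by blast
qed

text \<open>Bisection in two stages. At a fixed height \<open>y\<close>, horizontal bisection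
  produces a strip of positive thickness across the whole rectangle; vertical bisection then stacks
  such strips. The windows \<open>Q\<close> are closed and convex, so two of them that meet do so in
  a connected set, as gluing requires.\<close>

lemma lifts_over_rectangle:
  assumes p: "covering_map_of X Y p" and X: "Hausdorff_space X"
    and k: "continuous_map (top_of_set (cbox a b)) Y k"
  shows "lifts_over X p k (cbox a b)"
proof (cases "cbox a b = {}")
  case False
  then have ab: "Re a \<le> Re b" "Im a \<le> Im b" by (auto simp: in_cbox_complex_iff)
  let ?R = "cbox a b"
  define Q where "Q = (\<lambda>u v s t. ?R \<inter> cbox (Complex u s) (Complex v t))"
  have Q: "z \<in> Q u v s t \<longleftrightarrow> z \<in> ?R \<and> u \<le> Re z \<and> Re z \<le> v \<and> s \<le> Im z \<and> Im z \<le> t" for z u v s t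
    by (auto simp: Q_def in_cbox_complex_iff)
  have conv: "convex (Q u v s t)" "closed (Q u v s t)" for u v s t
    by (auto simp: Q_def intro: convex_Int closed_Int closed_cbox)
  have un: "lifts_over X p k (Q u v s t \<union> Q u' v' s' t')"
    if "lifts_over X p k (Q u v s t)" "lifts_over X p k (Q u' v' s' t')"
      "Q u v s t \<inter> Q u' v' s' t' \<noteq> {} \<or> Q u v s t = {} \<or> Q u' v' s' t' = {}" for u v s t u' v' s' t'
  proof (cases "Q u v s t \<inter> Q u' v' s' t' = {}")
    case False
    then show ?thesis
      using that conv convex_connected[OF convex_Int[OF conv(1) conv(1)]] by (intro lifts_over_Un[OF p X])
  next
    case True
    then show ?thesis using that by auto
  qed
  have strip: "\<exists>\<delta>>0. lifts_over X p k (Q (Re a) (Re b) (y - \<delta>) (y + \<delta>))" if y: "Im a \<le> y" "y \<le> Im b" for y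
    using ab(1)
  proof (induction rule: Bolzano)
    case (trans u m v)
    then obtain d1 d2 where d: "0 < d1" "lifts_over X p k (Q u m (y - d1) (y + d1))"
        "0 < d2" "lifts_over X p k (Q m v (y - d2) (y + d2))" by blast
    define d where "d = min d1 d2"
    have "Q u m (y - d) (y + d) \<subseteq> Q u m (y - d1) (y + d1)" "Q m v (y - d) (y + d) \<subseteq> Q m v (y - d2) (y + d2)"
      unfolding d_def by (auto simp: Q)
    then have l: "lifts_over X p k (Q u m (y - d) (y + d))" "lifts_over X p k (Q m v (y - d) (y + d))"
      using d lifts_over_subset by blast+
    have "0 < d" using d by (simp add: d_def)
    \<comment> \<open>The bisection principle does not place \<open>m\<close> within the rectangle;
      if it falls outside, one of the two windows is empty and no gluing takes place.\<close>
    have "Q u m (y - d) (y + d) \<inter> Q m v (y - d) (y + d) \<noteq> {} \<or> Q u m (y - d) (y + d) = {} \<or> Q m v (y - d) (y + d) = {}"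
    proof (cases "Re a \<le> m \<and> m \<le> Re b")
      case True
      then have "Complex m y \<in> Q u m (y - d) (y + d) \<inter> Q m v (y - d) (y + d)"
        using trans y \<open>0 < d\<close> by (simp add: Q in_cbox_complex_iff)
      then show ?thesis by blast
    next
      case False
      then consider "m < Re a" | "Re b < m" by linarith
      then have "Q u m (y - d) (y + d) = {} \<or> Q m v (y - d) (y + d) = {}"
        by cases (auto simp: Q in_cbox_complex_iff)
      then show ?thesis by blast
    qed
    then have "lifts_over X p k (Q u m (y - d) (y + d) \<union> Q m v (y - d) (y + d))" by (rule un[OF l])
    moreover have "Q u m (y - d) (y + d) \<union> Q m v (y - d) (y + d) = Q u v (y - d) (y + d)"
      using trans by (auto simp: Q)
    ultimately show ?case using \<open>0 < d\<close> by metis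
  next
    case (local x)
    then have "Complex x y \<in> ?R" using y by (simp add: in_cbox_complex_iff)
    then obtain e where e: "0 < e" "lifts_over X p k (?R \<inter> ball (Complex x y) e)"
      using lifts_over_local[OF p k] by blast
    \<comment> \<open>A horizontal deviation below \<open>e/2\<close> and a vertical one of at most
      \<open>e/4\<close> add up to less than \<open>e\<close>.\<close>
    have "Q u v (y - e/4) (y + e/4) \<subseteq> ?R \<inter> ball (Complex x y) e" if "u \<le> x" "x \<le> v" "v - u < e/2" for u v
    proof
      fix w assume w: "w \<in> Q u v (y - e/4) (y + e/4)"
      have "cmod (w - Complex x y) \<le> \<bar>Re w - x\<bar> + \<bar>Im w - y\<bar>"
        using cmod_le[of "w - Complex x y"] by simp
      also have "\<dots> < e"
      proof -
        have "u \<le> Re w" "Re w \<le> v" "y - e/4 \<le> Im w" "Im w \<le> y + e/4" using w by (simp_all add: Q)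
        then have "\<bar>Re w - x\<bar> < e/2" "\<bar>Im w - y\<bar> \<le> e/4" using that by linarith+
        then show ?thesis using e(1) by linarith
      qed
      finally show "w \<in> ?R \<inter> ball (Complex x y) e"
        using w by (simp add: Q dist_norm norm_minus_commute)
    qed
    then have "lifts_over X p k (Q u v (y - e/4) (y + e/4))" if "u \<le> x" "x \<le> v" "v - u < e/2" for u v
      using that by (intro lifts_over_subset[OF e(2)])
    then show ?case using e(1) by (intro exI[of _ "e/2"] conjI allI impI exI[of _ "e/4"]) auto
  qed
  have "lifts_over X p k (Q (Re a) (Re b) (Im a) (Im b))"
    using ab(2)
  proof (induction rule: Bolzano)
    case (trans s m t)
    have "Q (Re a) (Re b) s m \<inter> Q (Re a) (Re b) m t \<noteq> {} \<or> Q (Re a) (Re b) s m = {} \<or> Q (Re a) (Re b) m t = {}"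
    proof (cases "Im a \<le> m \<and> m \<le> Im b")
      case True
      then have "Complex (Re a) m \<in> Q (Re a) (Re b) s m \<inter> Q (Re a) (Re b) m t"
        using trans ab by (simp add: Q in_cbox_complex_iff)
      then show ?thesis by blast
    next
      case False
      then consider "m < Im a" | "Im b < m" by linarith
      then have "Q (Re a) (Re b) s m = {} \<or> Q (Re a) (Re b) m t = {}"
        by cases (auto simp: Q in_cbox_complex_iff)
      then show ?thesis by blast
    qed
    then have "lifts_over X p k (Q (Re a) (Re b) s m \<union> Q (Re a) (Re b) m t)" by (rule un[OF trans(1,2)])
    moreover have "Q (Re a) (Re b) s m \<union> Q (Re a) (Re b) m t = Q (Re a) (Re b) s t"
      using trans by (auto simp: Q)
    ultimately show ?case by simp
  next
    case (local y)
    then obtain d where d: "0 < d" "lifts_over X p k (Q (Re a) (Re b) (y - d) (y + d))" using strip by blast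
    have "Q (Re a) (Re b) s t \<subseteq> Q (Re a) (Re b) (y - d) (y + d)" if "s \<le> y" "y \<le> t" "t - s < d" for s t
      using that by (auto simp: Q)
    then show ?case using d(1) lifts_over_subset[OF d(2)] by (intro exI[of _ d]) auto
  qed
  moreover have "Q (Re a) (Re b) (Im a) (Im b) = ?R" by (auto simp: Q in_cbox_complex_iff)
  ultimately show ?thesis by simp
qed (simp add: lifts_over_def)

section \<open>Area over a disc in a finite cover\<close>

lemma finite_coverD:
  assumes "finite_cover St S p"
  shows "riemann_surface St" "covering_map_of (surf_top St) (surf_top S) p"
    and "s \<in> topspace (surf_top S) \<Longrightarrow> finite {x \<in> topspace (surf_top St). p x = s}"
    and "x \<in> topspace (surf_top St) \<Longrightarrow> holomorphic_map_at St S p x"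
    and "surf_punctures St = {x \<in> topspace (surf_top St). p x \<in> surf_punctures S}"
    and "Hausdorff_space (surf_top St)" "continuous_map (surf_top St) (surf_top S) p"
  using assms by (auto simp: finite_cover_def riemann_surface_def covering_map_of_def)

lemma conformal_param_subset:
  assumes "conformal_param Y \<Omega> G" "open \<Omega>'" "\<Omega>' \<subseteq> \<Omega>"
  shows "conformal_param Y \<Omega>' G"
proof -
  note G = conformal_paramD[OF assms(1)]
  have "(\<lambda>z. \<psi> (G z)) holomorphic_on {z \<in> \<Omega>'. G z \<in> V}" if "(V, \<psi>) \<in> surf_atlas Y" for V \<psi>
    by (rule holomorphic_on_subset[OF G(5)[OF that]]) (use assms(3) in auto)
  moreover have "G ` \<Omega>' \<subseteq> surf_interior Y" using G(4) assms(3) by blast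
  ultimately show ?thesis
    unfolding conformal_param_def
    using assms(2,3) continuous_map_from_subtopology_mono[OF G(2) assms(3)] inj_on_subset[OF G(3) assms(3)] by auto
qed

text \<open>A lift of an injective map is injective, so it avoids the boundary by invariance of
  domain; it avoids the punctures because these are the points above punctures. For holomorphy,
  \<open>p\<close> read in charts is holomorphic and injective on the open image of the lift, hence
  has a holomorphic inverse there, and the lift is this inverse composed with
  \<open>k\<close>.\<close>

lemma conformal_param_lift:
  assumes S: "riemann_surface S" and cov: "finite_cover St S p" and k: "conformal_param S \<Omega> k"
    and G: "continuous_map (top_of_set \<Omega>) (surf_top St) G" and pG: "\<And>z. z \<in> \<Omega> \<Longrightarrow> p (G z) = k z"
  shows "conformal_param St \<Omega> G"
proof -
  note cD = finite_coverD[OF cov]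
  note St' = riemann_surface_imp_charted[OF cD(1)] and S' = riemann_surface_imp_charted[OF S]
  note kD = conformal_paramD[OF k]
  have Gt: "G z \<in> topspace (surf_top St)" if "z \<in> \<Omega>" for z using G that by (auto simp: continuous_map_def)
  have inj: "inj_on G \<Omega>"
    using kD(3) pG by (metis inj_on_def)
  have nb: "G ` \<Omega> \<inter> surf_boundary St = {}"
    by (rule continuous_inj_image_disjoint_boundary[OF St' kD(1) G inj])
  have int: "G ` \<Omega> \<subseteq> surf_interior St"
  proof
    fix y assume "y \<in> G ` \<Omega>"
    then obtain z where z: "z \<in> \<Omega>" "y = G z" by blast
    have "p y \<in> surf_interior S" using z pG kD(4) by auto
    then have "p y \<notin> surf_punctures S" by (simp add: surf_interior_def)
    then show "y \<in> surf_interior St" using z Gt nb cD(5) by (auto simp: surf_interior_def)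
  qed
  have loc: "(\<lambda>z. \<theta> (G z)) holomorphic_on {z \<in> \<Omega>. G z \<in> W} \<inter> {z \<in> \<Omega>. k z \<in> U}"
    if b: "(W, \<theta>) \<in> surf_atlas St" and a: "(U, \<psi>) \<in> surf_atlas S" for W \<theta> U \<psi>
  proof -
    let ?\<Omega> = "{z \<in> \<Omega>. G z \<in> W} \<inter> {z \<in> \<Omega>. k z \<in> U}"
    note injW = inj_on_chart[OF St' b]
    have invW: "inv_into W \<theta> (\<theta> y) = y" if "y \<in> W" for y using injW that by (rule inv_into_f_f)
    have op: "open ?\<Omega>"
      using open_Collect_preimage[OF kD(1) G openin_chart[OF St' b]] open_param_preimage[OF k openin_chart[OF S' a]] by (rule open_Int)
    let ?D = "G ` ?\<Omega>"
    have "openin (surf_top St) ?D"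
      by (rule openin_continuous_inj_image[OF St' kD(1) G inj op]) auto
    then have opD: "open (\<theta> ` ?D)" by (rule open_chart_image[OF St' b]) (use nb in auto)
    have hol: "(\<lambda>w. (\<psi> \<circ> p) (inv_into W \<theta> w)) holomorphic_on \<theta> ` ?D"
    proof (rule holomorphic_on_inv_chart[OF injW _ opD])
      fix x assume "x \<in> ?D"
      then obtain z where z: "z \<in> \<Omega>" "G z \<in> W" "k z \<in> U" "x = G z" by blast
      then have "p x \<in> U" using pG by simp
      then have "holomorphic_in_chart \<theta> {y \<in> W. p y \<in> U} x (\<lambda>y. \<psi> (p y))"
        using cD(4)[OF Gt[OF z(1)]] a b z unfolding holomorphic_map_at_def by fast
      then show "holomorphic_in_chart \<theta> ?D x (\<psi> \<circ> p)"
        unfolding o_def by (rule holomorphic_in_chart_subset) (use pG in auto)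
    qed auto
    let ?l = "\<lambda>w. (\<psi> \<circ> p) (inv_into W \<theta> w)"
    have l: "?l (\<theta> (G z)) = \<psi> (k z)" if "z \<in> ?\<Omega>" for z using that invW pG by simp
    \<comment> \<open>Injectivity of \<open>p\<close> along the image of the lift is inherited from
      \<open>k\<close>, since \<open>p\<close> undoes the lift to \<open>k\<close>.\<close>
    have injl: "inj_on ?l (\<theta> ` ?D)"
    proof (rule inj_onI)
      fix x y assume "x \<in> \<theta> ` ?D" "y \<in> \<theta> ` ?D" and e: "?l x = ?l y"
      then obtain z w where zw: "z \<in> ?\<Omega>" "x = \<theta> (G z)" "w \<in> ?\<Omega>" "y = \<theta> (G w)" by blast
      then have "\<psi> (k z) = \<psi> (k w)" using e l[OF zw(1)] l[OF zw(3)] by simp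
      then have "k z = k w" using inj_on_chart[OF S' a] zw by (auto dest: inj_onD)
      then have "z = w" using kD(3) zw by (auto dest: inj_onD)
      then show "x = y" using zw by simp
    qed
    obtain g where g: "g holomorphic_on (?l ` \<theta> ` ?D)" "\<And>w. w \<in> \<theta> ` ?D \<Longrightarrow> g (?l w) = w"
      by (rule holomorphic_has_inverse[OF hol opD injl]) blast
    have "?l ` \<theta> ` ?D = (\<lambda>z. \<psi> (k z)) ` ?\<Omega>" unfolding image_image by (rule image_cong[OF refl]) (rule l)
    moreover have "(\<lambda>z. \<psi> (k z)) holomorphic_on ?\<Omega>"
      by (rule holomorphic_on_subset[OF kD(5)[OF a]]) auto
    ultimately have "(\<lambda>z. g (\<psi> (k z))) holomorphic_on ?\<Omega>"
      using holomorphic_on_compose_gen[of "\<lambda>z. \<psi> (k z)" ?\<Omega> g] g(1) by (simp add: o_def)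
    then show ?thesis
    proof (rule holomorphic_transform)
      fix z assume z: "z \<in> ?\<Omega>"
      have "g (?l (\<theta> (G z))) = \<theta> (G z)" by (rule g(2)) (use z in blast)
      then show "g (\<psi> (k z)) = \<theta> (G z)" unfolding l[OF z] .
    qed
  qed
  have "(\<lambda>z. \<theta> (G z)) holomorphic_on {z \<in> \<Omega>. G z \<in> W}" if b: "(W, \<theta>) \<in> surf_atlas St" for W \<theta>
  proof (rule holomorphic_on_locally)
    show op: "open {z \<in> \<Omega>. G z \<in> W}" by (rule open_Collect_preimage[OF kD(1) G openin_chart[OF St' b]])
    fix z assume z: "z \<in> {z \<in> \<Omega>. G z \<in> W}"
    then have "k z \<in> topspace (surf_top S)" using kD(4) by (auto simp: surf_interior_def)
    then obtain U \<psi> where a: "(U, \<psi>) \<in> surf_atlas S" "k z \<in> U" using charted_surface_covered[OF S'] by blast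
    have "open ({z \<in> \<Omega>. G z \<in> W} \<inter> {z \<in> \<Omega>. k z \<in> U})"
      using op open_param_preimage[OF k openin_chart[OF S' a(1)]] by (rule open_Int)
    then obtain e where "0 < e" "ball z e \<subseteq> {z \<in> \<Omega>. G z \<in> W} \<inter> {z \<in> \<Omega>. k z \<in> U}"
      using z a(2) unfolding open_contains_ball by blast
    then show "\<exists>e>0. \<exists>g. g holomorphic_on ball z e \<and> (\<forall>w\<in>{z \<in> \<Omega>. G z \<in> W} \<inter> ball z e. \<theta> (G w) = g w)"
      using loc[OF b a(1)] holomorphic_on_subset by (intro exI[of _ e] conjI exI[of _ "\<lambda>z. \<theta> (G z)"]) auto
  qed
  then show ?thesis unfolding conformal_param_def using kD(1) G inj int by auto
qed

lemma lifts_over_chart_rectangle: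
  assumes S: "riemann_surface S" and cov: "finite_cover St S p" and a: "(U, \<psi>) \<in> surf_atlas S"
    and R: "cbox u v \<subseteq> \<psi> ` (U - surf_boundary S)"
  shows "continuous_map (top_of_set (cbox u v)) (surf_top S) (inv_into U \<psi>)"
    and "lifts_over (surf_top St) p (inv_into U \<psi>) (cbox u v)"
proof -
  note S' = riemann_surface_imp_charted[OF S]
  have "U - surf_boundary S = U \<inter> (topspace (surf_top S) - surf_boundary S)"
    using openin_subset[OF openin_chart[OF S' a]] by auto
  then have "openin (surf_top S) (U - surf_boundary S)"
    using openin_chart[OF S' a] openin_nonboundary[OF S'] by (simp add: openin_Int)
  then have "continuous_map (top_of_set (\<psi> ` (U - surf_boundary S))) (surf_top S) (inv_into U \<psi>)"
    by (rule continuous_map_inv_chart[OF S' a]) auto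
  then show c: "continuous_map (top_of_set (cbox u v)) (surf_top S) (inv_into U \<psi>)"
    by (rule continuous_map_from_subtopology_mono[OF _ R])
  show "lifts_over (surf_top St) p (inv_into U \<psi>) (cbox u v)"
    by (rule lifts_over_rectangle[OF finite_coverD(2,6)[OF cov] c])
qed

text \<open>The definition of a cover places no condition on boundaries. A rectangle about
  \<open>p y\<close> within the interior lifts through \<open>y\<close>, and the lift, being a
  conformal parametrisation on the open rectangle, has its values in the interior.\<close>

lemma cover_interior:
  assumes S: "riemann_surface S" and cov: "finite_cover St S p"
    and y: "y \<in> topspace (surf_top St)" "p y \<in> surf_interior S"
  shows "y \<in> surf_interior St"
proof -
  note S' = riemann_surface_imp_charted[OF S]
  have "p y \<in> topspace (surf_top S)" using y(2) by (simp add: surf_interior_def)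
  then obtain U \<psi> where a: "(U, \<psi>) \<in> surf_atlas S" and pU: "p y \<in> U" using charted_surface_covered[OF S'] by blast
  have "\<psi> (p y) \<in> \<psi> ` (U \<inter> surf_interior S)" using pU y(2) by blast
  then obtain u v where uv: "cbox u v \<subseteq> \<psi> ` (U \<inter> surf_interior S)" "\<psi> (p y) \<in> box u v"
    using open_contains_cbox[OF open_chart_interior_image[OF S' a]] by metis
  have "\<psi> ` (U \<inter> surf_interior S) \<subseteq> \<psi> ` (U - surf_boundary S)" by (auto simp: surf_interior_def)
  then have R: "cbox u v \<subseteq> \<psi> ` (U - surf_boundary S)" using uv(1) by blast
  have "inv_into U \<psi> (\<psi> (p y)) = p y" using inj_on_chart[OF S' a] pU by (rule inv_into_f_f)
  then obtain g where g: "continuous_map (top_of_set (cbox u v)) (surf_top St) g" "g (\<psi> (p y)) = y"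
      "\<forall>z\<in>cbox u v. p (g z) = inv_into U \<psi> z"
    using lifts_over_chart_rectangle(2)[OF S cov a R] y(1) subsetD[OF box_subset_cbox uv(2)] unfolding lifts_over_def by metis
  have "conformal_param S (box u v) (inv_into U \<psi>)"
    by (rule conformal_param_subset[OF conformal_param_inv_chart[OF S a] open_box order_trans[OF box_subset_cbox uv(1)]])
  then have "conformal_param St (box u v) g"
    by (rule conformal_param_lift[OF S cov _ continuous_map_from_subtopology_mono[OF g(1) box_subset_cbox]])
       (use g(3) subsetD[OF box_subset_cbox, of _ u v] in auto)
  then have "g ` box u v \<subseteq> surf_interior St" by (rule conformal_paramD(4))
  then show ?thesis using imageI[OF uv(2), of g] g(2) by auto
qed

abbreviation cover_area :: "'d surf \<Rightarrow> 'd qdiff \<Rightarrow> ('d \<Rightarrow> 'b) \<Rightarrow> 'b set \<Rightarrow> ennreal" where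
  "cover_area St q p N \<equiv> emeasure (area_measure St q) {y \<in> surf_interior St. p y \<in> N}"

text \<open>The part of the cover above the disc is the union of one lift for each point of the
  fibre over the centre, and uniqueness of lifts makes these disjoint. The function
  \<open>h s\<close> is the differential read along the lift through \<open>s\<close>. The disc sits
  in a rectangle because that is where lifts are available.\<close>

lemma cover_disc_area:
  fixes q :: "'d qdiff"
  assumes S: "riemann_surface S" and cov: "finite_cover St S p" and a: "(U, \<psi>) \<in> surf_atlas S"
    and R: "cbox u v \<subseteq> \<psi> ` (U - surf_boundary S)" and D: "ball c \<rho> \<subseteq> cbox u v" "0 < \<rho>"
    and punct: "inv_into U \<psi> ` ball c \<rho> \<inter> surf_punctures S \<subseteq> {inv_into U \<psi> c}"
    and q: "quadratic_differential St q"
  shows "\<exists>(F :: 'd set) h. finite F \<and> (\<forall>s\<in>F. h s holomorphic_on ball c \<rho> - {c}) \<and>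
    (\<forall>E\<in>sets borel. E \<subseteq> ball c \<rho> \<longrightarrow>
       cover_area St q p (inv_into U \<psi> ` E) =
         (\<Sum>s\<in>F. \<integral>\<^sup>+z\<in>E - {c}. ennreal (cmod (h s z)) \<partial>lborel))"
proof -
  note cD = finite_coverD[OF cov]
  note St' = riemann_surface_imp_charted[OF cD(1)] and S' = riemann_surface_imp_charted[OF S]
  note M = is_area_measureD[OF is_area_measure_area_measure[OF cD(1) q]]
  let ?k = "inv_into U \<psi>"
  note kR = lifts_over_chart_rectangle[OF S cov a R]
  have c: "c \<in> ball c \<rho>" "c \<in> cbox u v" using D by auto
  have inv: "?k z \<in> U - surf_boundary S" "\<psi> (?k z) = z" if "z \<in> cbox u v" for z
    using that R inj_on_chart[OF S' a] by auto
  define F where "F = {s \<in> topspace (surf_top St). p s = ?k c}"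
  have "?k c \<in> topspace (surf_top S)" using inv(1)[OF c(2)] openin_subset[OF openin_chart[OF S' a]] by blast
  then have finF: "finite F" unfolding F_def by (rule cD(3))
  have "\<forall>s\<in>F. \<exists>g. continuous_map (top_of_set (cbox u v)) (surf_top St) g \<and> g c = s \<and> (\<forall>z\<in>cbox u v. p (g z) = ?k z)"
    using kR(2) c(2) unfolding lifts_over_def F_def by blast
  then obtain G where G: "\<And>s. s \<in> F \<Longrightarrow> continuous_map (top_of_set (cbox u v)) (surf_top St) (G s)"
      "\<And>s. s \<in> F \<Longrightarrow> G s c = s" "\<And>s z. s \<in> F \<Longrightarrow> z \<in> cbox u v \<Longrightarrow> p (G s z) = ?k z"
    by metis
  define Z where "Z = (if ?k c \<in> surf_punctures S then {c} else {})"
  define \<Omega> where "\<Omega> = ball c \<rho> - Z"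
  have \<Omega>: "open \<Omega>" "\<Omega> \<subseteq> cbox u v" "ball c \<rho> - {c} \<subseteq> \<Omega>" "\<Omega> \<subseteq> ball c \<rho>"
    using D by (auto simp: \<Omega>_def Z_def)
  have \<Omega>int: "\<Omega> \<subseteq> \<psi> ` (U \<inter> surf_interior S)"
  proof
    fix z assume z: "z \<in> \<Omega>"
    have zR: "z \<in> cbox u v" using z \<Omega>(2) by blast
    have "?k z \<notin> surf_punctures S"
    proof
      assume pz: "?k z \<in> surf_punctures S"
      then have "?k z = ?k c" using z \<Omega>(4) punct by blast
      then have "z = c" using inv(2)[OF zR] inv(2)[OF c(2)] by metis
      then show False using pz z by (simp add: \<Omega>_def Z_def)
    qed
    moreover have "?k z \<in> topspace (surf_top S)"
      using inv(1)[OF zR] openin_subset[OF openin_chart[OF S' a]] by blast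
    ultimately have "?k z \<in> U \<inter> surf_interior S" using inv(1)[OF zR] by (simp add: surf_interior_def)
    then show "z \<in> \<psi> ` (U \<inter> surf_interior S)" using inv(2)[OF zR] by (metis imageI)
  qed
  have par: "conformal_param St \<Omega> (G s)" if s: "s \<in> F" for s
    by (rule conformal_param_lift[OF S cov conformal_param_subset[OF conformal_param_inv_chart[OF S a] \<Omega>(1) \<Omega>int]
        continuous_map_from_subtopology_mono[OF G(1)[OF s] \<Omega>(2)]])
       (use G(3)[OF s] \<Omega>(2) in blast)
  have uniq: "g z = h z"
    if "continuous_map (top_of_set (cbox u v)) (surf_top St) g" "continuous_map (top_of_set (cbox u v)) (surf_top St) h"
      "\<And>z. z \<in> cbox u v \<Longrightarrow> p (g z) = ?k z" "\<And>z. z \<in> cbox u v \<Longrightarrow> p (h z) = ?k z" "w \<in> cbox u v" "g w = h w" "z \<in> cbox u v"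
    for g h w z
    by (rule lift_unique[OF cD(2,6) convex_connected[OF convex_box(1)] that(1,2) _ that(5,6,7)]) (simp add: that)
  have "cover_area St q p (?k ` E) =
         (\<Sum>s\<in>F. \<integral>\<^sup>+z\<in>E - {c}. ennreal (cmod (qd_along St q (G s) z)) \<partial>lborel)"
    if E: "E \<in> sets borel" "E \<subseteq> ball c \<rho>" for E
  proof -
    have EZ: "E - Z \<in> sets borel" "E - Z \<subseteq> \<Omega>" using E by (auto simp: Z_def \<Omega>_def)
    have "{y \<in> surf_interior St. p y \<in> ?k ` E} = (\<Union>s\<in>F. G s ` (E - Z))"
    proof (intro equalityI subsetI)
      fix y assume "y \<in> (\<Union>s\<in>F. G s ` (E - Z))"
      then obtain s z where sz: "s \<in> F" "z \<in> E - Z" "y = G s z" by blast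
      then have "z \<in> \<Omega>" using EZ by blast
      then show "y \<in> {y \<in> surf_interior St. p y \<in> ?k ` E}"
        using sz G(3)[OF sz(1), of z] \<Omega>(2) conformal_paramD(4)[OF par[OF sz(1)]] by blast
    next
      fix y assume y: "y \<in> {y \<in> surf_interior St. p y \<in> ?k ` E}"
      then obtain z where z: "z \<in> E" "p y = ?k z" by blast
      have zR: "z \<in> cbox u v" using z(1) E(2) D(1) by blast
      have yt: "y \<in> topspace (surf_top St)" using y by (simp add: surf_interior_def)
      obtain g where g: "continuous_map (top_of_set (cbox u v)) (surf_top St) g" "g z = y" "\<forall>z\<in>cbox u v. p (g z) = ?k z"
        using kR(2) yt zR z(2) unfolding lifts_over_def by blast
      have "g c \<in> topspace (surf_top St)" using g(1) c(2) by (auto simp: continuous_map_def)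
      then have gF: "g c \<in> F" using g(3) c(2) by (simp add: F_def)
      have "g z = G (g c) z"
        by (rule uniq[OF g(1) G(1)[OF gF] _ G(3)[OF gF] c(2) _ zR]) (use g(3) G(2)[OF gF] in auto)
      moreover have "z \<notin> Z"
      proof
        assume "z \<in> Z"
        then have "p y \<in> surf_punctures S" using z(2) by (simp add: Z_def split: if_splits)
        then show False using y yt cD(5) by (auto simp: surf_interior_def)
      qed
      ultimately show "y \<in> (\<Union>s\<in>F. G s ` (E - Z))" using gF z(1) g(2) by blast
    qed
    moreover have "emeasure (area_measure St q) (\<Union>s\<in>F. G s ` (E - Z)) = (\<Sum>s\<in>F. emeasure (area_measure St q) (G s ` (E - Z)))"
    proof (rule sum_emeasure[symmetric, OF _ _ finF])
      show "(\<lambda>s. G s ` (E - Z)) ` F \<subseteq> sets (area_measure St q)"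
        using borel_image_param[OF St' par EZ] by (auto simp: M(2))
      show "disjoint_family_on (\<lambda>s. G s ` (E - Z)) F"
        unfolding disjoint_family_on_def
      proof (intro ballI impI)
        fix s t assume st: "s \<in> F" "t \<in> F" "s \<noteq> t"
        show "G s ` (E - Z) \<inter> G t ` (E - Z) = {}"
        proof (rule ccontr)
          assume "\<not> ?thesis"
          then obtain z w where zw: "z \<in> E - Z" "w \<in> E - Z" "G s z = G t w" by blast
          have R: "z \<in> cbox u v" "w \<in> cbox u v" using zw EZ(2) \<Omega>(2) by blast+
          have "?k z = ?k w" using zw(3) G(3)[OF st(1) R(1)] G(3)[OF st(2) R(2)] by simp
          then have "z = w" using inv(2)[OF R(1)] inv(2)[OF R(2)] by metis
          then have "G s c = G t c"
            using uniq[OF G(1)[OF st(1)] G(1)[OF st(2)] G(3)[OF st(1)] G(3)[OF st(2)] R(1) _ c(2)] zw(3) by blast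
          then show False using G(2) st by simp
        qed
      qed
    qed
    moreover have "emeasure (area_measure St q) (G s ` (E - Z)) =
        mass (qd_along St q (G s)) (E - {c})" if "s \<in> F" for s
    proof -
      have "emeasure (area_measure St q) (G s ` (E - Z)) = mass (qd_along St q (G s)) (E - Z)"
        by (rule emeasure_param[OF cD(1) q par[OF that] EZ])
      also have "\<dots> = mass (qd_along St q (G s)) (E - {c})"
        by (rule nn_integral_cong_AE)
           (use AE_lborel_singleton[of c] in eventually_elim, auto simp: indicator_def Z_def split: if_splits)
      finally show ?thesis .
    qed
    ultimately show ?thesis by simp
  qed
  moreover have "qd_along St q (G s) holomorphic_on ball c \<rho> - {c}" if "s \<in> F" for s
    using qd_along_holomorphic[OF cD(1) q par[OF that]] \<Omega>(3) by (rule holomorphic_on_subset)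
  ultimately show ?thesis using finF by (intro exI[of _ F] exI[of _ "\<lambda>s. qd_along St q (G s)"]) auto
qed

section \<open>Propagating the area bound\<close>

text \<open>The constants stand before the quantifiers over covers and differentials, and this order
  is the uniformity to be proved. The type argument fixes the carrier type of the covers.\<close>

definition area_bound :: "'d itself \<Rightarrow> 'b surf \<Rightarrow> 'b set \<Rightarrow> 'b set \<Rightarrow> real \<Rightarrow> real \<Rightarrow> bool" where
  "area_bound _ S A N \<epsilon> C \<longleftrightarrow>
     (\<forall>(St :: 'd surf) p q.
        finite_cover St S p \<longrightarrow> quadratic_differential St q \<longrightarrow> area St q < \<infinity> \<longrightarrow>
        cover_area St q p N \<le> ennreal \<epsilon> * area St q + ennreal C * cover_area St q p A)"

definition area_controlled :: "'d itself \<Rightarrow> 'b surf \<Rightarrow> 'b set \<Rightarrow> 'b set \<Rightarrow> bool" where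
  "area_controlled T S A N \<longleftrightarrow> (\<forall>\<epsilon>>0. \<exists>C\<ge>0. area_bound T S A N \<epsilon> C)"

section \<open>Controlled sets under subsets and finite unions\<close>

lemma area_boundI:
  assumes "\<And>(St :: 'd surf) p q. finite_cover St S p \<Longrightarrow> quadratic_differential St q \<Longrightarrow> area St q < \<infinity> \<Longrightarrow>
        cover_area St q p N \<le> ennreal \<epsilon> * area St q + ennreal C * cover_area St q p A"
  shows "area_bound TYPE('d) S A N \<epsilon> C"
  unfolding area_bound_def using assms by (intro allI impI)

lemma area_boundD:
  fixes St :: "'d surf"
  assumes "area_bound TYPE('d) S A N \<epsilon> C"
    and "finite_cover St S p" "quadratic_differential St q" "area St q < \<infinity>"
  shows "cover_area St q p N \<le> ennreal \<epsilon> * area St q + ennreal C * cover_area St q p A"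
  using assms unfolding area_bound_def by simp

lemma area_controlledE:
  assumes "area_controlled T S A N" "0 < \<epsilon>"
  obtains C where "0 \<le> C" "area_bound T S A N \<epsilon> C"
  using assms unfolding area_controlled_def by auto

lemma area_controlledI:
  assumes "\<And>\<epsilon>. 0 < \<epsilon> \<Longrightarrow> \<exists>C\<ge>0. area_bound T S A N \<epsilon> C"
  shows "area_controlled T S A N"
  using assms unfolding area_controlled_def by simp

lemma cover_preimage_sets:
  assumes cov: "finite_cover St S p" and q: "quadratic_differential St q" and N: "openin (surf_top S) N"
  shows "{y \<in> surf_interior St. p y \<in> N} \<in> sets (area_measure St q)"
proof -
  note cD = finite_coverD[OF cov]
  note St' = riemann_surface_imp_charted[OF cD(1)]
  have "openin (surf_top St) {y \<in> surf_interior St. p y \<in> N}"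
    by (rule openin_continuous_map_preimage_gen[OF cD(7) openin_surf_interior[OF St'] N])
  then show ?thesis
    using is_area_measureD(2)[OF is_area_measure_area_measure[OF cD(1) q]] by (simp add: surf_setsI)
qed

lemma emeasure_le_area:
  assumes "riemann_surface Y" "quadratic_differential Y q"
  shows "emeasure (area_measure Y q) B \<le> area Y q"
  using emeasure_space[of "area_measure Y q" B] is_area_measureD(1)[OF is_area_measure_area_measure[OF assms]]
  by (simp add: area_def)

text \<open>Openness is asked of the larger set only: its preimage has to be measurable for
  monotonicity, whereas \<open>emeasure\<close> is 0 on a set that is not measurable.\<close>

lemma area_controlled_mono:
  assumes c: "area_controlled TYPE('d) S A N" and N: "openin (surf_top S) N" "N' \<subseteq> N"
  shows "area_controlled TYPE('d) S A N'"
proof (rule area_controlledI)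
  fix \<epsilon> :: real assume "0 < \<epsilon>"
  with c obtain C where C: "0 \<le> C" "area_bound TYPE('d) S A N \<epsilon> C"
    by (rule area_controlledE)
  have "area_bound TYPE('d) S A N' \<epsilon> C"
  proof (rule area_boundI)
    fix St :: "'d surf" and p q
    assume h: "finite_cover St S p" "quadratic_differential St q" "area St q < \<infinity>"
    have "cover_area St q p N' \<le> cover_area St q p N"
      by (rule emeasure_mono[OF _ cover_preimage_sets[OF h(1,2) N(1)]]) (use N(2) in auto)
    then show "cover_area St q p N' \<le> ennreal \<epsilon> * area St q + ennreal C * cover_area St q p A"
      using area_boundD[OF C(2) h] by (rule order_trans)
  qed
  then show "\<exists>C\<ge>0. area_bound TYPE('d) S A N' \<epsilon> C" using C(1) by blast
qed

lemma area_controlled_Un: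
  assumes c: "area_controlled TYPE('d) S A N" "area_controlled TYPE('d) S A N'"
    and N: "openin (surf_top S) N" "openin (surf_top S) N'"
  shows "area_controlled TYPE('d) S A (N \<union> N')"
proof (rule area_controlledI)
  fix \<epsilon> :: real assume "0 < \<epsilon>"
  then have \<epsilon>: "0 < \<epsilon> / 2" by simp
  obtain C where C: "0 \<le> C" "area_bound TYPE('d) S A N (\<epsilon>/2) C"
    by (rule area_controlledE[OF c(1) \<epsilon>])
  obtain C' where C': "0 \<le> C'" "area_bound TYPE('d) S A N' (\<epsilon>/2) C'"
    by (rule area_controlledE[OF c(2) \<epsilon>])
  have "area_bound TYPE('d) S A (N \<union> N') \<epsilon> (C + C')"
  proof (rule area_boundI)
    fix St :: "'d surf" and p q
    assume h: "finite_cover St S p" "quadratic_differential St q" "area St q < \<infinity>"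
    have "{y \<in> surf_interior St. p y \<in> N \<union> N'} = {y \<in> surf_interior St. p y \<in> N} \<union> {y \<in> surf_interior St. p y \<in> N'}" by auto
    then have "cover_area St q p (N \<union> N') \<le> cover_area St q p N + cover_area St q p N'"
      using emeasure_subadditive[OF cover_preimage_sets[OF h(1,2) N(1)] cover_preimage_sets[OF h(1,2) N(2)]] by simp
    also have "\<dots> \<le> (ennreal (\<epsilon>/2) * area St q + ennreal C * cover_area St q p A) + (ennreal (\<epsilon>/2) * area St q + ennreal C' * cover_area St q p A)"
      by (rule add_mono[OF area_boundD[OF C(2) h] area_boundD[OF C'(2) h]])
    also have "\<dots> = (ennreal (\<epsilon>/2) + ennreal (\<epsilon>/2)) * area St q + (ennreal C + ennreal C') * cover_area St q p A"
      by (simp add: distrib_right add_ac)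
    also have "\<dots> = ennreal \<epsilon> * area St q + ennreal (C + C') * cover_area St q p A"
      using \<epsilon> C(1) C'(1) by (simp flip: ennreal_plus)
    finally show "cover_area St q p (N \<union> N') \<le> ennreal \<epsilon> * area St q + ennreal (C + C') * cover_area St q p A" .
  qed
  then show "\<exists>C\<ge>0. area_bound TYPE('d) S A (N \<union> N') \<epsilon> C"
    using C(1) C'(1) by (intro exI[of _ "C + C'"]) simp
qed

lemma area_controlled_Union:
  assumes "finite \<N>" "\<And>N. N \<in> \<N> \<Longrightarrow> openin (surf_top S) N \<and> area_controlled TYPE('d) S A N"
  shows "area_controlled TYPE('d) S A (\<Union>\<N>)"
  using assms
proof induction
  case empty
  show ?case unfolding area_controlled_def area_bound_def by (auto intro!: exI[of _ 0])
next
  case (insert N \<N>)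
  have "openin (surf_top S) (\<Union>\<N>)" using insert.prems by auto
  then show ?case unfolding Union_insert using insert by (intro area_controlled_Un) auto
qed

text \<open>Propagation starts here: the constant 1 works for every \<epsilon>. The preimage of
  \<open>A\<close> is measurable as the complement of that of an open set.\<close>

lemma area_controlled_self:
  assumes A: "closedin (surf_top S) A" and N: "N \<subseteq> A"
  shows "area_controlled TYPE('d) S A N"
proof (intro area_controlledI exI[of _ 1] conjI area_boundI)
  fix \<epsilon> :: real and St :: "'d surf" and p q
  assume h: "finite_cover St S p" "quadratic_differential St q"
  let ?M = "area_measure St q"
  have op: "openin (surf_top S) (topspace (surf_top S) - A)" using A by blast
  have m: "continuous_map (surf_top St) (surf_top S) p" by (rule finite_coverD(7)[OF h(1)])
  have "{y \<in> surf_interior St. p y \<in> A} = space ?M - {y \<in> surf_interior St. p y \<in> topspace (surf_top S) - A}"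
    using is_area_measureD(1)[OF is_area_measure_area_measure[OF finite_coverD(1)[OF h(1)] h(2)]] closedin_subset[OF A] m
    by (auto simp: surf_interior_def continuous_map_def)
  then have "{y \<in> surf_interior St. p y \<in> A} \<in> sets ?M"
    using cover_preimage_sets[OF h op] by auto
  then have "emeasure ?M {y \<in> surf_interior St. p y \<in> N} \<le> emeasure ?M {y \<in> surf_interior St. p y \<in> A}"
    by (rule emeasure_mono[rotated]) (use N in auto)
  then show "emeasure ?M {y \<in> surf_interior St. p y \<in> N} \<le> ennreal \<epsilon> * area St q + ennreal 1 * emeasure ?M {y \<in> surf_interior St. p y \<in> A}"
    by (simp add: add_increasing)
qed simp

text \<open>The three-disc estimate holds on each sheet over a disc with the same constants, and being
  linear it sums over the sheets: this is why the constants do not depend on the cover.\<close>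

lemma area_controlled_disc:
  assumes S: "riemann_surface S" and x: "x \<in> topspace (surf_top S) - surf_boundary S"
  shows "\<exists>D. openin (surf_top S) D \<and> x \<in> D \<and> D \<subseteq> topspace (surf_top S) - surf_boundary S \<and>
    (\<forall>B. openin (surf_top S) B \<longrightarrow> B \<noteq> {} \<longrightarrow> B \<subseteq> D \<longrightarrow> area_controlled TYPE('d) S A B \<longrightarrow> area_controlled TYPE('d) S A D)"
proof -
  note S' = riemann_surface_imp_charted[OF S]
  obtain U \<psi> where a: "(U, \<psi>) \<in> surf_atlas S" and xU: "x \<in> U" using charted_surface_covered[OF S'] x by blast
  let ?k = "inv_into U \<psi>"
  let ?c = "\<psi> x"
  have inv: "?k (\<psi> y) = y" if "y \<in> U" for y using inj_on_chart[OF S' a] that by (rule inv_into_f_f)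
  have fin: "finite (surf_punctures S)" "surf_punctures S \<subseteq> topspace (surf_top S)" "Hausdorff_space (surf_top S)"
    using S by (auto simp: riemann_surface_def)
  \<comment> \<open>All punctures other than \<open>x\<close> are removed from the chart domain, so
    that the disc has no puncture except possibly its centre.\<close>
  have "closedin (surf_top S) (surf_punctures S - {x})"
    using fin by (intro closedin_Hausdorff_finite) auto
  then have "openin (surf_top S) (U \<inter> (topspace (surf_top S) - surf_boundary S) - (surf_punctures S - {x}))"
    by (rule openin_diff[OF openin_Int[OF openin_chart[OF S' a] openin_nonboundary[OF S']]])
  moreover define W where "W = U - surf_boundary S - (surf_punctures S - {x})"
  moreover have "U \<inter> (topspace (surf_top S) - surf_boundary S) - (surf_punctures S - {x}) = W"
    using openin_subset[OF openin_chart[OF S' a]] by (auto simp: W_def)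
  ultimately have W: "openin (surf_top S) W" "W \<subseteq> U" "W \<inter> surf_boundary S = {}" by auto
  have "open (\<psi> ` W)" by (rule open_chart_image[OF S' a W])
  moreover have "?c \<in> \<psi> ` W" using x xU by (auto simp: W_def)
  ultimately obtain u v where uv: "cbox u v \<subseteq> \<psi> ` W" "?c \<in> box u v" using open_contains_cbox by metis
  obtain \<rho> where \<rho>: "0 < \<rho>" "ball ?c \<rho> \<subseteq> box u v" using uv(2) open_box open_contains_ball by blast
  have Du: "ball ?c \<rho> \<subseteq> cbox u v" using \<rho>(2) box_subset_cbox by blast
  have R: "cbox u v \<subseteq> \<psi> ` (U - surf_boundary S)" using uv(1) unfolding W_def by blast
  have kW: "?k z \<in> W" "\<psi> (?k z) = z" if "z \<in> ball ?c \<rho>" for z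
  proof -
    obtain y where "y \<in> W" "z = \<psi> y" using \<open>z \<in> ball ?c \<rho>\<close> Du uv(1) by blast
    then show "?k z \<in> W" "\<psi> (?k z) = z" using inv W(2) by auto
  qed
  have punct: "?k ` ball ?c \<rho> \<inter> surf_punctures S \<subseteq> {?k ?c}"
    using kW(1) inv[OF xU] by (auto simp: W_def)
  \<comment> \<open>The disc estimate bounds mass on a strictly smaller disc; the neighbourhood
    \<open>D\<close> belongs to the smaller radius, while \<rho> is the radius of the disc that is
    lifted.\<close>
  define r where "r = \<rho> / 2"
  have r: "0 < r" "r < \<rho>" using \<rho>(1) by (simp_all add: r_def)
  have rr: "ball ?c r \<subseteq> ball ?c \<rho>" using r by (intro subset_ball) simp
  define D where "D = ?k ` ball ?c r"
  have "D = {y \<in> U. \<psi> y \<in> ball ?c r}"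
  proof (intro equalityI subsetI)
    fix y assume "y \<in> D"
    then obtain z where "z \<in> ball ?c r" "y = ?k z" by (auto simp: D_def)
    moreover have "z \<in> ball ?c \<rho>" using rr \<open>z \<in> ball ?c r\<close> by blast
    ultimately show "y \<in> {y \<in> U. \<psi> y \<in> ball ?c r}" using kW[of z] W(2) by auto
  next
    fix y assume "y \<in> {y \<in> U. \<psi> y \<in> ball ?c r}"
    then show "y \<in> D" using inv[of y] unfolding D_def by (metis (mono_tags, lifting) image_eqI mem_Collect_eq)
  qed
  then have opD: "openin (surf_top S) D" using openin_chart_preimage[OF S' a open_ball] by simp
  have DW: "D \<subseteq> W" using kW(1) rr by (auto simp: D_def)
  have xD: "x \<in> D" unfolding D_def using r(1) inv[OF xU] by (intro image_eqI[of _ _ ?c]) auto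
  have "area_controlled TYPE('d) S A D"
    if B: "openin (surf_top S) B" "B \<noteq> {}" "B \<subseteq> D" and cB: "area_controlled TYPE('d) S A B" for B
  proof (rule area_controlledI)
    fix \<epsilon> :: real assume "0 < \<epsilon>"
    then have \<epsilon>2: "0 < \<epsilon> / 2" by simp
    have BU: "B \<subseteq> U" using B(3) DW W(2) by blast
    have kB: "?k ` \<psi> ` B = B" using inv BU by force
    have opB: "open (\<psi> ` B)" by (rule open_chart_image[OF S' a B(1) BU]) (use B(3) DW W(3) in blast)
    have BD: "\<psi> ` B \<subseteq> ball ?c \<rho>"
    proof
      fix w assume "w \<in> \<psi> ` B"
      then obtain z where "z \<in> ball ?c r" "w = \<psi> (?k z)" using B(3) unfolding D_def by blast
      then show "w \<in> ball ?c \<rho>" using kW(2)[of z] rr by auto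
    qed
    obtain C1 where C1: "0 \<le> C1" "\<And>h. h holomorphic_on ball ?c \<rho> - {?c} \<Longrightarrow>
        mass h (ball ?c \<rho> - {?c}) < \<infinity> \<Longrightarrow>
        mass h (ball ?c r - {?c}) \<le>
          ennreal (\<epsilon>/2) * mass h (ball ?c \<rho> - {?c}) +
          ennreal C1 * mass h (\<psi> ` B - {?c})"
      using disc_area_estimate[OF r(2) opB _ BD \<epsilon>2] B(2) by blast
    \<comment> \<open>The error allowed on \<open>B\<close> reappears multiplied by
      \<open>C1\<close>; this choice keeps the product within \<open>\<epsilon> / 2\<close>, and the
      other half is spent in the disc estimate.\<close>
    define \<epsilon>' where "\<epsilon>' = \<epsilon> / (2 * (C1 + 1))"
    have \<epsilon>': "0 < \<epsilon>'" "C1 * \<epsilon>' \<le> \<epsilon> / 2" using \<open>0 < \<epsilon>\<close> C1(1) by (auto simp: \<epsilon>'_def field_simps)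
    obtain C2 where C2: "0 \<le> C2" "area_bound TYPE('d) S A B \<epsilon>' C2"
      by (rule area_controlledE[OF cB \<epsilon>'(1)])
    have "area_bound TYPE('d) S A D \<epsilon> (C1 * C2)"
    proof (rule area_boundI)
      fix St :: "'d surf" and p q
      assume h: "finite_cover St S p" "quadratic_differential St q" "area St q < \<infinity>"
      define T where "T = area St q"
      obtain F :: "'d set" and h' where F: "finite F" "\<And>s. s \<in> F \<Longrightarrow> h' s holomorphic_on ball ?c \<rho> - {?c}"
        and Fm: "\<And>E. E \<in> sets borel \<Longrightarrow> E \<subseteq> ball ?c \<rho> \<Longrightarrow> cover_area St q p (?k ` E) =
         (\<Sum>s\<in>F. \<integral>\<^sup>+z\<in>E - {?c}. ennreal (cmod (h' s z)) \<partial>lborel)"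
        using cover_disc_area[OF S h(1) a R Du \<rho>(1) punct h(2)] by blast
      let ?I = "\<lambda>E s. \<integral>\<^sup>+z\<in>E - {?c}. ennreal (cmod (h' s z)) \<partial>lborel"
      have le: "(\<Sum>s\<in>F. ?I (ball ?c \<rho>) s) \<le> T"
        using emeasure_le_area[OF finite_coverD(1)[OF h(1)] h(2), of "{y \<in> surf_interior St. p y \<in> ?k ` ball ?c \<rho>}"]
          Fm[of "ball ?c \<rho>"] by (simp add: T_def)
      \<comment> \<open>The disc estimate is for finite masses; each sheet has at most the finite
        total area of the cover.\<close>
      have finI: "?I (ball ?c \<rho>) s < \<infinity>" if "s \<in> F" for s
      proof -
        have "?I (ball ?c \<rho>) s \<le> (\<Sum>s\<in>F. ?I (ball ?c \<rho>) s)"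
          using that F(1) by (intro member_le_sum) auto
        also have "\<dots> < \<infinity>" using le h(3) by (simp add: T_def le_less_trans)
        finally show ?thesis .
      qed
      have "cover_area St q p D = (\<Sum>s\<in>F. ?I (ball ?c r) s)" unfolding D_def using rr by (intro Fm) auto
      also have "\<dots> \<le> (\<Sum>s\<in>F. ennreal (\<epsilon>/2) * ?I (ball ?c \<rho>) s + ennreal C1 * ?I (\<psi> ` B) s)"
        using F(2) finI by (intro sum_mono C1(2))
      also have "\<dots> = ennreal (\<epsilon>/2) * (\<Sum>s\<in>F. ?I (ball ?c \<rho>) s) + ennreal C1 * (\<Sum>s\<in>F. ?I (\<psi> ` B) s)"
        by (simp add: sum.distrib sum_distrib_left)
      also have "(\<Sum>s\<in>F. ?I (\<psi> ` B) s) = cover_area St q p B"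
        using Fm[of "\<psi> ` B"] opB BD kB by simp
      also have "ennreal (\<epsilon>/2) * (\<Sum>s\<in>F. ?I (ball ?c \<rho>) s) + ennreal C1 * cover_area St q p B \<le>
          ennreal (\<epsilon>/2) * T + ennreal C1 * (ennreal \<epsilon>' * T + ennreal C2 * cover_area St q p A)"
        using le area_boundD[OF C2(2) h] by (intro add_mono mult_left_mono) (auto simp: T_def)
      also have "\<dots> = ennreal (\<epsilon>/2) * T + ennreal (C1 * \<epsilon>') * T + ennreal (C1 * C2) * cover_area St q p A"
        using C1(1) C2(1) \<epsilon>'(1) by (simp add: ennreal_mult distrib_left mult.assoc add.assoc)
      also have "\<dots> \<le> ennreal (\<epsilon>/2) * T + ennreal (\<epsilon>/2) * T + ennreal (C1 * C2) * cover_area St q p A"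
        using \<epsilon>'(2) by (intro add_mono mult_right_mono ennreal_leI order_refl) auto
      also have "ennreal (\<epsilon>/2) * T + ennreal (\<epsilon>/2) * T = ennreal \<epsilon> * T"
        using \<epsilon>2 by (simp flip: distrib_right ennreal_plus)
      finally show "cover_area St q p D \<le> ennreal \<epsilon> * area St q + ennreal (C1 * C2) * cover_area St q p A"
        by (simp add: T_def)
    qed
    then show "\<exists>C\<ge>0. area_bound TYPE('d) S A D \<epsilon> C"
      using C1(1) C2(1) by (intro exI[of _ "C1 * C2"]) simp
  qed
  then show ?thesis
    using opD xD DW W openin_subset[OF opD] by (intro exI[of _ D]) blast
qed

section \<open>Propagation along connected sets and finite subcovers\<close>

definition controlled_points :: "'d itself \<Rightarrow> 'b surf \<Rightarrow> 'b set \<Rightarrow> 'b set" where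
  "controlled_points T S A = {x. \<exists>N. openin (surf_top S) N \<and> x \<in> N \<and> area_controlled T S A N}"

text \<open>The intersection of \<open>D\<close> with a controlled neighbourhood of one of its
  points is a non-empty controlled open subset, from which control spreads to \<open>D\<close>. The
  all-or-nothing form expresses relative openness and closedness together.\<close>

lemma controlled_points_closure:
  assumes S: "riemann_surface S" and x: "x \<in> topspace (surf_top S) - surf_boundary S"
  shows "\<exists>D. openin (surf_top S) D \<and> x \<in> D \<and> D \<subseteq> topspace (surf_top S) - surf_boundary S \<and>
    (D \<inter> controlled_points TYPE('d) S A \<noteq> {} \<longrightarrow> D \<subseteq> controlled_points TYPE('d) S A)"
proof -
  obtain D where D: "openin (surf_top S) D" "x \<in> D" "D \<subseteq> topspace (surf_top S) - surf_boundary S"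
    "\<And>B. openin (surf_top S) B \<Longrightarrow> B \<noteq> {} \<Longrightarrow> B \<subseteq> D \<Longrightarrow> area_controlled TYPE('d) S A B \<Longrightarrow> area_controlled TYPE('d) S A D"
    using area_controlled_disc[OF S x] by metis
  have "D \<subseteq> controlled_points TYPE('d) S A" if ne: "D \<inter> controlled_points TYPE('d) S A \<noteq> {}"
  proof -
    obtain y N where N: "y \<in> D" "y \<in> N" "openin (surf_top S) N" "area_controlled TYPE('d) S A N"
      using ne unfolding controlled_points_def by blast
    have "area_controlled TYPE('d) S A (D \<inter> N)"
      by (rule area_controlled_mono[OF N(4,3)]) auto
    then have "area_controlled TYPE('d) S A D"
      using N D(1) by (intro D(4)[of "D \<inter> N"]) (auto simp: openin_Int)
    then show ?thesis using D(1) unfolding controlled_points_def by blast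
  qed
  then show ?thesis using D by blast
qed

lemma connected_subset_controlled_points:
  assumes S: "riemann_surface S" and K: "connectedin (surf_top S) K" "K \<subseteq> topspace (surf_top S) - surf_boundary S"
    and ne: "K \<inter> controlled_points TYPE('d) S A \<noteq> {}"
  shows "K \<subseteq> controlled_points TYPE('d) S A"
proof (rule ccontr)
  let ?G = "controlled_points TYPE('d) S A"
  assume "\<not> K \<subseteq> ?G"
  define E1 where "E1 = \<Union>{D. openin (surf_top S) D \<and> D \<subseteq> ?G}"
  define E2 where "E2 = \<Union>{D. openin (surf_top S) D \<and> D \<inter> ?G = {}}"
  have "openin (surf_top S) E1" "openin (surf_top S) E2" by (auto simp: E1_def E2_def)
  moreover have "K \<subseteq> E1 \<union> E2"
  proof
    fix x assume "x \<in> K"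
    then obtain D where "openin (surf_top S) D" "x \<in> D" "D \<inter> ?G \<noteq> {} \<longrightarrow> D \<subseteq> ?G"
      using controlled_points_closure[OF S, of x, where A=A] K(2) by blast
    then show "x \<in> E1 \<union> E2" by (auto simp: E1_def E2_def)
  qed
  moreover have "E1 \<subseteq> ?G" "E2 \<inter> ?G = {}" by (auto simp: E1_def E2_def)
  ultimately show False
    using K(1) ne \<open>\<not> K \<subseteq> ?G\<close> unfolding connectedin by blast
qed

lemma compact_area_controlled:
  assumes K: "compactin (surf_top S) K" "K \<subseteq> controlled_points TYPE('d) S A"
  obtains N where "openin (surf_top S) N" "K \<subseteq> N" "area_controlled TYPE('d) S A N"
proof -
  let ?\<N> = "{N. openin (surf_top S) N \<and> area_controlled TYPE('d) S A N}"
  have "K \<subseteq> \<Union>?\<N>" using K(2) unfolding controlled_points_def by blast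
  then obtain \<F> where F: "finite \<F>" "\<F> \<subseteq> ?\<N>" "K \<subseteq> \<Union>\<F>"
    using K(1) unfolding compactin_def by (metis (no_types, lifting) mem_Collect_eq)
  show ?thesis
  proof (rule that[of "\<Union>\<F>"])
    show "area_controlled TYPE('d) S A (\<Union>\<F>)"
      by (rule area_controlled_Union[OF F(1)]) (use F(2) in auto)
  qed (use F in auto)
qed

section \<open>The image of an annular embedding\<close>

lemma conformal_embeddingD:
  assumes "conformal_embedding R S f"
  shows "continuous_map (surf_top R) (surf_top S) f" "f ` surf_interior R \<subseteq> surf_interior S"
    and "inj_on f (surf_interior R)" "\<And>x. x \<in> surf_interior R \<Longrightarrow> holomorphic_map_at R S f x"
  using assms by (auto simp: conformal_embedding_def)

text \<open>Holomorphy is not required at the punctures, but injectivity near a puncture is enough for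
  invariance of domain.\<close>

lemma embedding_puncture_not_boundary:
  assumes R: "riemann_surface R" and S: "riemann_surface S" and f: "conformal_embedding R S f"
    and x: "x \<in> surf_punctures R"
  shows "f x \<notin> surf_boundary S"
proof
  assume fx: "f x \<in> surf_boundary S"
  note R' = riemann_surface_imp_charted[OF R] and S' = riemann_surface_imp_charted[OF S]
  note fD = conformal_embeddingD[OF f]
  have fin: "finite (surf_punctures R)" "surf_punctures R \<subseteq> topspace (surf_top R) - surf_boundary R"
      "Hausdorff_space (surf_top R)"
    using R by (auto simp: riemann_surface_def)
  then have xt: "x \<in> topspace (surf_top R)" "x \<notin> surf_boundary R" using x by auto
  obtain U \<phi> where a: "(U, \<phi>) \<in> surf_atlas R" and xU: "x \<in> U" using charted_surface_covered[OF R' xt(1)] by blast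
  have "closedin (surf_top R) (surf_punctures R - {x})"
    using fin by (intro closedin_Hausdorff_finite) auto
  then have "openin (surf_top R) (U \<inter> (topspace (surf_top R) - surf_boundary R) - (surf_punctures R - {x}))"
    by (rule openin_diff[OF openin_Int[OF openin_chart[OF R' a] openin_nonboundary[OF R']]])
  moreover define W where "W = U - surf_boundary R - (surf_punctures R - {x})"
  moreover have "U \<inter> (topspace (surf_top R) - surf_boundary R) - (surf_punctures R - {x}) = W"
    using openin_subset[OF openin_chart[OF R' a]] by (auto simp: W_def)
  ultimately have W: "openin (surf_top R) W" "W \<subseteq> U" "W \<inter> surf_boundary R = {}" by auto
  have inv: "inv_into U \<phi> (\<phi> y) = y" if "y \<in> U" for y using inj_on_chart[OF R' a] that by (rule inv_into_f_f)
  have Wi: "y \<in> surf_interior R" if "y \<in> W" "y \<noteq> x" for y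
    using that openin_subset[OF W(1)] by (auto simp: W_def surf_interior_def)
  have injW: "inj_on f W"
  proof (rule inj_onI)
    fix y z assume yz: "y \<in> W" "z \<in> W" "f y = f z"
    \<comment> \<open>Nearby points go to the interior of \<open>S\<close>, while \<open>f x\<close>
      is assumed to lie on the boundary; hence injectivity extends to \<open>x\<close>.\<close>
    have nx: "f w \<noteq> f x" if "w \<in> W" "w \<noteq> x" for w
      using Wi[OF that] fD(2) fx by (auto simp: surf_interior_def)
    show "y = z"
    proof (cases "y = x \<or> z = x")
      case True then show ?thesis using nx yz by metis
    next
      case False then show ?thesis using Wi yz fD(3) by (auto dest: inj_onD)
    qed
  qed
  have "(f \<circ> inv_into U \<phi>) ` \<phi> ` W \<inter> surf_boundary S = {}"
  proof (rule continuous_inj_image_disjoint_boundary[OF S' open_chart_image[OF R' a W]])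
    show "continuous_map (top_of_set (\<phi> ` W)) (surf_top S) (f \<circ> inv_into U \<phi>)"
      by (rule continuous_map_compose[OF continuous_map_inv_chart[OF R' a W] fD(1)])
    show "inj_on (f \<circ> inv_into U \<phi>) (\<phi> ` W)"
    proof (rule inj_onI)
      fix v w assume "v \<in> \<phi> ` W" "w \<in> \<phi> ` W" and e: "(f \<circ> inv_into U \<phi>) v = (f \<circ> inv_into U \<phi>) w"
      then obtain y z where yz: "y \<in> W" "v = \<phi> y" "z \<in> W" "w = \<phi> z" by blast
      moreover from yz have "y \<in> U" "z \<in> U" using W(2) by blast+
      ultimately have "f y = f z" using e inv[of y] inv[of z] by simp
      then show "v = w" using injW yz by (auto dest: inj_onD)
    qed
  qed
  moreover have "x \<in> W" using xU xt by (simp add: W_def)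
  then have "(f \<circ> inv_into U \<phi>) (\<phi> x) \<in> (f \<circ> inv_into U \<phi>) ` \<phi> ` W" by (intro imageI)
  ultimately show False using fx inv[OF xU] by auto
qed

lemma annular_image_controlled:
  fixes R :: "'a surf" and S :: "'b surf"
  assumes R: "riemann_surface R" and S: "riemann_surface S" and ann: "annular_embedding TYPE('c) R S f"
    and comp: "\<forall>C \<in> connected_components_of (surf_top R). C \<inter> surf_boundary R \<noteq> {}"
  shows "f ` topspace (surf_top R) \<subseteq> controlled_points TYPE('d) S (topspace (surf_top S) - f ` surf_interior R)"
proof -
  let ?TR = "topspace (surf_top R)" and ?TS = "topspace (surf_top S)"
  let ?A = "?TS - f ` surf_interior R"
  let ?P = "controlled_points TYPE('d) S ?A"
  note R' = riemann_surface_imp_charted[OF R] and S' = riemann_surface_imp_charted[OF S]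
  obtain Rh :: "'c surf" and i fh where ext: "annular_extension R Rh i" and fh: "conformal_embedding Rh S fh"
      and f: "conformal_embedding R S f" and fhi: "\<And>x. x \<in> ?TR \<Longrightarrow> fh (i x) = f x"
    using ann unfolding annular_embedding_def by blast
  note fD = conformal_embeddingD[OF f] and hD = conformal_embeddingD[OF fh]
  have iR: "riemann_surface Rh" "conformal_embedding R Rh i" "inj_on i ?TR" "surf_punctures Rh = i ` surf_punctures R"
    using ext by (simp_all add: annular_extension_def)
  note iD = conformal_embeddingD[OF iR(2)]
  let ?BC = "boundary_components R"
  obtain r :: "'a set \<Rightarrow> real" and a :: "'a set \<Rightarrow> complex \<Rightarrow> 'c" where
    all: "\<forall>C \<in> ?BC. 1 < r C \<and>
           continuous_map (top_of_set (conf_annulus (r C))) (surf_top Rh) (a C) \<and>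
           inj_on (a C) (conf_annulus (r C)) \<and>
           (\<forall>z. 1 < cmod z \<and> cmod z < r C \<longrightarrow>
              (\<forall>(V, \<psi>) \<in> surf_atlas Rh. a C z \<in> V \<longrightarrow> (\<lambda>w. \<psi> (a C w)) analytic_on {z})) \<and>
           a C ` sphere 0 1 = i ` C \<and>
           a C ` conf_annulus (r C) \<inter> i ` ?TR = i ` C"
    and disj: "disjoint_family_on (\<lambda>C. a C ` conf_annulus (r C)) ?BC"
    and bd: "surf_boundary Rh = (\<Union>C \<in> ?BC. a C ` sphere 0 (r C))"
    using ext unfolding annular_extension_def by (elim conjE exE) (rule that; assumption)
  have ra: "\<And>C. C \<in> ?BC \<Longrightarrow> 1 < r C"
      "\<And>C. C \<in> ?BC \<Longrightarrow> continuous_map (top_of_set (conf_annulus (r C))) (surf_top Rh) (a C)"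
      "\<And>C. C \<in> ?BC \<Longrightarrow> inj_on (a C) (conf_annulus (r C))"
      "\<And>C. C \<in> ?BC \<Longrightarrow> a C ` sphere 0 1 = i ` C"
      "\<And>C. C \<in> ?BC \<Longrightarrow> a C ` conf_annulus (r C) \<inter> i ` ?TR = i ` C"
    using all by simp_all
  have punct: "finite (surf_punctures R)" "surf_punctures R \<subseteq> ?TR - surf_boundary R"
    using R by (auto simp: riemann_surface_def)
  have bR: "surf_boundary R \<subseteq> ?TR"
  proof
    fix x assume "x \<in> surf_boundary R"
    then obtain U \<phi> where "(U, \<phi>) \<in> surf_atlas R" "x \<in> U" unfolding surf_boundary_def by fast
    then show "x \<in> ?TR" using openin_subset[OF openin_chart[OF R']] by blast
  qed
  \<comment> \<open>The inner circle, where \<open>cmod z = 1\<close>, is included. The boundary of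
    \<open>Rh\<close> consists of the outer circles; disjointness of the annuli and injectivity of
    each parametrisation keep the present point off them.\<close>
  have nb: "a C z \<in> surf_interior Rh" if C: "C \<in> ?BC" and z: "1 \<le> cmod z" "cmod z < r C" and np: "a C z \<notin> i ` surf_punctures R" for C z
  proof -
    have zA: "z \<in> conf_annulus (r C)" using z by (simp add: conf_annulus_def)
    have "a C z \<notin> surf_boundary Rh"
    proof
      assume "a C z \<in> surf_boundary Rh"
      then obtain C' w where w: "C' \<in> ?BC" "cmod w = r C'" "a C z = a C' w" unfolding bd by auto
      have wA: "w \<in> conf_annulus (r C')" using w ra(1)[OF w(1)] by (simp add: conf_annulus_def)
      have "C = C'"
      proof (rule ccontr)
        assume "C \<noteq> C'"
        then have "a C ` conf_annulus (r C) \<inter> a C' ` conf_annulus (r C') = {}"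
          using disj C w(1) unfolding disjoint_family_on_def by blast
        then show False using zA wA w(3) by blast
      qed
      then have "z = w" using ra(3)[OF C] w zA wA by (auto dest: inj_onD)
      then show False using z w \<open>C = C'\<close> by simp
    qed
    moreover have "a C z \<in> topspace (surf_top Rh)"
      using ra(2)[OF C] zA by (auto simp: continuous_map_def)
    ultimately show ?thesis using np iR(4) by (simp add: surf_interior_def)
  qed
  have bcomp: "\<exists>C\<in>?BC. x \<in> C \<and> C \<subseteq> surf_boundary R" if x: "x \<in> surf_boundary R" for x
  proof -
    let ?X = "subtopology (surf_top R) (surf_boundary R)"
    have "x \<in> \<Union>(connected_components_of ?X)"
      unfolding Union_connected_components_of using x bR by auto
    then obtain C where C: "C \<in> ?BC" "x \<in> C" unfolding boundary_components_def by blast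
    then have "C \<subseteq> topspace ?X"
      unfolding boundary_components_def by (intro connected_components_of_subset)
    then show ?thesis using C by auto
  qed
  have sph: "\<exists>z. cmod z = 1 \<and> a C z = i x" if "C \<in> ?BC" "x \<in> C" for C x
  proof -
    have "i x \<in> a C ` sphere 0 1" using ra(4)[OF that(1)] that(2) by blast
    then show ?thesis by auto
  qed
  have ibd: "i x \<in> surf_interior Rh" if x: "x \<in> surf_boundary R" for x
  proof -
    obtain C where C: "C \<in> ?BC" "x \<in> C" using bcomp[OF x] by blast
    obtain z where z: "cmod z = 1" "a C z = i x" using sph[OF C] by blast
    have "i x \<notin> i ` surf_punctures R"
      using x bR punct(2) iR(3) by (auto simp: inj_on_def)
    then show ?thesis using nb[OF C(1), of z] z ra(1)[OF C(1)] by simp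
  qed
  have cases: "x \<in> surf_interior R \<or> x \<in> surf_boundary R \<or> x \<in> surf_punctures R" if "x \<in> ?TR" for x
    using that by (auto simp: surf_interior_def)
  have f_nb: "f x \<in> ?TS - surf_boundary S" if x: "x \<in> ?TR" for x
  proof -
    have "f x \<in> ?TS" using fD(1) x by (auto simp: continuous_map_def)
    moreover have "f x \<notin> surf_boundary S"
      using cases[OF x]
    proof (elim disjE)
      assume "x \<in> surf_interior R"
      then show ?thesis using fD(2) by (auto simp: surf_interior_def)
    next
      assume "x \<in> surf_boundary R"
      then have "fh (i x) \<in> surf_interior S" using ibd hD(2) by blast
      then show ?thesis using fhi[OF x] by (simp add: surf_interior_def)
    next
      assume "x \<in> surf_punctures R"
      then show ?thesis by (rule embedding_puncture_not_boundary[OF R S f])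
    qed
    ultimately show ?thesis by simp
  qed
  have opf: "openin (surf_top S) (f ` surf_interior R)"
    by (rule openin_conformal_image[OF R' S fD openin_surf_interior[OF R'] order_refl])
  have closA: "closedin (surf_top S) ?A" using opf by blast
  have "compactin (surf_top S) (f ` ?TR)"
    using charted_surface_compact[OF R'] fD(1) image_compactin unfolding compact_space_def by blast
  then have clf: "closedin (surf_top S) (f ` ?TR)"
    by (rule compactin_imp_closedin[rotated]) (use S in \<open>simp add: riemann_surface_def\<close>)
  have bdP: "f x \<in> ?P" if x: "x \<in> surf_boundary R" for x
  proof -
    obtain D where D: "openin (surf_top S) D" "f x \<in> D" "D \<inter> ?P \<noteq> {} \<longrightarrow> D \<subseteq> ?P"
      using controlled_points_closure[OF S f_nb[OF subsetD[OF bR x]], where A = ?A] by blast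
    obtain C where C: "C \<in> ?BC" "x \<in> C" "C \<subseteq> surf_boundary R" using bcomp[OF x] by blast
    obtain z where z: "cmod z = 1" "a C z = i x" using sph[OF C(1,2)] by blast
    let ?An = "conf_annulus (r C)"
    have "continuous_map (top_of_set ?An) (surf_top S) (fh \<circ> a C)"
      by (rule continuous_map_compose[OF ra(2)[OF C(1)] hD(1)])
    then have "openin (top_of_set ?An) {w \<in> topspace (top_of_set ?An). (fh \<circ> a C) w \<in> D}"
      using D(1) by (rule openin_continuous_map_preimage)
    then have "openin (top_of_set ?An) {w \<in> ?An. (fh \<circ> a C) w \<in> D}" by simp
    moreover have "(fh \<circ> a C) z = f x" using z fhi[OF subsetD[OF bR x]] by simp
    then have "z \<in> {w \<in> ?An. (fh \<circ> a C) w \<in> D}"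
      using z(1) ra(1)[OF C(1)] D(2) by (simp add: conf_annulus_def)
    ultimately obtain e where e: "0 < e" "ball z e \<inter> ?An \<subseteq> {w \<in> ?An. (fh \<circ> a C) w \<in> D}"
      unfolding openin_contains_ball by blast
    \<comment> \<open>Factors on the radius through \<open>z\<close>: the bound \<open>1 + e\<close>
      keeps the image inside \<open>D\<close>, the bound \<open>r C\<close> keeps the point off the
      outer circle.\<close>
    define I where "I = {1<..<min (1 + e) (r C)}"
    have I: "infinite I" using e(1) ra(1)[OF C(1)] by (simp add: I_def infinite_Ioo)
    let ?w = "\<lambda>t. of_real t * z"
    have w: "1 < cmod (?w t)" "cmod (?w t) < r C" "?w t \<in> ?An" "fh (a C (?w t)) \<in> D" if t: "t \<in> I" for t
    proof -
      show m: "1 < cmod (?w t)" "cmod (?w t) < r C" using t z(1) by (simp_all add: I_def norm_mult)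
      show An: "?w t \<in> ?An" using m by (simp add: conf_annulus_def)
      have "z - ?w t = of_real (1 - t) * z" by (simp add: algebra_simps)
      then have "dist z (?w t) = \<bar>1 - t\<bar>" using z(1) by (simp add: dist_norm norm_mult del: of_real_diff)
      then have "?w t \<in> ball z e" using t by (simp add: I_def)
      then show "fh (a C (?w t)) \<in> D" using e(2) An by auto
    qed
    have ni: "a C (?w t) \<notin> i ` ?TR" if t: "t \<in> I" for t
    proof
      assume "a C (?w t) \<in> i ` ?TR"
      then have "a C (?w t) \<in> a C ` sphere 0 1" using ra(4,5)[OF C(1)] w(3)[OF t] by blast
      then obtain v where v: "cmod v = 1" "a C (?w t) = a C v" by auto
      have "v \<in> ?An" using v ra(1)[OF C(1)] by (simp add: conf_annulus_def)
      then have "?w t = v" using inj_onD[OF ra(3)[OF C(1)] v(2) w(3)[OF t]] by simp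
      then show False using v w(1)[OF t] by simp
    qed
    have int: "a C (?w t) \<in> surf_interior Rh" if t: "t \<in> I" for t
      using nb[OF C(1), of "?w t"] w[OF t] ni[OF t] punct(2) by auto
    have "inj_on (\<lambda>t. fh (a C (?w t))) I"
    proof (rule inj_onI)
      fix s t assume st: "s \<in> I" "t \<in> I" "fh (a C (?w s)) = fh (a C (?w t))"
      then have "a C (?w s) = a C (?w t)" using inj_onD[OF hD(3) _ int int] by blast
      then have "?w s = ?w t" using inj_onD[OF ra(3)[OF C(1)] _ w(3) w(3)] st by blast
      then show "s = t" using z(1) by auto
    qed
    then have "infinite ((\<lambda>t. fh (a C (?w t))) ` I)" using I by (simp add: finite_image_iff)
    \<comment> \<open>Injectivity of \<open>fh\<close> is given on the interior, so it does not by
      itself separate annulus points from punctures. Counting does: infinitely many distinct images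
      against finitely many punctures.\<close>
    then have "\<not> (\<lambda>t. fh (a C (?w t))) ` I \<subseteq> f ` surf_punctures R"
      using punct(1) finite_subset by blast
    then obtain t where t: "t \<in> I" "fh (a C (?w t)) \<notin> f ` surf_punctures R" by blast
    have "fh (a C (?w t)) \<notin> f ` ?TR"
    proof
      assume "fh (a C (?w t)) \<in> f ` ?TR"
      then obtain y where y: "y \<in> ?TR" "fh (a C (?w t)) = f y" by blast
      then have "y \<in> surf_interior R \<or> y \<in> surf_boundary R" using cases t(2) by blast
      then have "i y \<in> surf_interior Rh" using iD(2) ibd by blast
      then have "a C (?w t) = i y" using inj_onD[OF hD(3) _ int[OF t(1)]] y fhi by auto
      then show False using ni[OF t(1)] y(1) by blast
    qed
    moreover have "fh (a C (?w t)) \<in> ?TS" using w(4)[OF t(1)] openin_subset[OF D(1)] by blast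
    moreover have "?TS - f ` ?TR \<subseteq> ?P"
    proof -
      have "f ` surf_interior R \<subseteq> f ` ?TR" by (auto simp: surf_interior_def)
      then have "area_controlled TYPE('d) S ?A (?TS - f ` ?TR)"
        by (intro area_controlled_self[OF closA]) auto
      moreover have "openin (surf_top S) (?TS - f ` ?TR)" using clf by blast
      ultimately show ?thesis unfolding controlled_points_def by blast
    qed
    ultimately have "D \<inter> ?P \<noteq> {}" using w(4)[OF t(1)] by blast
    then show ?thesis using D by blast
  qed
  show ?thesis
  proof
    fix y assume "y \<in> f ` ?TR"
    then obtain x where x: "x \<in> ?TR" "y = f x" by blast
    then have "x \<in> \<Union>(connected_components_of (surf_top R))" by (simp add: Union_connected_components_of)
    then obtain C where C: "C \<in> connected_components_of (surf_top R)" "x \<in> C" by blast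
    have con: "connectedin (surf_top R) C" using C(1) by (rule connectedin_connected_components_of)
    then have CT: "C \<subseteq> ?TR" by (rule connectedin_subset_topspace)
    obtain b where b: "b \<in> C" "b \<in> surf_boundary R" using comp C(1) by blast
    have "f ` C \<subseteq> ?P"
    proof (rule connected_subset_controlled_points[OF S])
      show "connectedin (surf_top S) (f ` C)" by (rule connectedin_continuous_map_image[OF fD(1) con])
      show "f ` C \<subseteq> ?TS - surf_boundary S" using f_nb CT by blast
      show "f ` C \<inter> ?P \<noteq> {}" using bdP[OF b(2)] b(1) by blast
    qed
    then show "y \<in> ?P" using x C(2) by blast
  qed
qed

lemma uniform_area_bound:
  fixes R :: "'a surf" and S :: "'b surf"
  assumes R: "riemann_surface R" and S: "riemann_surface S" and ann: "annular_embedding TYPE('c) R S f"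
    and comp: "\<forall>C \<in> connected_components_of (surf_top R). C \<inter> surf_boundary R \<noteq> {}"
  shows "\<exists>K :: real. 0 \<le> K \<and> K < 1 \<and> (\<forall>(St :: 'd surf) p q. finite_cover St S p \<longrightarrow> q \<in> QD St \<longrightarrow>
    cover_area St q p (f ` surf_interior R) \<le> ennreal K * area St q)"
proof -
  let ?A = "topspace (surf_top S) - f ` surf_interior R"
  note R' = riemann_surface_imp_charted[OF R]
  have f: "conformal_embedding R S f" using ann unfolding annular_embedding_def by blast
  note fD = conformal_embeddingD[OF f]
  have opf: "openin (surf_top S) (f ` surf_interior R)"
    by (rule openin_conformal_image[OF R' S fD openin_surf_interior[OF R'] order_refl])
  have "compactin (surf_top S) (f ` topspace (surf_top R))"
    using charted_surface_compact[OF R'] fD(1) image_compactin unfolding compact_space_def by blast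
  then obtain N where N: "openin (surf_top S) N" "f ` topspace (surf_top R) \<subseteq> N" "area_controlled TYPE('d) S ?A N"
    using annular_image_controlled[OF R S ann comp] by (rule compact_area_controlled)
  have "f ` surf_interior R \<subseteq> N" using N(2) by (auto simp: surf_interior_def)
  then have "area_controlled TYPE('d) S ?A (f ` surf_interior R)"
    by (rule area_controlled_mono[OF N(3,1)])
  then obtain C where C: "0 \<le> C" "area_bound TYPE('d) S ?A (f ` surf_interior R) (1/2) C"
    by (rule area_controlledE[of _ _ _ _ "1/2"]) auto
  define K where "K = (1/2 + C) / (1 + C)"
  have K: "0 \<le> K" "K < 1" using C(1) by (simp_all add: K_def)
  have "cover_area St q p (f ` surf_interior R) \<le> ennreal K * area St q"
    if cov: "finite_cover St S p" and q: "q \<in> QD St" for St :: "'d surf" and p q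
  proof -
    let ?M = "area_measure St q"
    let ?B = "{y \<in> surf_interior St. p y \<in> f ` surf_interior R}"
    have q': "quadratic_differential St q" "area St q < \<infinity>" using q by (auto simp: QD_def)
    note M = is_area_measureD[OF is_area_measure_area_measure[OF finite_coverD(1)[OF cov] q'(1)]]
    have B: "?B \<in> sets ?M" by (rule cover_preimage_sets[OF cov q'(1) opf])
    have sp: "area St q = emeasure ?M (space ?M)" by (simp add: area_def M(1))
    define m T where "m = measure ?M ?B" and "T = measure ?M (space ?M)"
    have fin: "emeasure ?M X \<noteq> \<infinity>" for X
      using neq_top_trans[OF _ emeasure_le_area[OF finite_coverD(1)[OF cov] q'(1), of X]] q'(2) by simp
    have em: "emeasure ?M ?B = ennreal m" "area St q = ennreal T"
      unfolding m_def T_def sp using fin by (simp_all add: emeasure_eq_ennreal_measure)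
    \<comment> \<open>Because \<open>?A\<close> is the complement of the image of the interior, the
      two preimages partition the interior of the cover, and no statement about the area of the
      image of the boundary is called for.\<close>
    have "{y \<in> surf_interior St. p y \<in> ?A} = space ?M - ?B"
      using finite_coverD(7)[OF cov] unfolding M(1) by (auto simp: surf_interior_def continuous_map_def)
    then have "emeasure ?M {y \<in> surf_interior St. p y \<in> ?A} = ennreal T - ennreal m"
      using emeasure_compl[OF B] fin em sp by simp
    also have "\<dots> = ennreal (T - m)" by (rule ennreal_minus) (simp add: m_def)
    finally have "ennreal m \<le> ennreal (1/2) * ennreal T + ennreal C * ennreal (T - m)"
      using area_boundD[OF C(2) cov q'] em by simp
    moreover have mT: "0 \<le> m" "m \<le> T"
    proof -
      show "0 \<le> m" by (simp add: m_def)
      have "emeasure ?M ?B \<le> area St q" by (rule emeasure_le_area[OF finite_coverD(1)[OF cov] q'(1)])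
      then show "m \<le> T" unfolding em by (simp add: T_def)
    qed
    moreover have "ennreal (1/2 * T + C * (T - m)) = ennreal (1/2 * T) + ennreal (C * (T - m))"
      by (rule ennreal_plus) (use mT C(1) in auto)
    moreover have "ennreal (1/2 * T) = ennreal (1/2) * ennreal T" by (rule ennreal_mult) (use mT in auto)
    moreover have "ennreal (C * (T - m)) = ennreal C * ennreal (T - m)" by (rule ennreal_mult) (use mT C(1) in auto)
    ultimately have "ennreal m \<le> ennreal (1/2 * T + C * (T - m))" by (simp only:)
    then have "m \<le> 1/2 * T + C * (T - m)" using mT C(1) by (subst (asm) ennreal_le_iff) auto
    then have "m \<le> K * T" using C(1) by (simp add: K_def field_simps)
    then have "ennreal m \<le> ennreal (K * T)" by (rule ennreal_leI)
    then show ?thesis unfolding em using K mT by (simp add: ennreal_mult)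
  qed
  then show ?thesis using K by blast
qed

section \<open>The fibre product\<close>

text \<open>Makes the inequality for \<open>f\<close> itself an instance of the one for
  covers.\<close>

lemma finite_cover_id:
  assumes S: "riemann_surface S"
  shows "finite_cover S S id"
proof -
  have "covering_map_of (surf_top S) (surf_top S) id"
    unfolding covering_map_of_def
  proof (intro conjI ballI)
    fix y assume "y \<in> topspace (surf_top S)"
    then show "\<exists>T. y \<in> T \<and> openin (surf_top S) T \<and>
            (\<exists>v. \<Union>v = {x \<in> topspace (surf_top S). id x \<in> T} \<and> (\<forall>V \<in> v. openin (surf_top S) V) \<and> pairwise disjnt v \<and>
             (\<forall>V \<in> v. homeomorphic_map (subtopology (surf_top S) V) (subtopology (surf_top S) T) id))"
      by (intro exI[of _ "topspace (surf_top S)"] conjI exI[of _ "{topspace (surf_top S)}"]) auto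
  qed auto
  moreover have "holomorphic_map_at S S id x" for x
    using S unfolding riemann_surface_def holomorphic_map_at_def by (fastforce simp: Int_def)
  moreover have "surf_punctures S \<subseteq> topspace (surf_top S)" using S by (auto simp: riemann_surface_def)
  moreover have "{x \<in> topspace (surf_top S). id x = s} \<subseteq> {s}" for s by auto
  then have "finite {x \<in> topspace (surf_top S). id x = s}" for s by (meson finite.emptyI finite.insertI finite_subset)
  ultimately show ?thesis using S by (auto simp: finite_cover_def)
qed

context
  fixes R :: "'a surf" and S :: "'b surf" and St :: "'d surf" and f :: "'a \<Rightarrow> 'b" and p :: "'d \<Rightarrow> 'b"
  assumes R: "riemann_surface R" and S: "riemann_surface S" and f: "conformal_embedding R S f"
    and cov: "finite_cover St S p"
begin

abbreviation (input) fibre where "fibre \<equiv> pullback_surf R St f p"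

lemma pullback_surf_simps:
  "surf_top fibre = subtopology (prod_topology (surf_top R) (surf_top St)) {x. f (fst x) = p (snd x)}"
  "surf_atlas fibre = {(W, \<phi> \<circ> fst) | W U \<phi>. (U, \<phi>) \<in> surf_atlas R \<and> openin (surf_top fibre) W \<and> inj_on fst W \<and> fst ` W \<subseteq> U}"
  "surf_punctures fibre = {x \<in> topspace (surf_top fibre). fst x \<in> surf_punctures R}"
  by (simp_all add: pullback_surf_def Let_def case_prod_unfold)

lemma topspace_pullback:
  "x \<in> topspace (surf_top fibre) \<longleftrightarrow> fst x \<in> topspace (surf_top R) \<and> snd x \<in> topspace (surf_top St) \<and> f (fst x) = p (snd x)"
  by (cases x) (auto simp: pullback_surf_simps(1))

lemma continuous_map_pullback:
  "continuous_map (surf_top fibre) (surf_top R) fst" "continuous_map (surf_top fibre) (surf_top St) snd"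
  unfolding pullback_surf_simps(1)
  by (auto intro: continuous_map_from_subtopology continuous_map_fst continuous_map_snd)

text \<open>With \<open>h\<close> inverse to \<open>p\<close> on a sheet \<open>V\<close>, the map
  taking \<open>r\<close> to \<open>(r, h (f r))\<close> is a local section of \<open>fst\<close>
  through \<open>x\<close>. Injectivity of \<open>p\<close> on \<open>V\<close> is recorded because
  it makes \<open>fst\<close> injective where the second coordinate lies in
  \<open>V\<close>.\<close>

lemma pullback_sheet:
  assumes x: "x \<in> topspace (surf_top fibre)"
  obtains V N g where "snd x \<in> V" "openin (surf_top St) V" "fst x \<in> N" "openin (surf_top R) N"
    "continuous_map (subtopology (surf_top R) N) (surf_top fibre) g" "g (fst x) = x" "\<And>r. r \<in> N \<Longrightarrow> fst (g r) = r"
    "\<And>s t. s \<in> V \<Longrightarrow> t \<in> V \<Longrightarrow> p s = p t \<Longrightarrow> s = t"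
proof -
  note cD = finite_coverD[OF cov]
  note fD = conformal_embeddingD[OF f]
  have x': "fst x \<in> topspace (surf_top R)" "snd x \<in> topspace (surf_top St)" "f (fst x) = p (snd x)"
    using x by (simp_all add: topspace_pullback)
  have "p (snd x) \<in> topspace (surf_top S)" using cD(7) x'(2) by (auto simp: continuous_map_def)
  then obtain T where T: "p (snd x) \<in> T" "openin (surf_top S) T"
    "\<And>s. s \<in> topspace (surf_top St) \<Longrightarrow> p s \<in> T \<Longrightarrow>
       \<exists>V g. s \<in> V \<and> openin (surf_top St) V \<and> homeomorphic_maps (subtopology (surf_top St) V) (subtopology (surf_top S) T) p g"
    by (rule covering_map_of_sheet[OF cD(2)]) blast
  obtain V h where V: "snd x \<in> V" "openin (surf_top St) V"
      and h: "homeomorphic_maps (subtopology (surf_top St) V) (subtopology (surf_top S) T) p h"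
    using T(3)[OF x'(2) T(1)] by blast
  have ts: "topspace (subtopology (surf_top St) V) = V" "topspace (subtopology (surf_top S) T) = T"
    using openin_subset[OF V(2)] openin_subset[OF T(2)] by auto
  have hc: "continuous_map (subtopology (surf_top S) T) (subtopology (surf_top St) V) h"
    and hp: "\<And>s. s \<in> V \<Longrightarrow> h (p s) = s" and ph: "\<And>y. y \<in> T \<Longrightarrow> p (h y) = y"
    using h unfolding homeomorphic_maps_def ts by blast+
  define N where "N = {r \<in> topspace (surf_top R). f r \<in> T}"
  have N: "openin (surf_top R) N" unfolding N_def by (rule openin_continuous_map_preimage[OF fD(1) T(2)])
  define g where "g = (\<lambda>r. (r, h (f r)))"
  have "continuous_map (subtopology (surf_top R) N) (subtopology (surf_top S) T) f"
    using continuous_map_from_subtopology[OF fD(1), of N] by (auto simp: continuous_map_in_subtopology N_def)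
  then have "continuous_map (subtopology (surf_top R) N) (subtopology (surf_top St) V) (h \<circ> f)"
    using hc by (rule continuous_map_compose)
  then have "continuous_map (subtopology (surf_top R) N) (surf_top St) (\<lambda>r. h (f r))"
    using continuous_map_into_fulltopology by (fastforce simp: o_def)
  moreover have "continuous_map (subtopology (surf_top R) N) (surf_top R) (\<lambda>r. r)"
    using continuous_map_from_subtopology[OF continuous_map_id] by (simp add: id_def)
  ultimately have "continuous_map (subtopology (surf_top R) N) (prod_topology (surf_top R) (surf_top St)) g"
    unfolding g_def by (simp add: continuous_map_paired)
  then have "continuous_map (subtopology (surf_top R) N) (surf_top fibre) g"
    unfolding pullback_surf_simps(1) using ph by (auto simp: continuous_map_in_subtopology g_def N_def)
  moreover have "g (fst x) = x" using hp[OF V(1)] x'(3) by (simp add: g_def prod_eq_iff)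
  moreover have "fst x \<in> N" using x' T(1) by (simp add: N_def)
  moreover have "s = t" if "s \<in> V" "t \<in> V" "p s = p t" for s t using hp that by metis
  ultimately show ?thesis using that[OF V _ N] by (simp add: g_def)
qed

lemma openin_fst_pullback:
  assumes W: "openin (surf_top fibre) W"
  shows "openin (surf_top R) (fst ` W)"
proof (subst openin_subopen, intro ballI)
  fix r assume "r \<in> fst ` W"
  then obtain x where x: "x \<in> W" "r = fst x" by blast
  then have "x \<in> topspace (surf_top fibre)" using openin_subset[OF W] by blast
  then obtain V N g where "snd x \<in> V" "openin (surf_top St) V" and N: "fst x \<in> N" "openin (surf_top R) N"
    and g: "continuous_map (subtopology (surf_top R) N) (surf_top fibre) g" "g (fst x) = x" "\<And>r. r \<in> N \<Longrightarrow> fst (g r) = r"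
    by (rule pullback_sheet) blast
  let ?N = "{r \<in> N. g r \<in> W}"
  have "openin (subtopology (surf_top R) N) {r \<in> topspace (subtopology (surf_top R) N). g r \<in> W}"
    by (rule openin_continuous_map_preimage[OF g(1) W])
  moreover have "topspace (subtopology (surf_top R) N) = N" using openin_subset[OF N(2)] by auto
  ultimately have "openin (subtopology (surf_top R) N) ?N" by (simp only:)
  then have "openin (surf_top R) ?N" using N(2) by (simp add: openin_open_subtopology)
  moreover have "?N \<subseteq> fst ` W"
  proof
    fix t assume "t \<in> ?N"
    then have "fst (g t) = t" "g t \<in> W" using g(3) by auto
    then show "t \<in> fst ` W" by (metis imageI)
  qed
  moreover have "r \<in> ?N" using x N(1) g(2) by simp
  ultimately show "\<exists>T. openin (surf_top R) T \<and> r \<in> T \<and> T \<subseteq> fst ` W" by blast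
qed

lemma pullback_chart_exists:
  assumes x: "x \<in> topspace (surf_top fibre)" and a: "(U, \<phi>) \<in> surf_atlas R" "fst x \<in> U"
  obtains W where "x \<in> W" "(W, \<phi> \<circ> fst) \<in> surf_atlas fibre"
proof -
  note R' = riemann_surface_imp_charted[OF R]
  obtain V N g where V: "snd x \<in> V" "openin (surf_top St) V" "\<And>s t. s \<in> V \<Longrightarrow> t \<in> V \<Longrightarrow> p s = p t \<Longrightarrow> s = t"
    by (rule pullback_sheet[OF x]) blast
  define W where "W = {y \<in> topspace (surf_top fibre). fst y \<in> U} \<inter> {y \<in> topspace (surf_top fibre). snd y \<in> V}"
  have "openin (surf_top fibre) W" unfolding W_def
    by (intro openin_Int openin_continuous_map_preimage[OF continuous_map_pullback(1) openin_chart[OF R' a(1)]]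
        openin_continuous_map_preimage[OF continuous_map_pullback(2) V(2)])
  moreover have "inj_on fst W"
  proof (rule inj_onI)
    fix y z assume "y \<in> W" "z \<in> W" "fst y = fst z"
    then show "y = z" using V(3)[of "snd y" "snd z"] by (auto simp: W_def topspace_pullback prod_eq_iff)
  qed
  moreover have "fst ` W \<subseteq> U" by (auto simp: W_def)
  ultimately have "(W, \<phi> \<circ> fst) \<in> surf_atlas fibre" unfolding pullback_surf_simps(2) using a(1) by blast
  moreover have "x \<in> W" using x a(2) V(1) by (simp add: W_def)
  ultimately show ?thesis using that by blast
qed

text \<open>Compactness comes from closedness in the product, since the equation
  \<open>f r = p s\<close> is between values in a Hausdorff space. The chart conditions pass from
  \<open>R\<close> through \<open>fst\<close>, which is injective on chart domains and open.\<close>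

lemma charted_surface_pullback: "charted_surface fibre"
proof -
  note R' = riemann_surface_imp_charted[OF R]
  note St' = riemann_surface_imp_charted[OF finite_coverD(1)[OF cov]]
  note fD = conformal_embeddingD[OF f]
  let ?prod = "prod_topology (surf_top R) (surf_top St)"
  have T: "surf_top fibre = subtopology ?prod {x \<in> topspace ?prod. (f \<circ> fst) x = (p \<circ> snd) x}"
  proof -
    have "{x \<in> topspace ?prod. (f \<circ> fst) x = (p \<circ> snd) x} = topspace ?prod \<inter> {x. f (fst x) = p (snd x)}" by auto
    then show ?thesis unfolding pullback_surf_simps(1) by (simp only: subtopology_restrict)
  qed
  have "Hausdorff_space (surf_top S)" using S by (simp add: riemann_surface_def)
  then have "closedin ?prod {x \<in> topspace ?prod. (f \<circ> fst) x = (p \<circ> snd) x}"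
    by (rule closedin_continuous_maps_eq)
       (rule continuous_map_compose[OF continuous_map_fst fD(1)], rule continuous_map_compose[OF continuous_map_snd finite_coverD(7)[OF cov]])
  moreover have "compact_space ?prod"
    using charted_surface_compact[OF R'] charted_surface_compact[OF St'] by (simp add: compact_space_prod_topology)
  ultimately have comp: "compact_space (surf_top fibre)"
    unfolding T by (intro compact_space_subtopology closedin_compact_space)
  have cl: "closedin (surf_top fibre) (surf_punctures fibre)"
    unfolding pullback_surf_simps(3)
    by (rule closedin_continuous_map_preimage[OF continuous_map_pullback(1) charted_surface_closedin_punctures[OF R']])
  have ch: "openin (surf_top fibre) W \<and> inj_on \<theta> W \<and> \<theta> ` W \<subseteq> half_plane \<and>
        continuous_map (subtopology (surf_top fibre) W) euclidean \<theta> \<and>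
        (\<forall>W'. openin (surf_top fibre) W' \<longrightarrow> W' \<subseteq> W \<longrightarrow> openin (top_of_set half_plane) (\<theta> ` W'))"
    if wa: "(W, \<theta>) \<in> surf_atlas fibre" for W \<theta>
  proof -
    obtain U \<phi> where a: "\<theta> = \<phi> \<circ> fst" "(U, \<phi>) \<in> surf_atlas R" "openin (surf_top fibre) W" "inj_on fst W" "fst ` W \<subseteq> U"
      using wa unfolding pullback_surf_simps(2) by blast
    have "inj_on \<theta> W" unfolding a(1)
      by (rule comp_inj_on[OF a(4) inj_on_subset[OF inj_on_chart[OF R' a(2)] a(5)]])
    moreover have "\<theta> ` W \<subseteq> half_plane" unfolding a(1) image_comp[symmetric]
      using chart_half_plane[OF R' a(2)] a(5) by blast
    moreover have "continuous_map (subtopology (surf_top fibre) W) (subtopology (surf_top R) U) fst"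
      using continuous_map_from_subtopology[OF continuous_map_pullback(1), of W] a(5)
      by (auto simp: continuous_map_in_subtopology)
    then have "continuous_map (subtopology (surf_top fibre) W) euclidean \<theta>" unfolding a(1)
      by (rule continuous_map_compose[OF _ continuous_map_chart[OF R' a(2)]])
    moreover have "openin (top_of_set half_plane) (\<theta> ` W')" if "openin (surf_top fibre) W'" "W' \<subseteq> W" for W'
      unfolding a(1) image_comp[symmetric]
      by (rule openin_chart_image[OF R' a(2) openin_fst_pullback[OF that(1)]]) (use that(2) a(5) in blast)
    ultimately show ?thesis using a(3) by blast
  qed
  have "(\<Union>(W, \<theta>) \<in> surf_atlas fibre. W) = topspace (surf_top fibre)"
  proof (intro equalityI subsetI)
    fix x assume "x \<in> (\<Union>(W, \<theta>) \<in> surf_atlas fibre. W)"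
    then obtain W \<theta> where W: "(W, \<theta>) \<in> surf_atlas fibre" "x \<in> W" by auto
    then have "openin (surf_top fibre) W" using ch by simp
    then show "x \<in> topspace (surf_top fibre)" using W(2) openin_subset by blast
  next
    fix x assume x: "x \<in> topspace (surf_top fibre)"
    then have "fst x \<in> topspace (surf_top R)" by (simp add: topspace_pullback)
    then obtain U \<phi> where "(U, \<phi>) \<in> surf_atlas R" "fst x \<in> U" using charted_surface_covered[OF R'] by blast
    then obtain W where "x \<in> W" "(W, \<phi> \<circ> fst) \<in> surf_atlas fibre" by (rule pullback_chart_exists[OF x]) blast
    then show "x \<in> (\<Union>(W, \<theta>) \<in> surf_atlas fibre. W)" by auto
  qed
  moreover have "\<forall>(W, \<theta>) \<in> surf_atlas fibre. openin (surf_top fibre) W \<and> inj_on \<theta> W \<and> \<theta> ` W \<subseteq> half_plane \<and>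
        continuous_map (subtopology (surf_top fibre) W) euclidean \<theta> \<and>
        (\<forall>W'. openin (surf_top fibre) W' \<longrightarrow> W' \<subseteq> W \<longrightarrow> openin (top_of_set half_plane) (\<theta> ` W'))"
    by (intro ballI, clarify) (rule ch)
  ultimately show ?thesis unfolding charted_surface_def using comp cl by (intro conjI)
qed

text \<open>A chart of \<open>R\<close> at \<open>fst x\<close> lifts to a chart at \<open>x\<close>
  with the same coordinate, so a boundary point of \<open>R\<close> can only lie below a boundary
  point. For the second coordinate, \<open>p (snd x)\<close> is interior in \<open>S\<close>, and
  interior points lift to interior points.\<close>

lemma pullback_interior:
  assumes x: "x \<in> surf_interior fibre"
  shows "fst x \<in> surf_interior R" "snd x \<in> surf_interior St" "p (snd x) = f (fst x)"
proof -
  have xt: "x \<in> topspace (surf_top fibre)" using x by (simp add: surf_interior_def)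
  then have x': "fst x \<in> topspace (surf_top R)" "snd x \<in> topspace (surf_top St)" "f (fst x) = p (snd x)"
    by (simp_all add: topspace_pullback)
  have "fst x \<notin> surf_boundary R"
  proof
    assume "fst x \<in> surf_boundary R"
    then obtain U \<phi> where a: "(U, \<phi>) \<in> surf_atlas R" "fst x \<in> U" "Im (\<phi> (fst x)) = 0"
      unfolding surf_boundary_def by auto
    obtain W where "x \<in> W" "(W, \<phi> \<circ> fst) \<in> surf_atlas fibre" by (rule pullback_chart_exists[OF xt a(1,2)])
    then have "x \<in> surf_boundary fibre" unfolding surf_boundary_def using a(3)
      by (intro CollectI bexI[of _ "(W, \<phi> \<circ> fst)"]) auto
    then show False using x by (simp add: surf_interior_def)
  qed
  moreover have "fst x \<notin> surf_punctures R"
    using x xt by (auto simp: surf_interior_def pullback_surf_simps(3))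
  ultimately show r: "fst x \<in> surf_interior R" using x'(1) by (simp add: surf_interior_def)
  show "p (snd x) = f (fst x)" using x'(3) by simp
  then show "snd x \<in> surf_interior St"
    using r conformal_embeddingD(2)[OF f] by (intro cover_interior[OF S cov x'(2)]) auto
qed

text \<open>Read in a chart of the fibre product, \<open>snd\<close> is a lift through
  \<open>p\<close> of \<open>f\<close> read in the underlying chart of \<open>R\<close>, so
  holomorphy of lifts applies.\<close>

lemma pullback_holomorphic:
  assumes x: "x \<in> surf_interior fibre"
  shows "holomorphic_map_at fibre St snd x"
  unfolding holomorphic_map_at_def
proof (clarify)
  fix W \<theta> V \<psi> assume b: "(W, \<theta>) \<in> surf_atlas fibre" and c: "(V, \<psi>) \<in> surf_atlas St" and xW: "x \<in> W" "snd x \<in> V"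
  note R' = riemann_surface_imp_charted[OF R] and P' = charted_surface_pullback
  obtain U \<phi> where a: "\<theta> = \<phi> \<circ> fst" "(U, \<phi>) \<in> surf_atlas R" "openin (surf_top fibre) W" "inj_on fst W" "fst ` W \<subseteq> U"
    using b unfolding pullback_surf_simps(2) by blast
  let ?W = "W \<inter> surf_interior fibre"
  have W: "openin (surf_top fibre) ?W" "?W \<subseteq> W" "?W \<inter> surf_boundary fibre = {}"
    using a(3) openin_surf_interior[OF P'] interior_Int_boundary[of ?W fibre] by (auto simp: openin_Int)
  let ?\<Omega> = "\<theta> ` ?W"
  have op: "open ?\<Omega>" by (rule open_chart_image[OF P' b W])
  have inv: "inv_into W \<theta> (\<theta> y) = y" if "y \<in> W" for y using inj_on_chart[OF P' b] that by (rule inv_into_f_f)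
  have invU: "inv_into U \<phi> (\<phi> r) = r" if "r \<in> U" for r using inj_on_chart[OF R' a(2)] that by (rule inv_into_f_f)
  have sub: "?\<Omega> \<subseteq> \<phi> ` (U \<inter> surf_interior R)"
    unfolding a(1) image_comp[symmetric] using a(5) pullback_interior(1) by (intro image_mono) auto
  have k: "conformal_param S ?\<Omega> (f \<circ> inv_into U \<phi>)"
    by (rule conformal_param_subset[OF conformal_param_comp_chart[OF R' S conformal_embeddingD[OF f] a(2)] op sub])
  have "conformal_param St ?\<Omega> (snd \<circ> inv_into W \<theta>)"
  proof (rule conformal_param_lift[OF S cov k])
    show "continuous_map (top_of_set ?\<Omega>) (surf_top St) (snd \<circ> inv_into W \<theta>)"
      by (rule continuous_map_compose[OF continuous_map_inv_chart[OF P' b W] continuous_map_pullback(2)])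
    fix z assume "z \<in> ?\<Omega>"
    then obtain y where y: "y \<in> ?W" "z = \<theta> y" by blast
    moreover have "fst y \<in> U" using y a(5) by blast
    ultimately show "p ((snd \<circ> inv_into W \<theta>) z) = (f \<circ> inv_into U \<phi>) z"
      using inv[of y] invU[of "fst y"] pullback_interior(3)[of y] a(1) by simp
  qed
  note G = this
  let ?\<Omega>' = "{z \<in> ?\<Omega>. (snd \<circ> inv_into W \<theta>) z \<in> V}"
  have "open ?\<Omega>'" by (rule open_param_preimage[OF G openin_chart[OF riemann_surface_imp_charted[OF finite_coverD(1)[OF cov]] c]])
  moreover have "\<theta> x \<in> ?\<Omega>'" using x xW inv by auto
  ultimately obtain e where e: "0 < e" "ball (\<theta> x) e \<subseteq> ?\<Omega>'" unfolding open_contains_ball by blast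
  show "holomorphic_in_chart \<theta> {y \<in> W. snd y \<in> V} x (\<lambda>y. \<psi> (snd y))"
    unfolding holomorphic_in_chart_def
  proof (intro exI conjI ballI impI)
    show "(\<lambda>z. \<psi> ((snd \<circ> inv_into W \<theta>) z)) holomorphic_on ball (\<theta> x) e"
      by (rule holomorphic_on_subset[OF conformal_paramD(5)[OF G c] e(2)])
    show "\<psi> (snd y) = \<psi> ((snd \<circ> inv_into W \<theta>) (\<theta> y))" if "y \<in> {y \<in> W. snd y \<in> V}" for y
      using inv that by simp
  qed (rule e(1))
qed

text \<open>Two points of the interior with the same second coordinate have first coordinates with
  the same image under \<open>f\<close>, hence coincide. So \<open>snd\<close> embeds the interior
  into the part of the cover above the image of \<open>f\<close>, and the area can be measured
  there.\<close>

lemma area_pullback_cover: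
  assumes q: "quadratic_differential St q"
  shows "area fibre (pullback_qd fibre St snd q) \<le> cover_area St q p (f ` surf_interior R)"
proof -
  note fD = conformal_embeddingD[OF f]
  note R' = riemann_surface_imp_charted[OF R]
  have "area fibre (pullback_qd fibre St snd q) = emeasure (area_measure St q) (snd ` surf_interior fibre)"
  proof (rule area_pullback[OF charted_surface_pullback finite_coverD(1)[OF cov] q continuous_map_pullback(2)])
    show "snd ` surf_interior fibre \<subseteq> surf_interior St" using pullback_interior(2) by blast
    show "inj_on snd (surf_interior fibre)"
    proof (rule inj_onI)
      fix x y assume xy: "x \<in> surf_interior fibre" "y \<in> surf_interior fibre" "snd x = snd y"
      then have "f (fst x) = f (fst y)" using pullback_interior(3)[of x] pullback_interior(3)[of y] by simp
      then have "fst x = fst y" by (rule inj_onD[OF fD(3) _ pullback_interior(1)[OF xy(1)] pullback_interior(1)[OF xy(2)]])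
      then show "x = y" using xy(3) by (simp add: prod_eq_iff)
    qed
  qed (rule pullback_holomorphic)
  also have "\<dots> \<le> cover_area St q p (f ` surf_interior R)"
  proof (rule emeasure_mono)
    show "snd ` surf_interior fibre \<subseteq> {y \<in> surf_interior St. p y \<in> f ` surf_interior R}"
      using pullback_interior by auto
    show "{y \<in> surf_interior St. p y \<in> f ` surf_interior R} \<in> sets (area_measure St q)"
      by (rule cover_preimage_sets[OF cov q openin_conformal_image[OF R' S fD openin_surf_interior[OF R'] order_refl]])
  qed
  finally show ?thesis .
qed

end

theorem theorem4:
  fixes R :: "'a surf" and S :: "'b surf" and f :: "'a \<Rightarrow> 'b"
  assumes "riemann_surface R" and "riemann_surface S"
    and "annular_embedding TYPE('c) R S f"
    and "\<forall>C \<in> connected_components_of (surf_top R). C \<inter> surf_boundary R \<noteq> {}"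
  shows "\<exists>K :: real. 0 \<le> K \<and> K < 1 \<and>
    (\<forall>q \<in> QD S. area R (pullback_qd R S f q) \<le> ennreal K * area S q) \<and>
    (\<forall>(St :: ('b \<times> nat) surf) p. finite_cover St S p \<longrightarrow>
       (\<forall>q \<in> QD St.
          area (pullback_surf R St f p) (pullback_qd (pullback_surf R St f p) St snd q)
            \<le> ennreal K * area St q))"
proof -
  have f: "conformal_embedding R S f" using assms(3) unfolding annular_embedding_def by blast
  note R' = riemann_surface_imp_charted[OF assms(1)]
  obtain K1 :: real where K1: "0 \<le> K1" "K1 < 1" "\<And>(St :: 'b surf) p q. finite_cover St S p \<Longrightarrow> q \<in> QD St \<Longrightarrow>
    cover_area St q p (f ` surf_interior R) \<le> ennreal K1 * area St q"
    using uniform_area_bound[OF assms] by blast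
  obtain K2 :: real where K2: "0 \<le> K2" "K2 < 1" "\<And>(St :: ('b \<times> nat) surf) p q. finite_cover St S p \<Longrightarrow> q \<in> QD St \<Longrightarrow>
    cover_area St q p (f ` surf_interior R) \<le> ennreal K2 * area St q"
    using uniform_area_bound[OF assms] by blast
  \<comment> \<open>The uniform bound is for one carrier type at a time: \<open>K1\<close> is for
    covers on the type of \<open>S\<close> itself and is applied to the identity, \<open>K2\<close>
    is for covers on \<open>'b \<times> nat\<close>.\<close>
  define K where "K = max K1 K2"
  have K: "ennreal K1 * t \<le> ennreal K * t" "ennreal K2 * t \<le> ennreal K * t" for t
    by (auto intro!: mult_right_mono ennreal_leI simp: K_def)
  have "area R (pullback_qd R S f q) \<le> ennreal K * area S q" if q: "q \<in> QD S" for q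
  proof -
    have q': "quadratic_differential S q" using q by (simp add: QD_def)
    have "area R (pullback_qd R S f q) = emeasure (area_measure S q) (f ` surf_interior R)"
      by (rule area_pullback[OF R' assms(2) q' conformal_embeddingD[OF f]])
    also have "f ` surf_interior R = {y \<in> surf_interior S. id y \<in> f ` surf_interior R}"
      using conformal_embeddingD(2)[OF f] by auto
    also have "emeasure (area_measure S q) \<dots> \<le> ennreal K1 * area S q"
      by (rule K1(3)[OF finite_cover_id[OF assms(2)] q])
    finally show ?thesis using K(1) order_trans by blast
  qed
  moreover have "area (pullback_surf R St f p) (pullback_qd (pullback_surf R St f p) St snd q) \<le> ennreal K * area St q"
    if cov: "finite_cover St S p" and q: "q \<in> QD St" for St :: "('b \<times> nat) surf" and p q
  proof -
    have q': "quadratic_differential St q" using q by (simp add: QD_def)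
    show ?thesis
      by (rule order_trans[OF area_pullback_cover[OF assms(1,2) f cov q'] order_trans[OF K2(3)[OF cov q] K(2)]])
  qed
  moreover have "0 \<le> K" "K < 1" using K1 K2 by (simp_all add: K_def)
  ultimately show ?thesis by blast
qed

end
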